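(* Let $m$ and $n$ be positive integers. The order of the rowmotion operator $\mathrm{Row}\colon\mathrm{Tam}_n(m)\to\mathrm{Tam}_n(m)$ on the $n$-th $m$-Tamari lattice is $(m+1)n$. Moreover, the triple $(\mathrm{Tam}_n(m),\mathrm{Row},\mathrm{Cat}^{(m)}_n(q))$ exhibits the cyclic sieving phenomenon, where \[\mathrm{Cat}^{(m)}_n(q)=\frac{1}{[(m+1)n+1]_q}{(m+1)n+1\brack n}_q.\]
   Context: Intervals are integer intervals: $[a,b]=\{a,\dots,b\}$ (empty if $a>b$), $[b]=[1,b]$. Vectors are indexed from $0$. $m$-Tamari lattice. Let $\ell=(m+1)n$. $\mathrm{Tam}_n(m)$ is the set of integer vectors $\mathsf b=(\mathsf b_0,\dots,\mathsf b_\ell)$ such that (I) $\mathsf b_{(m+1)k}=k$ for all $k\in[0,n]$; (II) $s+1\le \mathsf b_{(m+1)s+t}\le n$ for all $s\in[0,n-1]$, $t\in[m+1]$; (III) if $\mathsf b_i=k$, then $\mathsf b_j\le k$ for all $j\in[i+1,(m+1)k]$. It is ordered componentwise; it is a finite semidistributive lattice whose meet is the componentwise minimum. Rowmotion on a finite semidistributive lattice. A lattice $L$ is semidistributive if for all $x,y,z\in L$: $x\vee y=x\vee z$ implies $x\vee(y\wedge z)=x\vee y$, and $x\wedge y=x\wedge z$ implies $x\wedge(y\vee z)=x\wedge y$. Let $L$ be a finite semidistributive lattice. An element $j$ is join-irreducible if it covers exactly one element, denoted $j_*$; for such $j$, the set $\{z\in L:z\wedge j=j_*\}$ has a maximum,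 denoted $\kappa(j)$. For each cover relation $x\lessdot y$ there is a unique join-irreducible $j_{xy}$ with $j_{xy}\le y$ and $\kappa(j_{xy})\ge x$. Put $\mathcal D(z)=\{j_{xz}:x\lessdot z\}$ and $\mathcal U(z)=\{j_{zy}:z\lessdot y\}$. For each $x\in L$ there is a unique element $\mathrm{Row}(x)\in L$ with $\mathcal U(\mathrm{Row}(x))=\mathcal D(x)$; this defines a bijection $\mathrm{Row}\colon L\to L$. $q$-analogues: $[k]_q=1+q+\cdots+q^{k-1}$, $[k]_q!=[k]_q\cdots[1]_q$, ${k\brack r}_q=\frac{[k]_q!}{[r]_q![k-r]_q!}$; $\mathrm{Cat}^{(m)}_n(q)$ is a polynomial in $q$. Order and cyclic sieving. For a finite set $X$ and an invertible map $f\colon X\to X$, the order $\omega$ of $f$ is the smallest positive integer with $f^\omega(x)=x$ for all $x\in X$. For $F(q)\in\mathbb C[q]$, the triple $(X,f,F(q))$ exhibits the cyclic sieving phenomenon if for all integers $d$, the number of elements of $X$ fixed by $f^d$ equals $F(e^{2\pi i d/\omega})$.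
   Formalization: The order claim is false for n=1 (one point) and n=2 (order m+1), and sieving fails for n=2, m odd. Proved: for all m,n, Row^{(m+1)n}=id and sieving with (m+1)n in place of ω; for n≥3, the order is exactly (m+1)n and sieving holds as stated. *)

theory Defs
  imports
    Complex_Main
    "HOL-Algebra.Lattice"
    "HOL-Computational_Algebra.Polynomial"
begin

section \<open>Rowmotion on a finite semidistributive lattice\<close>

text \<open>
  The definite descriptions in this section denote what they should when \<open>L\<close> is a finite
  semidistributive lattice, in the sense of the locale \<^locale>\<open>lattice\<close> and with
  \<open>eq L\<close> being equality; nothing is claimed about other \<open>L\<close>.
\<close>

definition covers :: "('a, 'b) gorder_scheme \<Rightarrow> 'a \<Rightarrow> 'a \<Rightarrow> bool" where
  "covers L x y \<longleftrightarrow> x \<in> carrier L \<and> y \<in> carrier L \<and> x \<sqsubset>\<^bsub>L\<^esub> y \<and>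
     \<not> (\<exists>z\<in>carrier L. x \<sqsubset>\<^bsub>L\<^esub> z \<and> z \<sqsubset>\<^bsub>L\<^esub> y)" \<comment> \<open>\<open>y\<close> is the upper element\<close>

definition join_irreducible :: "('a, 'b) gorder_scheme \<Rightarrow> 'a \<Rightarrow> bool" where
  "join_irreducible L j \<longleftrightarrow> j \<in> carrier L \<and> (\<exists>!x. covers L x j)"

definition lower_cover :: "('a, 'b) gorder_scheme \<Rightarrow> 'a \<Rightarrow> 'a" where
  "lower_cover L j = (THE x. covers L x j)"

definition kappa :: "('a, 'b) gorder_scheme \<Rightarrow> 'a \<Rightarrow> 'a" where
  "kappa L j = (THE k. greatest L k {z \<in> carrier L. z \<sqinter>\<^bsub>L\<^esub> j = lower_cover L j})"

definition edge_label :: "('a, 'b) gorder_scheme \<Rightarrow> 'a \<Rightarrow> 'a \<Rightarrow> 'a" where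
  "edge_label L x y = (THE j. join_irreducible L j \<and> j \<sqsubseteq>\<^bsub>L\<^esub> y \<and> x \<sqsubseteq>\<^bsub>L\<^esub> kappa L j)"

definition down_labels :: "('a, 'b) gorder_scheme \<Rightarrow> 'a \<Rightarrow> 'a set" where
  "down_labels L z = {edge_label L x z | x. covers L x z}"

definition up_labels :: "('a, 'b) gorder_scheme \<Rightarrow> 'a \<Rightarrow> 'a set" where
  "up_labels L z = {edge_label L z y | y. covers L z y}"

definition rowmotion :: "('a, 'b) gorder_scheme \<Rightarrow> 'a \<Rightarrow> 'a" where
  "rowmotion L x = (THE y. y \<in> carrier L \<and> up_labels L y = down_labels L x)"


section \<open>The \<open>m\<close>-Tamari lattices\<close>

definition tamari_vectors :: "nat \<Rightarrow> nat \<Rightarrow> int list set" where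
  "tamari_vectors m n = {b. length b = (m + 1) * n + 1 \<and>
     (\<forall>k\<in>{0..n}. b ! ((m + 1) * k) = int k) \<and>
     (\<forall>s\<in>{0..<n}. \<forall>t\<in>{1..m + 1}.
        int s + 1 \<le> b ! ((m + 1) * s + t) \<and> b ! ((m + 1) * s + t) \<le> int n) \<and>
     (\<forall>i\<in>{0..(m + 1) * n}. \<forall>j. i + 1 \<le> j \<and> int j \<le> (int m + 1) * b ! i \<longrightarrow> b ! j \<le> b ! i)}"

definition tamari_lattice :: "nat \<Rightarrow> nat \<Rightarrow> int list gorder" where
  "tamari_lattice m n = \<lparr>carrier = tamari_vectors m n, eq = (=), le = list_all2 (\<le>)\<rparr>"


section \<open>\<open>q\<close>-analogues\<close>

definition q_int :: "nat \<Rightarrow> complex poly" where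
  "q_int k = (\<Sum>i<k. monom 1 i)"

definition q_fact :: "nat \<Rightarrow> complex poly" where
  "q_fact k = (\<Prod>i=1..k. q_int i)"

text \<open>The polynomial divisions in the next two definitions are exact (for \<open>r \<le> k\<close>).\<close>

definition q_binomial :: "nat \<Rightarrow> nat \<Rightarrow> complex poly" where
  "q_binomial k r = q_fact k div (q_fact r * q_fact (k - r))"

definition q_fuss_catalan :: "nat \<Rightarrow> nat \<Rightarrow> complex poly" where
  "q_fuss_catalan m n = q_binomial ((m + 1) * n + 1) n div q_int ((m + 1) * n + 1)"


section \<open>Order and cyclic sieving\<close>

definition map_order :: "'a set \<Rightarrow> ('a \<Rightarrow> 'a) \<Rightarrow> nat" where
  "map_order X f = (LEAST k. k > 0 \<and> (\<forall>x\<in>X. (f ^^ k) x = x))"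

definition int_iterate :: "'a set \<Rightarrow> ('a \<Rightarrow> 'a) \<Rightarrow> int \<Rightarrow> 'a \<Rightarrow> 'a" where
  "int_iterate X f d = (if d \<ge> 0 then f ^^ nat d else inv_into X f ^^ nat (- d))"

text \<open>
  Cyclic sieving for the action of the cyclic group of order \<open>N\<close> generated by \<open>f\<close>, an action that
  need not be faithful. Cyclic sieving in the strict sense is the case where \<open>N\<close> is the order of \<open>f\<close>.
  The distinction matters for rowmotion on the \<open>n\<close>-th \<open>m\<close>-Tamari lattice only when \<open>n \<le> 2\<close>: that lattice
  is then a chain, and the order of rowmotion is a proper divisor of \<open>(m + 1) * n\<close>.
\<close>

definition csp_with_period :: "'a set \<Rightarrow> ('a \<Rightarrow> 'a) \<Rightarrow> nat \<Rightarrow> complex poly \<Rightarrow> bool" where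
  "csp_with_period X f N F \<longleftrightarrow>
     finite X \<and> bij_betw f X X \<and> N > 0 \<and> (\<forall>x\<in>X. (f ^^ N) x = x) \<and>
     (\<forall>d::int. of_nat (card {x \<in> X. int_iterate X f d x = x}) =
        poly F (exp (2 * of_real pi * \<i> * of_int d / of_nat N)))"

definition exhibits_csp :: "'a set \<Rightarrow> ('a \<Rightarrow> 'a) \<Rightarrow> complex poly \<Rightarrow> bool" where
  "exhibits_csp X f F \<longleftrightarrow> csp_with_period X f (map_order X f) F"

end

theory Submission
  imports Defs "HOL-Computational_Algebra.Primes"
begin

text \<open>
  A Tamari vector is a noncrossing partition of \<open>{1..(m+1)n}\<close> whose block maxima are the multiples of
  \<open>m + 1\<close>, so it is determined by its set of block minima. Marking these gives a ballot word with \<open>n\<close>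
  letters of weight \<open>m\<close> and \<open>m n\<close> letters of weight \<open>- 1\<close>. The canonical join and meet representations show
  that rowmotion acts on words by \<open>1A0B \<mapsto> A1B0\<close> with \<open>A\<close> balanced, which is rotation of the noncrossing
  partition into blocks of size \<open>m + 1\<close> with the given block minima; hence \<open>Row^N = 1\<close> for \<open>N = (m+1)n\<close>.

  Reading the iterates of a word around a cycle of length \<open>N\<close> gives \<open>m n + 1\<close> distinct \<open>n\<close>-subsets, and
  \<open>n\<close> distinct \<open>(n-1)\<close>-subsets after erasing the leading letter. These families are equivariant and
  partition all subsets of the respective size. If \<open>Row^(N/e)\<close> fixes the word, a prime \<open>p\<close> dividing \<open>e\<close> fails to
  divide \<open>m n + 1\<close> or \<open>n\<close>, so an action of the group of order \<open>p\<close> has a fixed point in one of the families,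
  and this fixed point is unique. Counting fixed words thus reduces to counting periodic subsets, and
  the numbers agree with the values of the \<open>q\<close>-Fuss-Catalan polynomial at roots of unity.
\<close>

section \<open>Ballot words and the turn operator\<close>

text \<open>The two subset families mirror the two factorizations
  \<open>Cat * [m n + 1] = binomial(N, n)\<close> and \<open>Cat * [n] = binomial(N, n - 1)\<close>
  of q-analogues: a word accounts for \<open>m n + 1\<close> subsets of size \<open>n\<close> and
  for \<open>n\<close> subsets of size \<open>n - 1\<close>. One family alone would not do, because
  a prime dividing both \<open>e\<close> and the multiplicity defeats the fixed point argument;
  since \<open>n\<close> and \<open>m n + 1\<close> are coprime, one of the two is always usable.
  The obstacle on the combinatorial side is that \<open>turn\<close> is not a cyclic rotation of
  words, as it alters a letter. If the reading position advances with the number of turns, all marks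
  on the cycle rest except one. Some powers of \<open>turn\<close> nevertheless do rotate: those
  that carry a balanced prefix to the back, and, once the leading letter is erased, those that
  return to the block of that letter. These are exactly the sources of coincidences among the
  subsets of one word, so they serve both to count the subsets and to show that different words
  share none.\<close>

definition height :: "nat \<Rightarrow> bool list \<Rightarrow> int" where
  "height m w = (\<Sum>x\<leftarrow>w. if x then int m else - 1)"

definition balanced :: "nat \<Rightarrow> bool list \<Rightarrow> bool" where
  "balanced m w \<longleftrightarrow> height m w = 0 \<and> (\<forall>u v. w = u @ v \<longrightarrow> 0 \<le> height m u)"

text \<open>Turns the first letter that would bring the height below zero into \<open>True\<close>.\<close>

fun fill :: "nat \<Rightarrow> int \<Rightarrow> bool list \<Rightarrow> bool list" where
  "fill m h [] = []"
| "fill m h (x # u) =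
     (if x then True # fill m (h + int m) u
      else if h \<le> 0 then True # u
      else False # fill m (h - 1) u)"

text \<open>On a nonempty balanced word the dropped letter is \<open>True\<close>, so the tail ends
  at height \<open>- m\<close> and, for positive \<open>m\<close>, \<open>fill\<close> does flip a
  letter, which adds \<open>m + 1\<close>; the appended \<open>False\<close> then restores length
  and balance.\<close>

definition turn :: "nat \<Rightarrow> bool list \<Rightarrow> bool list" where
  "turn m w = (if w = [] then [] else fill m 0 (tl w) @ [False])"

lemma height_simps [simp]:
  "height m [] = 0"
  "height m (x # w) = (if x then int m else - 1) + height m w"
  "height m (u @ v) = height m u + height m v"
  by (simp_all add: height_def)

lemma height_count: "height m w = int (Suc m) * int (count_list w True) - int (length w)"
  by (induction w) (auto simp: algebra_simps)

lemma balanced_Nil [simp]: "balanced m []"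
  by (simp add: balanced_def)

lemma balanced_height: "balanced m w \<Longrightarrow> height m w = 0"
  by (simp add: balanced_def)

lemma balanced_prefix: "balanced m (u @ v) \<Longrightarrow> 0 \<le> height m u"
  by (auto simp: balanced_def)

lemma balanced_append:
  assumes "balanced m u" "balanced m v"
  shows "balanced m (u @ v)"
  using assms unfolding balanced_def by (fastforce simp: append_eq_append_conv2)

lemma balanced_append_cancel:
  assumes "balanced m (u @ v)" "height m u = 0"
  shows "balanced m u" "balanced m v"
proof -
  show "balanced m u"
    using assms unfolding balanced_def by auto
  have "0 \<le> height m p" if "v = p @ q" for p q
  proof -
    have "u @ v = (u @ p) @ q" using that by simp
    then have "0 \<le> height m (u @ p)" using assms(1) balanced_prefix by metis
    then show ?thesis using assms(2) by simp
  qed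
  then show "balanced m v"
    using assms unfolding balanced_def by auto
qed

lemma fill_append:
  assumes "\<And>p q. u = p @ q \<Longrightarrow> 0 \<le> h + height m p"
  shows "fill m h (u @ v) = u @ fill m (h + height m u) v"
  using assms
proof (induction u arbitrary: h)
  case (Cons x u)
  have *: "0 \<le> (h + (if x then int m else - 1)) + height m p" if "u = p @ q" for p q
    using Cons.prems[of "x # p" q] that by (simp add: algebra_simps)
  have "0 \<le> h + (if x then int m else - 1)"
    using *[of "[]" u] by simp
  moreover have "fill m (h + (if x then int m else - 1)) (u @ v)
      = u @ fill m (h + (if x then int m else - 1) + height m u) v"
    by (rule Cons.IH) (use * in blast)
  ultimately show ?case
    by (cases x) (auto simp: algebra_simps)
qed simp

lemma turn_eq:
  assumes "balanced m A"
  shows "turn m (True # A @ False # B) = A @ True # B @ [False]"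
proof -
  have "fill m 0 (A @ False # B) = A @ fill m (0 + height m A) (False # B)"
    by (rule fill_append) (use assms balanced_prefix in auto)
  then show ?thesis using balanced_height[OF assms] by (simp add: turn_def)
qed

text \<open>Down steps have size one, so the shortest prefix of negative height ends with a
  \<open>False\<close> that starts from height exactly 0.\<close>

lemma first_passage:
  assumes "u = p @ q" "height m p < 0"
  shows "\<exists>A B. u = A @ False # B \<and> balanced m A"
proof -
  define l where "l = (LEAST l. \<exists>p q. u = p @ q \<and> length p = l \<and> height m p < 0)"
  have "\<exists>p q. u = p @ q \<and> length p = l \<and> height m p < 0"
    unfolding l_def by (rule LeastI[of _ "length p"]) (use assms in blast)
  then obtain p' q' where p': "u = p' @ q'" "length p' = l" "height m p' < 0" by blast
  have small: "0 \<le> height m a" if "u = a @ b" "length a < l" for a b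
    using not_less_Least[of "length a" "\<lambda>l. \<exists>p q. u = p @ q \<and> length p = l \<and> height m p < 0"]
      that unfolding l_def by (metis linorder_not_less)
  have "p' \<noteq> []" using p' by auto
  then obtain A x where Ax: "p' = A @ [x]" by (metis append_butlast_last_id)
  have nonneg: "0 \<le> height m a" if "A = a @ b" for a b
    using small[of a "b @ x # q'"] that p' Ax by auto
  have "0 \<le> height m A" using nonneg by auto
  with p'(3) Ax have x: "\<not> x" and "height m A = 0" by (auto split: if_splits)
  then have "balanced m A" unfolding balanced_def using nonneg by auto
  then show ?thesis using p'(1) Ax x by auto
qed

lemma balanced_hd:
  assumes "balanced m w" "w \<noteq> []"
  shows "\<exists>u. w = True # u"
proof (cases w)
  case (Cons x u)
  have "0 \<le> height m [x]"
    using assms(1) Cons balanced_prefix[of m "[x]" u] by simp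
  then show ?thesis using Cons by (auto split: if_splits)
qed (use assms in simp)

text \<open>Deleting the leading \<open>True\<close> leaves total height \<open>- m < 0\<close>, so
  there is a first passage below zero; its letter is the one that \<open>turn\<close> flips.\<close>

lemma balanced_decomp:
  assumes "0 < m" "balanced m w" "w \<noteq> []"
  obtains A B where "w = True # A @ False # B" "balanced m A"
proof -
  obtain u where u: "w = True # u" using balanced_hd[OF assms(2,3)] by blast
  have "height m u < 0" using balanced_height[OF assms(2)] u assms(1) by simp
  then obtain A B where "u = A @ False # B" "balanced m A"
    using first_passage[of u u "[]" m] by auto
  then show ?thesis using u that by blast
qed

lemma length_turn: "0 < m \<Longrightarrow> balanced m w \<Longrightarrow> length (turn m w) = length w"
  by (cases "w = []") (simp add: turn_def, auto simp: turn_eq elim!: balanced_decomp)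

lemma balanced_iff:
  "balanced m w \<longleftrightarrow> height m w = 0 \<and> (\<forall>i\<le>length w. 0 \<le> height m (take i w))"
proof
  assume "balanced m w"
  then show "height m w = 0 \<and> (\<forall>i\<le>length w. 0 \<le> height m (take i w))"
    unfolding balanced_def by (metis append_take_drop_id)
next
  assume "height m w = 0 \<and> (\<forall>i\<le>length w. 0 \<le> height m (take i w))"
  moreover have "u = take (length u) w \<and> length u \<le> length w" if "w = u @ v" for u v
    using that by auto
  ultimately show "balanced m w" unfolding balanced_def by metis
qed

text \<open>\<open>A\<close> has height 0, so cutting it out keeps the other prefix heights, and
  moving the \<open>False\<close> behind \<open>B\<close> only raises those in between.\<close>

lemma balanced_swap:
  assumes "balanced m (True # A @ False # B)" "balanced m A"
  shows "balanced m (True # B @ [False])"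
proof -
  have hA: "height m A = 0" using assms balanced_height by auto
  have "0 \<le> height m p" if eq: "True # B @ [False] = p @ q" for p q
  proof (cases "p = []")
    case False
    then obtain p' where p': "p = True # p'" "B @ [False] = p' @ q"
      using eq by (metis append_eq_Cons_conv)
    show ?thesis
    proof (cases "q = []")
      case True
      then show ?thesis using assms balanced_height[OF assms(1)] p' hA by auto
    next
      case False
      then obtain q' where "B = p' @ q'" using p'(2)
        by (metis append_butlast_last_id append_assoc append1_eq_conv)
      then have "True # A @ False # B = (True # A @ False # p') @ q'" by simp
      then have "0 \<le> height m (True # A @ False # p')" using assms(1) balanced_prefix by metis
      then show ?thesis using p' hA by simp
    qed
  qed simp
  moreover have "height m (True # B @ [False]) = 0"
    using balanced_height[OF assms(1)] hA by simp
  ultimately show ?thesis unfolding balanced_def by blast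
qed

lemma balanced_turn:
  assumes "0 < m" "balanced m w"
  shows "balanced m (turn m w)"
proof (cases "w = []")
  case False
  then obtain A B where w: "w = True # A @ False # B" "balanced m A"
    using balanced_decomp assms by metis
  then have "balanced m (True # B @ [False])" using balanced_swap assms by simp
  then show ?thesis using w turn_eq balanced_append by auto
qed (simp add: turn_def)

lemma balanced_turn_pow:
  assumes "0 < m" "balanced m w"
  shows "balanced m ((turn m ^^ j) w)" "length ((turn m ^^ j) w) = length w"
  by (induction j) (use assms balanced_turn length_turn in auto)

section \<open>Powers of the turn operator that act as rotations\<close>

text \<open>The words that can precede a return to the block of a \<open>True\<close> placed in front of them.\<close>

definition sinking :: "nat \<Rightarrow> bool list \<Rightarrow> bool" where
  "sinking m Y \<longleftrightarrow> (\<forall>u v. Y = u @ v \<longrightarrow> height m v \<le> 0)"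

lemma balanced_sinking: "balanced m A \<Longrightarrow> sinking m A"
  unfolding sinking_def balanced_def by (metis add_le_same_cancel1 add.commute height_simps(3))

lemma balanced_if_sinking: "sinking m A \<Longrightarrow> height m A = 0 \<Longrightarrow> balanced m A"
  unfolding sinking_def balanced_def by (metis add_decreasing2 height_simps(3) linorder_not_le order.strict_iff_order add_less_same_cancel2 nle_le)

text \<open>Cut where the path first returns to height 0. Before that, prefixes of the part after
  the leading \<open>True\<close> stay above \<open>- m\<close>, hence at or above
  \<open>height m Y = 1 - m\<close>, which makes every suffix of \<open>Y\<close>
  nonpositive.\<close>

lemma first_return:
  assumes "0 < m" "balanced m A" "A \<noteq> []"
  obtains Y A' where "A = True # Y @ False # A'" "sinking m Y" "balanced m A'" "height m Y = 1 - int m"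
proof -
  obtain u where u: "A = True # u" using balanced_hd[OF assms(2,3)] by blast
  define P where "P l \<longleftrightarrow> (\<exists>p q. u = p @ q \<and> length p = l \<and> height m p = - int m)" for l
  have "height m u = - int m" using balanced_height[OF assms(2)] u by simp
  then have "P (length u)" unfolding P_def by auto
  then have "P (LEAST l. P l)" by (rule LeastI)
  then obtain p q where pq: "u = p @ q" "length p = (LEAST l. P l)" "height m p = - int m"
    unfolding P_def by blast
  have "p \<noteq> []" using pq(3) assms(1) by auto
  then obtain Y x where Yx: "p = Y @ [x]" by (metis append_butlast_last_id)
  have pos: "height m a > - int m" if "Y = a @ b" for a b
  proof -
    have "A = (True # a) @ (b @ x # q)" using u pq Yx that by simp
    then have "0 \<le> height m (True # a)" using assms(2) balanced_prefix by metis
    moreover have "\<not> P (length a)" by (rule not_less_Least) (use pq(2) Yx that in simp)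
    then have "height m a \<noteq> - int m" unfolding P_def using u pq Yx that by auto
    ultimately show ?thesis by simp
  qed
  from pos[of Y "[]"] pq(3) Yx have x: "\<not> x" and hY: "height m Y = 1 - int m"
    by (auto split: if_splits)
  have "sinking m Y" unfolding sinking_def
  proof (intro allI impI)
    fix a b assume "Y = a @ b"
    with pos[of a b] hY show "height m b \<le> 0" by simp
  qed
  moreover have eq: "A = (True # Y @ [False]) @ q" using u pq Yx x by simp
  moreover have "balanced m q"
    using balanced_append_cancel(2)[of m "True # Y @ [False]" q] assms(2) eq hY by simp
  ultimately show ?thesis using that[of Y q] hY by auto
qed

lemma sinking_suffix: "sinking m (u @ v) \<Longrightarrow> sinking m v"
  unfolding sinking_def by (metis append_assoc)

text \<open>Both halves describe rotations: a balanced prefix goes to the back, and in the second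
  half the word with its leading letter erased is rotated by \<open>Suc l\<close>. They feed each
  other. Append cuts \<open>A\<close> at its first return and uses swap at a shorter length; swap
  splits \<open>Y\<close> at a first passage into two shorter swaps, unless \<open>Y\<close> is
  balanced.\<close>

lemma turn_pow_append_and_swap:
  assumes m: "0 < m"
  shows "(\<forall>A V. length A = l \<longrightarrow> balanced m A \<longrightarrow> balanced m V \<longrightarrow> (turn m ^^ l) (A @ V) = V @ A) \<and>
    (\<forall>Y B. length Y = l \<longrightarrow> sinking m Y \<longrightarrow> balanced m (True # Y @ False # B) \<longrightarrow>
      (turn m ^^ Suc l) (True # Y @ False # B) = True # B @ False # Y)"
proof (induction l rule: less_induct)
  case (less l)
  have app: "(turn m ^^ length A) (A @ V) = V @ A"
    if "length A < l" "balanced m A" "balanced m V" for A V using less that by blast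
  have swp: "(turn m ^^ Suc (length Y)) (True # Y @ False # B) = True # B @ False # Y"
    if "length Y < l" "sinking m Y" "balanced m (True # Y @ False # B)" for Y B
    using less that by blast
  have app': "(turn m ^^ l) (A @ V) = V @ A"
    if A: "length A = l" "balanced m A" and V: "balanced m V" for A V
  proof (cases "A = []")
    case False
    obtain Y A' where d: "A = True # Y @ False # A'" "sinking m Y" "balanced m A'" "height m Y = 1 - int m"
      using first_return[OF m A(2) False] by metis
    have l: "l = length A' + Suc (Suc (length Y))" using d A(1) by simp
    have bal: "balanced m (A' @ V)" by (rule balanced_append[OF d(3) V])
    have Y0: "balanced m (True # Y @ [False])"
      using balanced_append_cancel(1)[of m "True # Y @ [False]" A'] A(2) d by simp
    have "balanced m (A @ V)" by (rule balanced_append[OF A(2) V])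
    then have "(turn m ^^ Suc (length Y)) (A @ V) = True # (A' @ V) @ False # Y"
      using swp[of Y "A' @ V"] d l by simp
    then have "(turn m ^^ Suc (Suc (length Y))) (A @ V) = turn m (True # (A' @ V) @ False # Y)"
      by simp
    also have "\<dots> = A' @ (V @ True # Y @ [False])" using turn_eq[OF bal] by simp
    finally have "(turn m ^^ l) (A @ V) = (turn m ^^ length A') (A' @ (V @ True # Y @ [False]))"
      unfolding l funpow_add by simp
    also have "\<dots> = (V @ True # Y @ [False]) @ A'"
      by (rule app) (use l d balanced_append[OF V Y0] in auto)
    finally show ?thesis using d by simp
  qed (use A in auto)
  \<comment> \<open>For balanced \<open>Y\<close> this uses the append half at the same length
    \<open>l\<close>, which is why that half is settled beforehand.\<close>
  have swp': "(turn m ^^ Suc l) (True # Y @ False # B) = True # B @ False # Y"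
    if Y: "length Y = l" "sinking m Y" and bal: "balanced m (True # Y @ False # B)" for Y B
  proof (cases "height m Y = 0")
    case True
    then have bY: "balanced m Y" using balanced_if_sinking Y by auto
    have "(turn m ^^ Suc l) (True # Y @ False # B) = (turn m ^^ l) (Y @ True # B @ [False])"
      using turn_eq[OF bY] by (simp add: funpow_swap1)
    also have "\<dots> = (True # B @ [False]) @ Y"
      by (rule app') (use Y bY balanced_swap[OF bal bY] in auto)
    finally show ?thesis by simp
  next
    case False
    then have "height m Y < 0" using Y(2) unfolding sinking_def by force
    then obtain A Y' where AY: "Y = A @ False # Y'" "balanced m A"
      using first_passage[of Y Y "[]" m] by auto
    have l: "Suc l = Suc (length Y') + Suc (length A)" using AY Y by simp
    have 1: "(turn m ^^ Suc (length A)) (True # Y @ False # B) = True # Y' @ False # (B @ False # A)"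
      using swp[of A "Y' @ False # B"] AY balanced_sinking bal l by simp
    have "balanced m (True # Y' @ False # (B @ False # A))"
      using balanced_turn_pow[OF m bal] 1 by metis
    then have "(turn m ^^ Suc (length Y')) (True # Y' @ False # (B @ False # A))
        = True # (B @ False # A) @ False # Y'"
      using swp[of Y' "B @ False # A"] l sinking_suffix[of m "A @ [False]" Y'] AY Y by simp
    then show ?thesis unfolding l funpow_add comp_apply 1 using AY by simp
  qed
  show ?case using app' swp' by blast
qed

corollary turn_pow_append:
  assumes "0 < m" "balanced m A" "balanced m V"
  shows "(turn m ^^ length A) (A @ V) = V @ A"
  using turn_pow_append_and_swap assms by blast

corollary turn_pow_swap:
  assumes "0 < m" "sinking m Y" "balanced m (True # Y @ False # B)"
  shows "(turn m ^^ Suc (length Y)) (True # Y @ False # B) = True # B @ False # Y"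
  using turn_pow_append_and_swap assms by blast

corollary turn_pow_length:
  assumes "0 < m" "balanced m w"
  shows "(turn m ^^ length w) w = w"
  using turn_pow_append[OF assms, of "[]"] by simp

section \<open>Juggling states on a cycle\<close>

text \<open>The state at time \<open>j\<close> is a set of positions on the cycle; the ball at position \<open>j\<close> is thrown to the free
  position \<open>\<sigma> j\<close>. Since the cycle closes up, \<open>\<sigma>\<close> is a permutation, and two states agree iff \<open>\<sigma>\<close>
  preserves the interval of times between them.\<close>

locale juggling =
  fixes N :: nat and S :: "nat \<Rightarrow> nat set" and \<sigma> :: "nat \<Rightarrow> nat"
  assumes N_pos: "0 < N"
    and states: "S j \<subseteq> {..<N}"
    and \<sigma>_less: "j < N \<Longrightarrow> \<sigma> j < N"
    and throw_mem: "j < N \<Longrightarrow> j \<in> S j"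
    and throw_free: "j < N \<Longrightarrow> \<sigma> j \<notin> S j"
    and throw: "j < N \<Longrightarrow> S (Suc j) = insert (\<sigma> j) (S j - {j})"
    and jump: "j < N \<Longrightarrow> S (\<sigma> j) = S (Suc j)"
    and closed: "S N = S 0"
begin

text \<open>Each step vacates \<open>i\<close> and fills \<open>\<sigma> i\<close>, so the
  indicators telescope. Landings are counted with multiplicity because injectivity of
  \<open>\<sigma>\<close> is only derived from this count.\<close>

lemma multiplicity:
  assumes "j \<le> j'" "j' \<le> N"
  shows "(of_bool (x \<in> S j') :: int) =
    of_bool (x \<in> S j) - of_bool (x \<in> {j..<j'}) + int (card {i \<in> {j..<j'}. \<sigma> i = x})"
  using assms
proof (induction j' rule: dec_induct)
  case (step i)
  then have i: "i < N" "j \<le> i" by auto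
  have "{l \<in> {j..<Suc i}. \<sigma> l = x} = (if \<sigma> i = x then insert i {l \<in> {j..<i}. \<sigma> l = x} else {l \<in> {j..<i}. \<sigma> l = x})"
    using i by (auto simp: less_Suc_eq)
  then have card: "card {l \<in> {j..<Suc i}. \<sigma> l = x} = card {l \<in> {j..<i}. \<sigma> l = x} + of_bool (\<sigma> i = x)"
    by auto
  have "(of_bool (x \<in> S (Suc i)) :: int) = of_bool (x \<in> S i) - of_bool (x = i) + of_bool (\<sigma> i = x)"
    using throw[OF i(1)] throw_mem[OF i(1)] throw_free[OF i(1)] by auto
  moreover have "(of_bool (x \<in> {j..<Suc i}) :: int) = of_bool (x \<in> {j..<i}) + of_bool (x = i)"
    using i by auto
  ultimately show ?case using step i card by simp
qed auto

text \<open>Over a full cycle the state returns and every position below \<open>N\<close> is vacated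
  exactly once, so exactly one throw lands on it.\<close>

lemma \<sigma>_bij: "bij_betw \<sigma> {..<N} {..<N}"
proof -
  have c: "card {i \<in> {0..<N}. \<sigma> i = x} = 1" if "x < N" for x
    using multiplicity[of 0 N x] closed that by auto
  have "{..<N} \<subseteq> \<sigma> ` {..<N}"
  proof
    fix x assume "x \<in> {..<N}"
    then have "card {i \<in> {0..<N}. \<sigma> i = x} = 1" using c by auto
    then have "{i \<in> {0..<N}. \<sigma> i = x} \<noteq> {}" by (metis card.empty zero_neq_one)
    then show "x \<in> \<sigma> ` {..<N}" by auto
  qed
  then have "\<sigma> ` {..<N} = {..<N}" using \<sigma>_less by auto
  then show ?thesis by (simp add: bij_betw_def eq_card_imp_inj_on)
qed

lemma \<sigma>_inj: "i < N \<Longrightarrow> i' < N \<Longrightarrow> \<sigma> i = \<sigma> i' \<longleftrightarrow> i = i'"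
  using \<sigma>_bij by (metis bij_betw_def inj_on_def lessThan_iff)

lemma state_indicator:
  assumes "j \<le> j'" "j' \<le> N"
  shows "(of_bool (x \<in> S j') :: int) =
    of_bool (x \<in> S j) - of_bool (x \<in> {j..<j'}) + of_bool (x \<in> \<sigma> ` {j..<j'})"
proof -
  have "card {i \<in> {j..<j'}. \<sigma> i = x} = of_bool (x \<in> \<sigma> ` {j..<j'})"
  proof (cases "x \<in> \<sigma> ` {j..<j'}")
    case True
    then obtain i where "i \<in> {j..<j'}" "\<sigma> i = x" by auto
    then have "{i \<in> {j..<j'}. \<sigma> i = x} = {i}" using \<sigma>_inj assms by force
    then show ?thesis using True by simp
  next
    case False
    then have "{i \<in> {j..<j'}. \<sigma> i = x} = {}" by auto
    then show ?thesis using False by (simp only: card.empty of_bool_eq simp_thms)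
  qed
  then show ?thesis using multiplicity[OF assms, of x] by simp
qed

lemma state_eq_iff:
  assumes "j \<le> j'" "j' \<le> N"
  shows "S j' = S j \<longleftrightarrow> \<sigma> ` {j..<j'} = {j..<j'}"
proof -
  have "S j' = S j \<longleftrightarrow> (\<forall>x. (of_bool (x \<in> S j') :: int) = of_bool (x \<in> S j))"
    by (auto simp: set_eq_iff)
  also have "\<dots> \<longleftrightarrow> (\<forall>x. (of_bool (x \<in> \<sigma> ` {j..<j'}) :: int) = of_bool (x \<in> {j..<j'}))"
    unfolding state_indicator[OF assms] by auto
  also have "\<dots> \<longleftrightarrow> \<sigma> ` {j..<j'} = {j..<j'}"
    by (simp only: of_bool_eq_iff set_eq_iff)
  finally show ?thesis .
qed

text \<open>Deleting \<open>j'\<close> from the later state and \<open>j\<close> from the earlier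
  one turns the vacated set \<open>{j..<j'}\<close> into \<open>{Suc j..<Suc j'}\<close>.\<close>

lemma residue_eq_iff:
  assumes "j \<le> j'" "j' < N"
  shows "S j' - {j'} = S j - {j} \<longleftrightarrow> \<sigma> ` {j..<j'} = {Suc j..<Suc j'}"
proof -
  have j: "j < N" using assms by simp
  have diff: "(of_bool (x \<in> S i - {i}) :: int) = of_bool (x \<in> S i) - of_bool (x = i)" if "i < N" for x i
    using throw_mem[OF that] by (cases "x = i"; cases "x \<in> S i") simp_all
  have shift: "(of_bool (x \<in> {Suc j..<Suc j'}) :: int) = of_bool (x \<in> {j..<j'}) + of_bool (x = j') - of_bool (x = j)" for x
    using assms unfolding of_bool_def atLeastLessThan_iff by presburger
  have "S j' - {j'} = S j - {j} \<longleftrightarrow> (\<forall>x. (of_bool (x \<in> S j' - {j'}) :: int) = of_bool (x \<in> S j - {j}))"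
    by (simp only: of_bool_eq_iff set_eq_iff)
  also have "\<dots> \<longleftrightarrow> (\<forall>x. (of_bool (x \<in> \<sigma> ` {j..<j'}) :: int) = of_bool (x \<in> {Suc j..<Suc j'}))"
    unfolding diff[OF assms(2)] diff[OF j] shift state_indicator[OF assms(1) less_imp_le[OF assms(2)]]
    by (auto simp: algebra_simps)
  also have "\<dots> \<longleftrightarrow> \<sigma> ` {j..<j'} = {Suc j..<Suc j'}"
    by (simp only: of_bool_eq_iff set_eq_iff)
  finally show ?thesis .
qed

text \<open>At time \<open>x\<close> the position \<open>x\<close> is occupied: either its mark was
  there from the start, or an earlier throw put it there.\<close>

lemma mem_start_iff:
  assumes "x < N"
  shows "x \<in> S 0 \<longleftrightarrow> (\<forall>i<x. \<sigma> i \<noteq> x)"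
proof -
  have "(1::int) = of_bool (x \<in> S 0) + of_bool (x \<in> \<sigma> ` {0..<x})"
    using state_indicator[of 0 x x] throw_mem[OF assms] assms by simp
  then show ?thesis by (auto split: if_splits simp: of_bool_def)
qed

lemma residue_jump:
  assumes "j < N" shows "S (\<sigma> j) - {\<sigma> j} = S j - {j}"
  unfolding jump[OF assms] throw[OF assms] using throw_free[OF assms] by (simp add: insert_Diff_if)

text \<open>Following a mark through its throws does not change the residue, and tracing it back
  ends in \<open>S 0\<close>. Two members of \<open>S 0\<close> have different residues, since
  otherwise the later one would be the landing place of an earlier throw.\<close>

lemma card_residues: "card ((\<lambda>j. S j - {j}) ` {..<N}) = card (S 0)"
proof -
  have "\<exists>i\<in>S 0. S i - {i} = S j - {j}" if "j < N" for j
    using that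
  proof (induction j rule: less_induct)
    case (less j)
    show ?case
    proof (cases "j \<in> S 0")
      case False
      then obtain i where i: "i < j" "\<sigma> i = j" using mem_start_iff less by blast
      then show ?thesis using less residue_jump[of i] by force
    qed auto
  qed
  then have img: "(\<lambda>j. S j - {j}) ` {..<N} = (\<lambda>j. S j - {j}) ` S 0"
    using states[of 0] by (auto simp: image_iff) metis
  have "inj_on (\<lambda>j. S j - {j}) (S 0)"
  proof (rule linorder_inj_onI)
    fix j j' assume less: "j < j'" and in0: "j \<in> S 0" "j' \<in> S 0"
    then have N: "j' < N" using states by blast
    show "S j - {j} \<noteq> S j' - {j'}"
    proof
      assume "S j - {j} = S j' - {j'}"
      then have "\<sigma> ` {j..<j'} = {Suc j..<Suc j'}"
        using residue_eq_iff[OF less_imp_le[OF less] N] by simp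
      then have "j' \<in> \<sigma> ` {j..<j'}" using less by auto
      then show False using mem_start_iff[OF N] in0 by auto
    qed
  qed auto
  then show ?thesis unfolding img by (rule card_image)
qed

text \<open>By \<open>jump\<close>, the state at time \<open>j\<close> repeats an earlier one when
  the preceding throw landed before \<open>j\<close>. The remaining times give pairwise different
  states, and there are \<open>card (S 0) - 1\<close> repetitions.\<close>

lemma card_states: "card (S ` {..<N}) = Suc N - card (S 0)"
proof -
  define D where "D = {j \<in> {1..<N}. \<sigma> (j - 1) < j}"
  have "\<exists>i\<in>{..<N} - D. S i = S j" if "j < N" for j
    using that
  proof (induction j rule: less_induct)
    case (less j)
    show ?case
    proof (cases "j \<in> D")
      case True
      then have j: "1 \<le> j" "\<sigma> (j - 1) < j" unfolding D_def by auto
      have "S (\<sigma> (j - 1)) = S j" using jump[of "j - 1"] j less by simp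
      moreover obtain i where "i \<in> {..<N} - D" "S i = S (\<sigma> (j - 1))"
        using less.IH[of "\<sigma> (j - 1)"] j less.prems by auto
      ultimately show ?thesis by auto
    qed (use less in auto)
  qed
  then have img: "S ` {..<N} = S ` ({..<N} - D)"
    by (auto simp: image_iff) metis
  have "inj_on S ({..<N} - D)"
  proof (rule linorder_inj_onI)
    fix j j' assume less: "j < j'" and D: "j \<in> {..<N} - D" "j' \<in> {..<N} - D"
    show "S j \<noteq> S j'"
    proof
      assume "S j = S j'"
      \<comment> \<open>Since \<open>\<sigma>\<close> preserves the interval, its last throw lands
        back inside, which puts \<open>j'\<close> into \<open>D\<close>.\<close>
      then have "\<sigma> ` {j..<j'} = {j..<j'}" using state_eq_iff[of j j'] less D by auto
      moreover have "j' - 1 \<in> {j..<j'}" using less by auto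
      ultimately have "\<sigma> (j' - 1) \<in> {j..<j'}" by blast
      then show False using D less unfolding D_def by auto
    qed
  qed auto
  then have "card (S ` {..<N}) = card ({..<N} - D)" unfolding img by (rule card_image)
  also have "\<dots> = N - card D" by (subst card_Diff_subset) (auto simp: D_def)
  also have "card D = card (S 0) - 1"
  proof -
    \<comment> \<open>The throws that do not go forward land exactly on the members of
      \<open>S 0\<close>. The throw at \<open>N - 1\<close> is always one of them, but no time below
      \<open>N\<close> follows it; hence the \<open>- 1\<close>.\<close>
    have "bij_betw \<sigma> {i\<in>{..<N}. \<sigma> i \<le> i} (S 0)"
    proof (rule bij_betwI')
      show "\<sigma> x \<in> S 0" if "x \<in> {i \<in> {..<N}. \<sigma> i \<le> i}" for x
        using mem_start_iff[of "\<sigma> x"] \<sigma>_less that \<sigma>_inj by fastforce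
      show "\<exists>x\<in>{i \<in> {..<N}. \<sigma> i \<le> i}. y = \<sigma> x" if y: "y \<in> S 0" for y
      proof -
        have "y < N" using states y by blast
        then have "y \<in> \<sigma> ` {..<N}" using \<sigma>_bij by (simp add: bij_betw_def)
        then obtain x where x: "x < N" "\<sigma> x = y" by auto
        then have "\<not> x < y" using mem_start_iff[OF \<open>y < N\<close>] y by metis
        then show ?thesis using x by (intro bexI[of _ x]) simp_all
      qed
    qed (use \<sigma>_inj in auto)
    then have "card {i\<in>{..<N}. \<sigma> i \<le> i} = card (S 0)" by (rule bij_betw_same_card)
    moreover have "{i\<in>{..<N}. \<sigma> i \<le> i} = insert (N - 1) ((\<lambda>j. j - 1) ` D)"
    proof -
      have "i = N - 1 \<or> i \<in> (\<lambda>j. j - 1) ` D" if "i < N" "\<sigma> i \<le> i" for i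
      proof (cases "Suc i < N")
        case True
        then have "Suc i \<in> D" using that unfolding D_def by simp
        then show ?thesis by (metis diff_Suc_1 image_eqI)
      next
        case False
        then have "i = N - 1" using that by linarith
        then show ?thesis ..
      qed
      moreover have "\<sigma> (N - 1) \<le> N - 1" using \<sigma>_less[of "N - 1"] N_pos by simp
      ultimately show ?thesis using N_pos unfolding D_def by auto
    qed
    moreover have "N - 1 \<notin> (\<lambda>j. j - 1) ` D" unfolding D_def by auto
    moreover have "card ((\<lambda>j. j - 1) ` D) = card D"
      by (rule card_image) (auto simp: D_def inj_on_def)
    moreover have "finite D" unfolding D_def by simp
    ultimately show ?thesis by simp
  qed
  also have "N - (card (S 0) - 1) = Suc N - card (S 0)"
    using throw_mem[OF N_pos] finite_subset[OF states[of 0]] card_gt_0_iff[of "S 0"] by fastforce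
  finally show ?thesis .
qed

text \<open>\<open>{j..<j'}\<close> is the difference of two windows of length \<open>M\<close> that
  \<open>\<sigma>\<close> preserves, so it is preserved as well. The bound on \<open>M\<close> keeps
  both windows inside the cycle.\<close>

lemma periodic_state_unique:
  assumes M: "2 * M \<le> N" and j: "j \<le> j'" "j' < M"
    and per: "S (j + M) = S j" "S (j' + M) = S j'"
  shows "S j' = S j"
proof -
  have inv: "\<sigma> ` {j..<j + M} = {j..<j + M}" "\<sigma> ` {j'..<j' + M} = {j'..<j' + M}"
    using per state_eq_iff[of j "j + M"] state_eq_iff[of j' "j' + M"] M j by auto
  have diff: "{j..<j'} = {j..<j + M} - {j'..<j' + M}" using j by auto
  have "\<sigma> ` {j..<j'} = \<sigma> ` {j..<j + M} - \<sigma> ` {j'..<j' + M}"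
    unfolding diff by (rule inj_on_image_set_diff[where C = "{..<N}"]) (use \<sigma>_bij M j in \<open>auto simp: bij_betw_def\<close>)
  then have "\<sigma> ` {j..<j'} = {j..<j'}" unfolding inv diff .
  then show ?thesis using state_eq_iff[of j j'] M j by auto
qed

lemma periodic_residue_unique:
  assumes M: "2 * M \<le> N" and j: "j \<le> j'" "j' < M"
    and per: "S (j + M) - {j + M} = S j - {j}" "S (j' + M) - {j' + M} = S j' - {j'}"
  shows "S j' - {j'} = S j - {j}"
proof -
  have "\<sigma> ` {j..<j + M} = {Suc j..<Suc (j + M)}" "\<sigma> ` {j'..<j' + M} = {Suc j'..<Suc (j' + M)}"
    using per residue_eq_iff[of j "j + M"] residue_eq_iff[of j' "j' + M"] M j by auto
  moreover have "\<sigma> ` {j..<j'} = \<sigma> ` {j..<j + M} - \<sigma> ` {j'..<j' + M}"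
  proof -
    have diff: "{j..<j'} = {j..<j + M} - {j'..<j' + M}" using j by auto
    show ?thesis
      unfolding diff by (rule inj_on_image_set_diff[where C = "{..<N}"]) (use \<sigma>_bij M j in \<open>auto simp: bij_betw_def\<close>)
  qed
  ultimately have "\<sigma> ` {j..<j'} = {Suc j..<Suc j'}" using j by auto
  then show ?thesis using residue_eq_iff[of j j'] M j by auto
qed

end

section \<open>Fixed points of iterates and of maps of prime order\<close>

lemma funpow_fixed_gcd:
  assumes a: "(f ^^ a) x = x" and b: "(f ^^ b) x = x"
  shows "(f ^^ gcd a b) x = x"
proof (cases "a = 0")
  case False
  have mult: "(f ^^ (c * n)) x = x" if "(f ^^ n) x = x" for c n
    by (induction c) (use that in \<open>simp_all add: funpow_add\<close>)
  obtain u v where uv: "a * u = b * v + gcd a b" using bezout_nat[OF False] by blast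
  have "(f ^^ gcd a b) x = (f ^^ gcd a b) ((f ^^ (b * v)) x)"
    using mult[OF b, of v] by (simp add: mult.commute)
  also have "\<dots> = (f ^^ (a * u)) x" unfolding uv by (metis add.commute comp_apply funpow_add)
  also have "\<dots> = x" using mult[OF a, of u] by (simp add: mult.commute)
  finally show ?thesis .
qed (use b in simp)

text \<open>Without fixed points every orbit has exactly \<open>p\<close> elements, because a
  smaller period would be coprime to \<open>p\<close>. Removing orbits one at a time then shows that
  \<open>p\<close> divides the cardinality.\<close>

lemma prime_order_fixed_point:
  fixes A :: "'a set" and p :: nat
  assumes "finite A" "prime p" "\<And>x. x \<in> A \<Longrightarrow> f x \<in> A" "\<And>x. x \<in> A \<Longrightarrow> (f ^^ p) x = x"
    and "\<not> p dvd card A"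
  shows "\<exists>x\<in>A. f x = x"
proof (rule ccontr)
  assume none: "\<not> (\<exists>x\<in>A. f x = x)"
  have "p dvd card B" if "finite B" "\<And>x. x \<in> B \<Longrightarrow> f x \<in> B" "B \<subseteq> A" for B
    using that
  proof (induction B rule: finite_psubset_induct)
    case (psubset B)
    show ?case
    proof (cases "B = {}")
      case False
      then obtain x where x: "x \<in> B" by blast
      let ?O = "(\<lambda>i. (f ^^ i) x) ` {..<p}"
      have inB: "(f ^^ i) y \<in> B" if "y \<in> B" for i y by (induction i) (use that psubset.prems(1) in auto)
      have OB: "?O \<subseteq> B" using inB x by auto
      have fp: "(f ^^ p) x = x" using assms(4) x psubset.prems(2) by blast
      have "inj_on (\<lambda>i. (f ^^ i) x) {..<p}"
      proof (rule linorder_inj_onI)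
        fix i j assume ij: "i < j" "i \<in> {..<p}" "j \<in> {..<p}"
        show "(f ^^ i) x \<noteq> (f ^^ j) x"
        proof
          assume "(f ^^ i) x = (f ^^ j) x"
          then have "(f ^^ (p - j)) ((f ^^ i) x) = (f ^^ (p - j)) ((f ^^ j) x)" by simp
          also have "\<dots> = (f ^^ (p - j + j)) x" by (simp only: funpow_add comp_apply)
          also have "\<dots> = x" using fp ij by simp
          finally have "(f ^^ (p - j + i)) x = x" by (simp add: funpow_add)
          then have "(f ^^ gcd (p - j + i) p) x = x" using fp funpow_fixed_gcd by metis
          moreover have "\<not> p dvd (p - j + i)"
            using ij by (intro nat_dvd_not_less) auto
          then have "gcd (p - j + i) p = 1"
            using prime_imp_coprime[OF assms(2)] coprime_imp_gcd_eq_1 gcd.commute by metis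
          ultimately show False using none x psubset.prems(2) by auto
        qed
      qed auto
      then have cO: "card ?O = p" by (simp add: card_image)
      have x0: "x \<in> ?O"
        by (rule image_eqI[where x = 0]) (use prime_gt_0_nat[OF assms(2)] in simp_all)
      have "f ` ?O \<subseteq> ?O"
      proof clarify
        fix i assume "i < p"
        have "f ((f ^^ i) x) = (f ^^ Suc i) x" by simp
        also have "\<dots> \<in> ?O"
        proof (cases "Suc i = p")
          case True
          then show ?thesis using fp x0 by simp
        next
          case False
          then have "Suc i \<in> {..<p}" using \<open>i < p\<close> by simp
          then show ?thesis by (rule imageI)
        qed
        finally show "f ((f ^^ i) x) \<in> ?O" .
      qed
      have inj: "inj_on f A"
      proof (rule inj_on_inverseI)
        fix y assume "y \<in> A"
        have "(f ^^ (p - 1)) (f y) = (f ^^ Suc (p - 1)) y" by (simp only: funpow_Suc_right comp_apply)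
        then show "(f ^^ (p - 1)) (f y) = y"
          using assms(4)[OF \<open>y \<in> A\<close>] prime_gt_0_nat[OF assms(2)] by simp
      qed
      have "f y \<in> B - ?O" if y: "y \<in> B - ?O" for y
      proof -
        have OA: "?O \<subseteq> A" by (rule subset_trans[OF OB psubset.prems(2)])
        have "f ` ?O = ?O"
          by (rule endo_inj_surj[OF finite_imageI[OF finite_lessThan] \<open>f ` ?O \<subseteq> ?O\<close> inj_on_subset[OF inj OA]])
        moreover have "y \<in> A" using y psubset.prems(2) by blast
        ultimately have "f y \<notin> ?O" using y inj_on_image_mem_iff[OF inj _ OA, of y] by simp
        then show ?thesis using y psubset.prems(1) by blast
      qed
      then have step: "f y \<in> B - ?O" if "y \<in> B - ?O" for y using that by blast
      have "B - ?O \<subset> B" using x x0 by blast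
      then have "p dvd card (B - ?O)"
        by (rule psubset.IH) (use step psubset.prems(2) in \<open>blast+\<close>)
      moreover have "card B = card (B - ?O) + p"
        using cO card_Diff_subset[OF _ OB] card_mono[OF psubset.hyps(1) OB] by simp
      ultimately show ?thesis by simp
    qed simp
  qed
  from this[of A] show False using assms(1,3,5) by simp
qed

section \<open>Covering subsets of a cycle\<close>

definition shift :: "nat \<Rightarrow> nat \<Rightarrow> nat set \<Rightarrow> nat set" where
  "shift N M T = (\<lambda>x. (x + M) mod N) ` T"

lemma shift_add: "shift N a (shift N b T) = shift N (a + b) T"
  by (force simp: shift_def image_image mod_simps add_ac)

lemma shift_multiple:
  assumes "T \<subseteq> {..<N}" "N dvd M"
  shows "shift N M T = T"
proof -
  have "(x + M) mod N = x" if "x \<in> T" for x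
    using assms that by (metis dvd_imp_mod_0 lessThan_iff mod_add_right_eq mod_less add_0_right subsetD)
  then show ?thesis unfolding shift_def by simp
qed

lemma shift_pow: "T \<subseteq> {..<N} \<Longrightarrow> (shift N M ^^ c) T = shift N (c * M) T"
  by (induction c) (simp_all add: shift_add shift_multiple)

lemma add_mod_inj:
  fixes i i' :: nat
  assumes "(j + i) mod N = (j + i') mod N" "i < N" "i' < N"
  shows "i = i'"
proof -
  have *: "a = b" if "(j + a) mod N = (j + b) mod N" "a < N" "a \<le> b" "b < N" for a b :: nat
  proof -
    have "N dvd (j + b) - (j + a)" using that by (metis add_le_cancel_left mod_eq_dvd_iff_nat)
    then show ?thesis using that by (auto dest: dvd_imp_le)
  qed
  show ?thesis using *[of i i'] *[of i' i] assms by (cases "i \<le> i'") auto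
qed

lemma residue_offset:
  fixes x j N :: nat
  assumes "x < N"
  obtains i where "i < N" "x = (j + i) mod N"
proof
  show "(x + j * (N - 1)) mod N < N" using assms by simp
  have "j + (x + j * (N - 1)) = x + j * N" using assms by (cases N) auto
  then have "(j + (x + j * (N - 1)) mod N) mod N = (x + j * N) mod N"
    by (metis mod_add_right_eq)
  then show "x = (j + (x + j * (N - 1)) mod N) mod N" using assms by simp
qed

lemma inj_on_shift: "inj_on (\<lambda>x. (x + M) mod N) {..<N::nat}"
  by (rule inj_onI) (metis add.commute add_mod_inj lessThan_iff)

text \<open>\<open>F w j\<close> is a subset of the cycle of length \<open>N\<close> on which \<open>w\<close> is read off from position \<open>j\<close>.\<close>

locale cyclic_cover =
  fixes X :: "'a set" and R :: "'a \<Rightarrow> 'a" and N c r :: nat and F :: "'a \<Rightarrow> nat \<Rightarrow> nat set"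
  assumes finite_X: "finite X" and N_pos: "0 < N"
    and R_closed: "w \<in> X \<Longrightarrow> R w \<in> X"
    and R_period: "w \<in> X \<Longrightarrow> (R ^^ N) w = w"
    and F_subset: "w \<in> X \<Longrightarrow> F w j \<subseteq> {..<N}"
    and card_F: "w \<in> X \<Longrightarrow> card (F w j) = c"
    and F_shift: "w \<in> X \<Longrightarrow> shift N M (F ((R ^^ M) w) j) = F w (j + M)"
    and F_cover: "T \<subseteq> {..<N} \<Longrightarrow> card T = c \<Longrightarrow> \<exists>w\<in>X. \<exists>j. T = F w j"
    and F_unique: "w \<in> X \<Longrightarrow> w' \<in> X \<Longrightarrow> F w j = F w' j' \<Longrightarrow> w = w'"
    and card_range: "w \<in> X \<Longrightarrow> card (F w ` {..<N}) = r"
    and periodic_unique: "w \<in> X \<Longrightarrow> 2 * M \<le> N \<Longrightarrow> j \<le> j' \<Longrightarrow> j' < M \<Longrightarrow>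
      F w (j + M) = F w j \<Longrightarrow> F w (j' + M) = F w j' \<Longrightarrow> F w j' = F w j"
begin

lemma R_pow_closed: "w \<in> X \<Longrightarrow> (R ^^ i) w \<in> X"
  by (induction i) (auto intro: R_closed)

lemma F_shift_fixed: "w \<in> X \<Longrightarrow> (R ^^ M) w = w \<Longrightarrow> F w (j + M) = shift N M (F w j)"
  using F_shift[of w M j] by simp

lemma range_F: "w \<in> X \<Longrightarrow> range (F w) = F w ` {..<N}"
proof -
  assume w: "w \<in> X"
  have "F w j = F w (j mod N)" for j
  proof (induction j rule: less_induct)
    case (less j)
    show ?case
    proof (cases "j < N")
      case False
      then have "F w j = F w (j - N)"
        using F_shift_fixed[OF w R_period[OF w], of "j - N"] shift_multiple[OF F_subset[OF w], of N "j - N"] by simp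
      then show ?thesis using less.IH[of "j - N"] False N_pos by (simp add: le_mod_geq)
    qed simp
  qed
  then show ?thesis using N_pos by (metis (no_types, lifting) image_subset_iff lessThan_iff mod_less_divisor
        rangeI subset_antisym image_eqI subset_UNIV image_mono)
qed

text \<open>A double count: each \<open>c\<close>-subset lies in the range of \<open>F w\<close> for
  exactly one \<open>w\<close>, and each range has \<open>r\<close> elements.\<close>

lemma card_mult: "card X * r = N choose c"
proof -
  have "{T. T \<subseteq> {..<N} \<and> card T = c} = (\<Union>w\<in>X. range (F w))"
  proof (intro equalityI subsetI)
    fix T assume "T \<in> {T. T \<subseteq> {..<N} \<and> card T = c}"
    then obtain w j where "w \<in> X" "T = F w j" using F_cover by blast
    then show "T \<in> (\<Union>w\<in>X. range (F w))" by blast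
  next
    fix T assume "T \<in> (\<Union>w\<in>X. range (F w))"
    then obtain w j where "w \<in> X" "T = F w j" by blast
    then show "T \<in> {T. T \<subseteq> {..<N} \<and> card T = c}" using F_subset card_F by simp
  qed
  also have "card \<dots> = (\<Sum>w\<in>X. card (range (F w)))"
  proof (rule card_UN_disjoint[OF finite_X])
    show "\<forall>w\<in>X. finite (range (F w))" using range_F by simp
    show "\<forall>w\<in>X. \<forall>w'\<in>X. w \<noteq> w' \<longrightarrow> range (F w) \<inter> range (F w') = {}" using F_unique by blast
  qed
  also have "\<dots> = card X * r" using range_F card_range by simp
  finally show ?thesis using n_subsets[of "{..<N}" c] by simp
qed

lemma fixed_if_periodic:
  assumes "w \<in> X" "M \<le> N" "shift N M (F w j) = F w j"
  shows "(R ^^ M) w = w"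
proof -
  \<comment> \<open>The preimage of \<open>w\<close> under \<open>R ^^ M\<close>. Periodicity gives
    \<open>w\<close> and \<open>w'\<close> a common subset, so they are equal.\<close>
  define w' where "w' = (R ^^ (N - M)) w"
  have w': "w' \<in> X" unfolding w'_def using R_pow_closed assms by simp
  have "(R ^^ M) w' = (R ^^ (M + (N - M))) w" unfolding w'_def by (simp only: funpow_add comp_apply)
  then have Rw': "(R ^^ M) w' = w" using assms R_period by simp
  then have "F w j = F w' (j + M)" using F_shift[OF w', of M j] assms(3) by simp
  then have "w = w'" using F_unique assms w' by blast
  then show ?thesis using Rw' by simp
qed

text \<open>Brings the time \<open>j\<close> below \<open>M\<close>, as
  \<open>periodic_unique\<close> demands.\<close>

lemma periodic_mod:
  assumes "w \<in> X" "(R ^^ M) w = w" "shift N M (F w j) = F w j"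
  shows "F w (j mod M) = F w j" "F w (j mod M + M) = F w (j mod M)"
proof -
  define r c where "r = j mod M" and "c = j div M"
  have j: "j = r + c * M" by (simp add: r_def c_def)
  have fixed: "shift N (i * M) (F w j) = F w j" for i
    by (induction i) (use assms(3) shift_multiple[OF F_subset[OF assms(1)]] in \<open>simp_all flip: shift_add\<close>)
  have "(R ^^ (c * M)) w = w" by (induction c) (use assms(2) in \<open>simp_all add: funpow_add\<close>)
  \<comment> \<open>The shift by \<open>(N - 1) * c * M\<close> undoes the one by
    \<open>c * M\<close>, since the sum is a multiple of \<open>N\<close>; being a multiple of
    \<open>M\<close>, it also fixes \<open>F w j\<close>.\<close>
  then have "shift N (((N - 1) * c) * M) (F w j) = shift N (((N - 1) * c) * M + c * M) (F w r)"
    unfolding j using F_shift_fixed[OF assms(1), of "c * M" r] by (simp add: shift_add)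
  also have "((N - 1) * c) * M + c * M = N * (c * M)" using N_pos by (cases N) (simp_all add: algebra_simps)
  finally have eq: "F w r = F w j" using fixed shift_multiple[OF F_subset[OF assms(1)]] by simp
  then show "F w (j mod M) = F w j" by (simp add: r_def)
  show "F w (j mod M + M) = F w (j mod M)"
    using F_shift_fixed[OF assms(1,2), of r] eq assms(3) by (simp add: r_def)
qed

lemma periodic_unique':
  assumes "w \<in> X" "(R ^^ M) w = w" "0 < M" "2 * M \<le> N"
    and "shift N M (F w j) = F w j" "shift N M (F w j') = F w j'"
  shows "F w j = F w j'"
proof -
  note red = periodic_mod[OF assms(1,2,5)] periodic_mod[OF assms(1,2,6)]
  have "F w (j mod M) = F w (j' mod M)"
    using periodic_unique[OF assms(1,4), of "j mod M" "j' mod M"] periodic_unique[OF assms(1,4), of "j' mod M" "j mod M"]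
      red assms(3) by (cases "j mod M \<le> j' mod M") auto
  then show ?thesis using red by simp
qed

text \<open>For a fixed word, the shift by \<open>N / p\<close> acts on its \<open>r\<close> subsets
  with trivial \<open>p\<close>-th power, so it fixes one of them. Uniqueness makes that subset
  invariant under the finer shift by \<open>M\<close>. Sending the word to this subset is the
  bijection.\<close>

lemma card_fixed:
  assumes M: "M dvd N" and p: "prime p" "p dvd N div M" "\<not> p dvd r"
  shows "card {w \<in> X. (R ^^ M) w = w} = card {T. T \<subseteq> {..<N} \<and> card T = c \<and> shift N M T = T}"
    (is "card ?A = card ?B")
proof -
  obtain q where q: "N = M * (p * q)"
    using M p(2) N_pos by (metis dvdE dvd_div_mult_self mult.commute mult.assoc dvd_mult_div_cancel)
  define M' where "M' = M * q"
  have pos: "0 < M" "0 < q" "0 < M'" using N_pos q by (auto simp: M'_def)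
  have p2: "2 \<le> p" using p prime_ge_2_nat by auto
  have N': "N = p * M'" using q M'_def by simp
  have le': "2 * M' \<le> N" using p2 N' by simp
  moreover have "M \<le> M'" using pos M'_def by simp
  ultimately have le: "2 * M \<le> N" by simp
  have ex: "\<exists>j. shift N M (F w j) = F w j" if w: "w \<in> X" "(R ^^ M) w = w" for w
  proof -
    have "(R ^^ (i * M)) w = w" for i by (induction i) (use w in \<open>simp_all add: funpow_add\<close>)
    from this[of q] have w': "(R ^^ M') w = w" unfolding M'_def by (simp add: mult.commute)
    have "\<exists>T\<in>range (F w). shift N M' T = T"
    proof (rule prime_order_fixed_point[where p = p])
      show "prime p" by (rule p(1))
      show "finite (range (F w))" using range_F w by simp
      show "\<not> p dvd card (range (F w))" using range_F card_range w p by simp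
      show "shift N M' T \<in> range (F w)" if T: "T \<in> range (F w)" for T
      proof -
        obtain i where "T = F w i" using T by blast
        then have "shift N M' T = F w (i + M')" using F_shift_fixed[OF w(1) w'] by simp
        then show ?thesis by simp
      qed
      show "(shift N M' ^^ p) T = T" if "T \<in> range (F w)" for T
      proof -
        have "T \<subseteq> {..<N}" using F_subset w that by blast
        then show ?thesis using shift_pow shift_multiple N' by simp
      qed
    qed
    then obtain j where j: "shift N M' (F w j) = F w j" by auto
    \<comment> \<open>The shift by \<open>M\<close> preserves \<open>M'\<close>-periodicity, and
      \<open>w\<close> has only one \<open>M'\<close>-periodic subset.\<close>
    have "shift N M' (F w (j + M)) = F w (j + M)"
      using F_shift_fixed[OF w, of j] j by (metis add.commute shift_add)
    then have "F w (j + M) = F w j" using periodic_unique'[OF w(1) w' pos(3) le'] j by blast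
    then show ?thesis using F_shift_fixed[OF w] by auto
  qed
  define h where "h w = F w (SOME j. shift N M (F w j) = F w j)" for w
  have h: "shift N M (h w) = h w" if "w \<in> X" "(R ^^ M) w = w" for w
    unfolding h_def by (rule someI_ex) (rule ex[OF that])
  have "bij_betw h ?A ?B"
  proof (rule bij_betwI')
    show "(h x = h y) = (x = y)" if "x \<in> ?A" "y \<in> ?A" for x y
      using that F_unique unfolding h_def by auto
    show "h x \<in> ?B" if "x \<in> ?A" for x
    proof -
      have "h x \<subseteq> {..<N}" "card (h x) = c" using that F_subset card_F unfolding h_def by auto
      then show ?thesis using that h by auto
    qed
    show "\<exists>x\<in>?A. T = h x" if T: "T \<in> ?B" for T
    proof -
      obtain w j where wj: "w \<in> X" "T = F w j" using F_cover T by blast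
      have Rw: "(R ^^ M) w = w" using fixed_if_periodic[OF wj(1), of M j] wj T le by simp
      have "T = h w" unfolding wj(2) h_def
        by (rule periodic_unique'[OF wj(1) Rw pos(1) le]) (use wj T h[OF wj(1) Rw] in \<open>auto simp: h_def\<close>)
      then show ?thesis using wj Rw by auto
    qed
  qed
  then show ?thesis by (rule bij_betw_same_card)
qed

end

text \<open>A periodic set is the union of the \<open>e\<close> translates of its part below
  \<open>M\<close>.\<close>

lemma card_periodic_subsets:
  assumes N: "N = e * M" and pos: "0 < e" "0 < M"
  shows "card {T. T \<subseteq> {..<N} \<and> card T = c \<and> shift N M T = T} = (if e dvd c then M choose (c div e) else 0)"
proof -
  define lift where "lift U = {x. x < N \<and> x mod M \<in> U}" for U
  have card_lift: "card (lift U) = e * card U" if U: "U \<subseteq> {..<M}" for U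
  proof -
    have "bij_betw (\<lambda>(i, x). i * M + x) ({..<e} \<times> U) (lift U)"
    proof (rule bij_betw_byWitness[where f' = "\<lambda>y. (y div M, y mod M)"])
      have "i * M + x < e * M" if "i < e" "x < M" for i x
      proof -
        have "i * M + x < Suc i * M" using that by simp
        also have "\<dots> \<le> e * M" using that by (intro mult_le_mono1) simp
        finally show ?thesis .
      qed
      then show "(\<lambda>(i, x). i * M + x) ` ({..<e} \<times> U) \<subseteq> lift U"
        using U unfolding lift_def N by (auto simp: subset_iff)
      show "(\<lambda>y. (y div M, y mod M)) ` lift U \<subseteq> {..<e} \<times> U"
        unfolding lift_def N by (auto simp: less_mult_imp_div_less)
    qed (use U pos in \<open>auto simp: subset_iff\<close>)
    then show ?thesis by (metis bij_betw_same_card card_cartesian_product card_lessThan)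
  qed
  have lift_shift: "shift N M (lift U) = lift U" if U: "U \<subseteq> {..<M}" for U
  proof -
    have "shift N M (lift U) \<subseteq> lift U"
      unfolding shift_def lift_def using N pos by (auto simp: mod_mod_cancel)
    moreover have "card (shift N M (lift U)) = card (lift U)"
      unfolding shift_def by (rule card_image, rule inj_on_subset[OF inj_on_shift]) (auto simp: lift_def)
    moreover have "finite (lift U)" unfolding lift_def by simp
    ultimately show ?thesis by (metis card_subset_eq)
  qed
  have T_lift: "T = lift (T \<inter> {..<M})" if T: "T \<subseteq> {..<N}" "shift N M T = T" for T
  proof -
    have step: "y + M \<in> T \<longleftrightarrow> y \<in> T" if y: "y + M < N" for y
    proof
      assume "y \<in> T"
      then have "(y + M) mod N \<in> shift N M T" unfolding shift_def by blast
      then show "y + M \<in> T" using T y by simp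
    next
      assume "y + M \<in> T"
      then obtain z where z: "z \<in> T" "(z + M) mod N = (y + M) mod N"
        using T y unfolding shift_def by force
      have "z = y" by (rule inj_onD[OF inj_on_shift[of M N] z(2)]) (use z T y in auto)
      then show "y \<in> T" using z by simp
    qed
    have "x \<in> T \<longleftrightarrow> x mod M \<in> T" if "x < N" for x
      using that
    proof (induction x rule: less_induct)
      case (less x)
      show ?case
      proof (cases "x < M")
        case False
        then show ?thesis using step[of "x - M"] less.IH[of "x - M"] less.prems pos by (simp add: le_mod_geq)
      qed simp
    qed
    then show ?thesis unfolding lift_def using T pos by auto
  qed
  have "bij_betw lift {U. U \<subseteq> {..<M} \<and> e * card U = c} {T. T \<subseteq> {..<N} \<and> card T = c \<and> shift N M T = T}"
  proof (rule bij_betw_byWitness[where f' = "\<lambda>T. T \<inter> {..<M}"])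
    have "M \<le> N" using N pos by simp
    then show "\<forall>U\<in>{U. U \<subseteq> {..<M} \<and> e * card U = c}. lift U \<inter> {..<M} = U"
      unfolding lift_def by auto
    show "\<forall>T\<in>{T. T \<subseteq> {..<N} \<and> card T = c \<and> shift N M T = T}. lift (T \<inter> {..<M}) = T"
      using T_lift by auto
    show "lift ` {U. U \<subseteq> {..<M} \<and> e * card U = c} \<subseteq> {T. T \<subseteq> {..<N} \<and> card T = c \<and> shift N M T = T}"
      using card_lift lift_shift by (auto simp: lift_def)
    show "(\<lambda>T. T \<inter> {..<M}) ` {T. T \<subseteq> {..<N} \<and> card T = c \<and> shift N M T = T} \<subseteq> {U. U \<subseteq> {..<M} \<and> e * card U = c}"
    proof clarify
      fix T assume "T \<subseteq> {..<N}" "shift N M T = T"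
      then show "T \<inter> {..<M} \<subseteq> {..<M} \<and> e * card (T \<inter> {..<M}) = card T"
        using T_lift[of T] card_lift[of "T \<inter> {..<M}"] by simp
    qed
  qed
  then have "card {T. T \<subseteq> {..<N} \<and> card T = c \<and> shift N M T = T} = card {U. U \<subseteq> {..<M} \<and> e * card U = c}"
    by (rule bij_betw_same_card[symmetric])
  also have "\<dots> = (if e dvd c then M choose (c div e) else 0)"
  proof (cases "e dvd c")
    case True
    then have "{U. U \<subseteq> {..<M} \<and> e * card U = c} = {U. U \<subseteq> {..<M} \<and> card U = c div e}"
      using pos by auto
    then show ?thesis using True n_subsets[of "{..<M}" "c div e"] by simp
  next
    case False
    then have "{U. U \<subseteq> {..<M} \<and> e * card U = c} = {}" by auto
    then show ?thesis using False by (simp only: card.empty if_False)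
  qed
  finally show ?thesis .
qed

section \<open>Fixed words\<close>

definition spread :: "nat \<Rightarrow> bool list \<Rightarrow> nat set" where
  "spread j v = (\<lambda>i. (j + i) mod length v) ` {i. i < length v \<and> v ! i}"

lemma spread_mem_iff:
  assumes "i < length v"
  shows "(j + i) mod length v \<in> spread j v \<longleftrightarrow> v ! i"
proof
  assume "(j + i) mod length v \<in> spread j v"
  then obtain i' where "i' < length v" "v ! i'" "(j + i) mod length v = (j + i') mod length v"
    unfolding spread_def by auto
  then show "v ! i" using add_mod_inj[of j i "length v" i'] assms by simp
qed (use assms in \<open>simp add: spread_def\<close>)

lemma spread_subset: "spread j v \<subseteq> {..<length v}"
  unfolding spread_def by (cases "v = []") auto

lemma card_spread: "card (spread j v) = count_list v True"
proof -
  have "card (spread j v) = card {i. i < length v \<and> v ! i}"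
    unfolding spread_def by (rule card_image) (auto intro: inj_onI add_mod_inj)
  also have "\<dots> = count_list v True"
    by (simp add: count_list_eq_length_filter length_filter_conv_card eq_commute[of True])
  finally show ?thesis .
qed

lemma spread_eqI:
  assumes "length v = length v'" "\<And>i. i < length v \<Longrightarrow> v ! i \<longleftrightarrow> (j + i) mod length v \<in> T"
    and "T \<subseteq> {..<length v}"
  shows "spread j v = T"
proof (rule Set.set_eqI)
  fix x
  show "x \<in> spread j v \<longleftrightarrow> x \<in> T"
  proof (cases "x < length v")
    case True
    then obtain i where "i < length v" "x = (j + i) mod length v" using residue_offset by metis
    then show ?thesis using assms(2) spread_mem_iff by simp
  qed (use assms(3) spread_subset in blast)
qed

lemma spread_inj:
  assumes "spread j v = spread j v'" "length v = length v'"
  shows "v = v'"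
proof (rule nth_equalityI)
  fix i assume "i < length v"
  then show "v ! i = v' ! i" using spread_mem_iff[of i v j] spread_mem_iff[of i v' j] assms by simp
qed (use assms in simp)

lemma spread_rotate: "spread (j + t) (rotate t v) = spread j v"
proof (rule spread_eqI[OF refl])
  fix i assume i: "i < length (rotate t v)"
  then have "(j + (t + i) mod length v) mod length v = (j + t + i) mod length v"
    by (simp add: mod_simps add.assoc)
  then show "rotate t v ! i \<longleftrightarrow> (j + t + i) mod length (rotate t v) \<in> spread j v"
    using i spread_mem_iff[of "(t + i) mod length v" v j] mod_less_divisor[of "length v" "t + i"]
    by (cases "v = []") (simp_all add: nth_rotate)
qed (use spread_subset[of j v] in simp)

lemma shift_spread: "shift (length v) M (spread j v) = spread (j + M) v"
  unfolding shift_def spread_def image_image by (simp add: mod_simps add_ac)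

lemma spread_hd:
  "j mod Suc (length z) \<in> spread j (True # z)"
  "j mod Suc (length z) \<notin> spread j (False # z)"
  "spread j (True # z) = insert (j mod Suc (length z)) (spread j (False # z))"
proof -
  show 1: "j mod Suc (length z) \<in> spread j (True # z)" and 2: "j mod Suc (length z) \<notin> spread j (False # z)"
    using spread_mem_iff[of 0 "True # z" j] spread_mem_iff[of 0 "False # z" j] by auto
  show "spread j (True # z) = insert (j mod Suc (length z)) (spread j (False # z))"
  proof (rule spread_eqI[OF refl])
    fix i assume i: "i < length (True # z)"
    have "(j + i) mod Suc (length z) = j mod Suc (length z) \<longleftrightarrow> i = 0"
      using add_mod_inj[of j i "Suc (length z)" 0] i by auto
    then show "(True # z) ! i \<longleftrightarrow> (j + i) mod length (True # z) \<in> insert (j mod Suc (length z)) (spread j (False # z))"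
      using i spread_mem_iff[of i "False # z" j] by (cases i) auto
  qed (use spread_subset[of j "False # z"] in auto)
qed

section \<open>The states of a ballot word\<close>

definition ballots :: "nat \<Rightarrow> nat \<Rightarrow> bool list set" where
  "ballots m n = {w. balanced m w \<and> length w = (m + 1) * n}"

text \<open>The reading position advances with each turn. As \<open>turn\<close> drops the leading
  letter, all other letters keep their places on the cycle; only the mark at the reading position
  moves, to the place of the flipped letter.\<close>

definition state :: "nat \<Rightarrow> bool list \<Rightarrow> nat \<Rightarrow> nat set" where
  "state m w j = spread j ((turn m ^^ j) w)"

lemma finite_ballots: "finite (ballots m n)"
  by (rule finite_subset[OF _ finite_lists_length_eq[of UNIV "(m + 1) * n"]]) (auto simp: ballots_def)

lemma ballots_count:
  assumes "w \<in> ballots m n"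
  shows "count_list w True = n"
proof -
  have "int (Suc m) * int (count_list w True) = int (Suc m) * int n"
    using assms height_count[of m w] by (simp add: ballots_def balanced_height algebra_simps)
  then show ?thesis by (metis mult_cancel_left nat.distinct(1) of_nat_eq_iff of_nat_0)
qed

lemma ballots_turn: "0 < m \<Longrightarrow> w \<in> ballots m n \<Longrightarrow> (turn m ^^ j) w \<in> ballots m n"
  unfolding ballots_def using balanced_turn_pow by auto

lemma ballots_period:
  assumes "0 < m" "w \<in> ballots m n" "(m + 1) * n dvd M"
  shows "(turn m ^^ M) w = w"
proof -
  obtain c where "M = (m + 1) * n * c" using assms(3) by blast
  moreover have "(turn m ^^ (c * length w)) w = w"
    by (induction c) (use turn_pow_length[of m w] assms in \<open>simp_all add: funpow_add ballots_def\<close>)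
  ultimately show ?thesis using assms(2) by (simp add: ballots_def mult_ac)
qed

lemma state_turn: "shift (length w) M (state m ((turn m ^^ M) w) j) = state m w (j + M)"
  if "0 < m" "w \<in> ballots m n"
proof -
  have "length ((turn m ^^ (j + M)) w) = length w"
    using that ballots_turn[OF that, of "j + M"] by (simp add: ballots_def)
  moreover have "(turn m ^^ j) ((turn m ^^ M) w) = (turn m ^^ (j + M)) w"
    by (simp add: funpow_add)
  ultimately show ?thesis unfolding state_def using shift_spread[of "(turn m ^^ (j + M)) w" M j] by simp
qed

lemma state_rotate:
  assumes "(turn m ^^ t) ((turn m ^^ j) w) = rotate t ((turn m ^^ j) w)"
  shows "state m w (j + t) = state m w j"
  using assms spread_rotate[of j t "(turn m ^^ j) w"]
  unfolding state_def by (simp add: funpow_add add.commute[of j t])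

text \<open>Both pieces at the cut are prefixes of balanced words, so their heights are nonnegative
  with sum 0. Hence both pieces are balanced, and \<open>turn_pow_append\<close> applies.\<close>

lemma turn_pow_eq_rotate:
  assumes "0 < m" "v \<in> ballots m n" "rotate t v \<in> ballots m n"
  shows "(turn m ^^ t) v = rotate t v"
proof -
  define d where "d = t mod length v"
  define B C where "B = take d v" and "C = drop d v"
  have v: "v = B @ C" "rotate t v = C @ B" by (simp_all add: B_def C_def d_def rotate_drop_take)
  have "balanced m (B @ C)" "balanced m (C @ B)" using assms(2,3) v unfolding ballots_def by auto
  then have "0 \<le> height m B" "0 \<le> height m C" "height m B + height m C = 0"
    using balanced_prefix balanced_height[of m "B @ C"] by auto
  then have "height m B = 0" by simp
  then have bal: "balanced m B" "balanced m C" using balanced_append_cancel[OF \<open>balanced m (B @ C)\<close>] by auto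
  have "(turn m ^^ t) v = (turn m ^^ (d + t div length v * length v)) v" by (simp add: d_def)
  also have "\<dots> = (turn m ^^ d) v"
    unfolding funpow_add comp_apply
    by (subst ballots_period[OF assms(1,2)]) (use assms(2) in \<open>simp_all add: ballots_def\<close>)
  also have "\<dots> = (turn m ^^ length B) (B @ C)"
  proof (cases "v = []")
    case True
    have "(turn m ^^ i) [] = []" for i by (induction i) (simp_all add: turn_def)
    then show ?thesis using True v(1) by simp
  next
    case False
    then have "length B = d" by (simp add: B_def d_def less_imp_le_nat)
    then show ?thesis using v by simp
  qed
  finally show ?thesis using turn_pow_append[OF assms(1) bal] v by simp
qed

text \<open>In \<open>True # A @ False # B\<close> the mark at \<open>j\<close> is thrown to the
  flipped letter, \<open>length A + 1\<close> places ahead; this is the only new element of the next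
  state, so \<open>the_elem\<close> finds it.\<close>

lemma state_juggling:
  assumes m: "0 < m" and w: "w \<in> ballots m n" and n: "0 < n"
  shows "juggling ((m + 1) * n) (state m w) (\<lambda>j. the_elem (state m w (Suc j) - state m w j))"
proof -
  define N where "N = (m + 1) * n"
  have N_pos: "0 < N" using n by (simp add: N_def)
  have len: "length ((turn m ^^ j) w) = N" for j
    using ballots_turn[OF m w, of j] by (simp add: ballots_def N_def)
  have period: "state m w (j + N) = state m w j" for j
    using ballots_period[OF m ballots_turn[OF m w], of N j] rotate_id[of N "(turn m ^^ j) w"] len[of j]
    by (intro state_rotate) (simp add: N_def)
  have key: "\<exists>s<N. the_elem (state m w (Suc j) - state m w j) = s \<and> s \<notin> state m w j \<and> j mod N \<in> state m w j \<and>
      state m w (Suc j) = insert s (state m w j - {j mod N}) \<and> state m w s = state m w (Suc j)" for j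
  proof -
    define v where "v = (turn m ^^ j) w"
    have bal: "balanced m v" "length v = N" using ballots_turn[OF m w, of j] by (simp_all add: ballots_def N_def v_def)
    then have "v \<noteq> []" using N_pos by auto
    then obtain A B where v: "v = True # A @ False # B" "balanced m A"
      using balanced_decomp[OF m bal(1)] by metis
    define v' where "v' = turn m v"
    have v': "v' = A @ True # B @ [False]" unfolding v'_def v(1) by (rule turn_eq[OF v(2)])
    have lv': "length v' = N" using v v' bal by simp
    define s where "s = (Suc j + length A) mod N"
    have sN: "s < N" using N_pos by (simp add: s_def)
    have st: "state m w j = spread j v" "state m w (Suc j) = spread (Suc j) v'"
      by (simp_all add: state_def v_def v'_def)
    have lA: "Suc (length A) < N" using v bal by simp
    have s_notin: "s \<notin> spread j v"
      using spread_mem_iff[of "Suc (length A)" v j] lA bal(2) v(1) by (simp add: s_def nth_append)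
    have j_in: "j mod N \<in> spread j v"
      using spread_mem_iff[of 0 v j] N_pos bal(2) v(1) by simp
    have step: "spread (Suc j) v' = insert s (spread j v - {j mod N})"
    proof (rule spread_eqI[OF refl])
      show "insert s (spread j v - {j mod N}) \<subseteq> {..<length v'}"
        using spread_subset[of j v] sN lv' bal by auto
      fix i assume "i < length v'"
      then have i: "i < N" using lv' by simp
      show "v' ! i \<longleftrightarrow> (Suc j + i) mod length v' \<in> insert s (spread j v - {j mod N})"
      proof (cases "Suc i = N")
        \<comment> \<open>The last letter of \<open>v'\<close> stands at \<open>j\<close> itself,
          the position just vacated.\<close>
        case True
        then have "(Suc j + i) mod N = j mod N" by (metis add_Suc_shift mod_add_self2)
        moreover have "j mod N \<noteq> s" using j_in s_notin by auto
        moreover have "i = Suc (length A + length B)" using True v bal by simp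
        ultimately show ?thesis using lv' v' by (simp add: nth_append)
      next
        case False
        then have Si: "Suc i < N" using i by simp
        have eq: "(Suc j + i) mod N = (j + Suc i) mod N" by simp
        have "(j + Suc i) mod N \<in> spread j v \<longleftrightarrow> v ! Suc i" using spread_mem_iff[of "Suc i" v j] Si bal by simp
        moreover have "(j + Suc i) mod N = s \<longleftrightarrow> i = length A"
          using add_mod_inj[of j "Suc i" N "Suc (length A)"] Si lA by (auto simp: s_def)
        moreover have "(j + Suc i) mod N \<noteq> j mod N"
          using add_mod_inj[of j "Suc i" N 0] Si N_pos by auto
        moreover have "v' ! i \<longleftrightarrow> v ! Suc i \<or> i = length A"
          unfolding v v' using Si bal(2) v(1) by (auto simp: nth_append nth_Cons split: nat.splits)
        ultimately show ?thesis using eq lv' by auto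
      qed
    qed
    \<comment> \<open>The jump: starting at time \<open>Suc j\<close>, \<open>length A\<close> turns
      carry the balanced \<open>A\<close> to the back. This is a rotation, so the state at the
      landing position equals that at \<open>Suc j\<close>.\<close>
    have "state m w (Suc j + length A) = state m w (Suc j)"
    proof (rule state_rotate)
      have bal': "balanced m (True # B @ [False])" using balanced_swap bal v by auto
      have "(turn m ^^ Suc j) w = A @ (True # B @ [False])" using v' by (simp add: v'_def v_def)
      then show "(turn m ^^ length A) ((turn m ^^ Suc j) w) = rotate (length A) ((turn m ^^ Suc j) w)"
        using turn_pow_append[OF m v(2) bal'] by (simp only: rotate_append)
    qed
    moreover have "state m w (x mod N) = state m w x" for x
    proof (induction x rule: less_induct)
      case (less x)
      show ?case
      proof (cases "x < N")
        case False
        then show ?thesis using less.IH[of "x - N"] period[of "x - N"] N_pos by (simp add: le_mod_geq)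
      qed simp
    qed
    ultimately have "state m w s = state m w (Suc j)" by (simp add: s_def)
    moreover have "the_elem (state m w (Suc j) - state m w j) = s"
    proof -
      have "state m w (Suc j) - state m w j = {s}" using st step s_notin by auto
      then show ?thesis by simp
    qed
    ultimately show ?thesis using sN s_notin j_in step st by auto
  qed
  show ?thesis
    unfolding N_def[symmetric]
  proof
    show "state m w j \<subseteq> {..<N}" for j
      using spread_subset[of j "(turn m ^^ j) w"] len[of j] by (simp add: state_def)
    show "state m w N = state m w 0" using period[of 0] by simp
    fix j assume j: "j < N"
    from key[of j] obtain s where s: "s < N" "the_elem (state m w (Suc j) - state m w j) = s" "s \<notin> state m w j"
      "j mod N \<in> state m w j" "state m w (Suc j) = insert s (state m w j - {j mod N})" "state m w s = state m w (Suc j)"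
      by blast
    have jN: "j mod N = j" using j by simp
    show "the_elem (state m w (Suc j) - state m w j) < N" "the_elem (state m w (Suc j) - state m w j) \<notin> state m w j"
      "j \<in> state m w j" using s jN by auto
    show "state m w (Suc j) = insert (the_elem (state m w (Suc j) - state m w j)) (state m w j - {j})"
      unfolding s(2) using s(5) jN by simp
    show "state m w (the_elem (state m w (Suc j) - state m w j)) = state m w (Suc j)"
      unfolding s(2) by (rule s(6))
  qed (use N_pos in simp)
qed

text \<open>As \<open>N = (m + 1) * n\<close> turns are the identity, \<open>(N - 1) * j\<close>
  further turns undo \<open>j\<close> turns.\<close>

lemma turn_pow_inj:
  assumes "0 < m" "w \<in> ballots m n" "w' \<in> ballots m n" "(turn m ^^ j) w = (turn m ^^ j) w'"
  shows "w = w'"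
proof -
  have *: "(turn m ^^ (((m + 1) * n - 1) * j)) ((turn m ^^ j) v) = v" if "v \<in> ballots m n" "0 < n" for v
  proof -
    have "((m + 1) * n - 1) * j + j = (m + 1) * n * j" using that(2) by (cases "(m + 1) * n") auto
    then have "(turn m ^^ (((m + 1) * n - 1) * j)) ((turn m ^^ j) v) = (turn m ^^ ((m + 1) * n * j)) v"
      by (metis comp_apply funpow_add)
    then show ?thesis using ballots_period[OF assms(1) that(1)] by simp
  qed
  show ?thesis
  proof (cases "n = 0")
    case False
    then show ?thesis using *[OF assms(2)] *[OF assms(3)] assms(4) by simp
  qed (use assms in \<open>auto simp: ballots_def\<close>)
qed

lemma turn_pow_surj:
  assumes "0 < m" "0 < n" "v \<in> ballots m n"
  obtains w where "w \<in> ballots m n" "(turn m ^^ j) w = v"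
proof
  let ?i = "((m + 1) * n - 1) * j"
  show "(turn m ^^ ?i) v \<in> ballots m n" by (rule ballots_turn[OF assms(1,3)])
  have "j + ?i = (m + 1) * n * j" using assms(2) by (cases "(m + 1) * n") auto
  then have "(turn m ^^ j) ((turn m ^^ ?i) v) = (turn m ^^ ((m + 1) * n * j)) v"
    by (metis comp_apply funpow_add)
  then show "(turn m ^^ j) ((turn m ^^ ?i) v) = v" using ballots_period[OF assms(1,3)] by simp
qed

text \<open>The step makes the iterates of both words agree at the later time, and powers of
  \<open>turn\<close> are injective. By symmetry the first word may be taken to have the earlier
  time.\<close>

lemma unique_if_turn_pow:
  assumes m: "0 < m" and w: "w \<in> ballots m n" "w' \<in> ballots m n" and eq: "F w j = F w' j'"
    and step: "\<And>w w' j d. w \<in> ballots m n \<Longrightarrow> w' \<in> ballots m n \<Longrightarrow> F w j = F w' (j + d) \<Longrightarrow>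
      (turn m ^^ d) ((turn m ^^ j) w) = (turn m ^^ (j + d)) w'"
  shows "w = w'"
proof -
  have main: "w = w'" if "j \<le> j'" "w \<in> ballots m n" "w' \<in> ballots m n" "F w j = F w' j'" for w w' j j'
  proof -
    have "(turn m ^^ j') w = (turn m ^^ j') w'"
      using step[OF that(2,3), of j "j' - j"] that(1,4) by (metis comp_apply funpow_add le_add_diff_inverse le_add_diff_inverse2)
    then show ?thesis using turn_pow_inj[OF m that(2,3)] by simp
  qed
  show ?thesis using main[of j j' w w'] main[of j' j w' w] w eq by (cases "j \<le> j'") auto
qed

lemma state_unique:
  assumes m: "0 < m" and w: "w \<in> ballots m n" "w' \<in> ballots m n" and eq: "state m w j = state m w' j'"
  shows "w = w'"
proof (rule unique_if_turn_pow[OF m w, of "state m", OF eq])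
  fix w w' j d assume w: "w \<in> ballots m n" "w' \<in> ballots m n" and eq: "state m w j = state m w' (j + d)"
  define v v' where "v = (turn m ^^ j) w" and "v' = (turn m ^^ (j + d)) w'"
  have v: "v \<in> ballots m n" "v' \<in> ballots m n" unfolding v_def v'_def using ballots_turn m w by auto
  have "spread (j + d) v' = spread (j + d) (rotate d v)"
    using eq spread_rotate[of j d v] unfolding state_def v_def v'_def by simp
  then have "v' = rotate d v" using spread_inj[of "j + d" v' "rotate d v"] v by (simp add: ballots_def)
  then have "(turn m ^^ d) v = v'" using turn_pow_eq_rotate[OF m v(1)] v(2) by simp
  then show "(turn m ^^ d) ((turn m ^^ j) w) = (turn m ^^ (j + d)) w'" by (simp only: v_def v'_def)
qed

lemma word_of_set:
  assumes "T \<subseteq> {..<N}"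
  obtains u where "length u = N" "spread 0 u = T" "count_list u True = card T"
proof
  let ?u = "map (\<lambda>i. i \<in> T) [0..<N]"
  show "length ?u = N" by simp
  show "spread 0 ?u = T" by (rule spread_eqI[OF refl]) (use assms in auto)
  then show "count_list ?u True = card T" using card_spread by metis
qed

text \<open>The cutting point of the cycle lemma: the earliest prefix of minimal height. Minimality
  serves sets of \<open>n\<close> marks; being the earliest matters for \<open>n - 1\<close>
  marks.\<close>

lemma exists_lowest_prefix:
  obtains p q where "u = p @ q" "\<And>p' q'. u = p' @ q' \<Longrightarrow> height m p \<le> height m p'"
    "\<And>p' q'. p = p' @ q' \<Longrightarrow> q' \<noteq> [] \<Longrightarrow> height m p < height m p'"
proof -
  have "\<exists>p q. u = p @ q \<and> (\<forall>p' q'. u = p' @ q' \<longrightarrow> height m p \<le> height m p') \<and>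
    (\<forall>p' q'. p = p' @ q' \<longrightarrow> q' \<noteq> [] \<longrightarrow> height m p < height m p')"
  proof (induction u rule: rev_induct)
    case (snoc x u)
    then obtain p q where pq: "u = p @ q" "\<forall>p' q'. u = p' @ q' \<longrightarrow> height m p \<le> height m p'"
      "\<forall>p' q'. p = p' @ q' \<longrightarrow> q' \<noteq> [] \<longrightarrow> height m p < height m p'" by blast
    have prefix: "p' = u @ [x] \<or> (\<exists>r. u = p' @ r)" if "u @ [x] = p' @ q'" for p' q'
      using that by (cases q' rule: rev_cases) auto
    show ?case
    proof (cases "height m (u @ [x]) < height m p")
      case True
      have A: "height m (u @ [x]) \<le> height m p'" if "u @ [x] = p' @ q'" for p' q'
        using prefix[OF that] pq(2) True by fastforce
      have B: "height m (u @ [x]) < height m p'" if "u @ [x] = p' @ q'" "q' \<noteq> []" for p' q'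
        using prefix[OF that(1)] pq(2) True that by fastforce
      show ?thesis
        by (rule exI[of _ "u @ [x]"], rule exI[of _ "[]"], intro conjI allI impI) (simp, (erule A B)+)
    next
      case False
      have A: "height m p \<le> height m p'" if "u @ [x] = p' @ q'" for p' q'
        using prefix[OF that] pq(2) False by fastforce
      show ?thesis
        by (rule exI[of _ p], rule exI[of _ "q @ [x]"], intro conjI allI impI)
          (simp add: pq(1), erule A, use pq(3) in blast)
    qed
  qed simp
  then show ?thesis using that by blast
qed

text \<open>Cycle lemma: \<open>n\<close> marks have total height 0, and reading from a lowest point
  keeps all prefix heights nonnegative.\<close>

lemma state_cover:
  assumes m: "0 < m" and n: "0 < n" and T: "T \<subseteq> {..<(m + 1) * n}" "card T = n"
  shows "\<exists>w\<in>ballots m n. \<exists>j. T = state m w j"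
proof -
  obtain u where u: "length u = (m + 1) * n" "spread 0 u = T" "count_list u True = card T"
    using word_of_set[OF T(1)] by metis
  obtain p q where pq: "u = p @ q" "\<And>p' q'. u = p' @ q' \<Longrightarrow> height m p \<le> height m p'"
    using exists_lowest_prefix by metis
  have "height m u = int (Suc m) * int n - int ((m + 1) * n)"
    unfolding height_count by (simp only: u T(2))
  then have hu: "height m p + height m q = 0" using pq(1) by (simp add: algebra_simps)
  have "0 \<le> height m a" if "q @ p = a @ b" for a b
  proof -
    consider c where "q = a @ c" | c where "a = q @ c" "p = c @ b"
      using \<open>q @ p = a @ b\<close> by (auto simp: append_eq_append_conv2)
    then show ?thesis
    proof cases
      case 1
      then show ?thesis using pq(1) pq(2)[of "p @ a" c] by simp
    next
      case 2
      then show ?thesis using pq(1) pq(2)[of c "b @ q"] hu by simp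
    qed
  qed
  then have "balanced m (q @ p)" using hu unfolding balanced_def by auto
  then have "rotate (length p) u \<in> ballots m n" using u(1) pq(1) by (simp add: ballots_def rotate_append)
  then obtain w where w: "w \<in> ballots m n" "(turn m ^^ length p) w = rotate (length p) u"
    using turn_pow_surj[OF m n] by metis
  have "state m w (length p) = T" unfolding state_def w(2) using spread_rotate[of 0 "length p" u] u by simp
  then show ?thesis using w by blast
qed

section \<open>States with the reading position erased\<close>

text \<open>Erasing the leading letter makes the block of position \<open>j\<close> the central one; the result depends on that
  block only.\<close>

definition residue :: "nat \<Rightarrow> bool list \<Rightarrow> nat \<Rightarrow> nat set" where
  "residue m w j = state m w j - {j mod length w}"

lemma residue_spread:
  assumes "(turn m ^^ j) w = True # z" "length w = Suc (length z)"
  shows "residue m w j = spread j (False # z)"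
  using spread_hd[of j z] assms unfolding residue_def state_def by auto

lemma ballots_Cons:
  assumes "w \<in> ballots m n" "0 < n"
  obtains z where "w = True # z"
  using assms balanced_hd[of m w] unfolding ballots_def by fastforce

text \<open>Equal residues say that the words with leading letter replaced by \<open>False\<close>
  are rotations of each other. A nontrivial cut splits them into \<open>False # Y\<close> and
  \<open>False # b\<close>, and \<open>turn_pow_swap\<close> realizes this rotation by a power of
  \<open>turn\<close>.\<close>

lemma residue_unique:
  assumes m: "0 < m" and n: "0 < n" and w: "w \<in> ballots m n" "w' \<in> ballots m n"
    and eq: "residue m w j = residue m w' j'"
  shows "w = w'"
proof (rule unique_if_turn_pow[OF m w, of "residue m", OF eq])
  fix w w' j d0 assume w: "w \<in> ballots m n" "w' \<in> ballots m n" and eq: "residue m w j = residue m w' (j + d0)"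
  have v: "(turn m ^^ j) w \<in> ballots m n" "(turn m ^^ (j + d0)) w' \<in> ballots m n"
    using ballots_turn m w by auto
  obtain z z' where z: "(turn m ^^ j) w = True # z" "(turn m ^^ (j + d0)) w' = True # z'"
    using ballots_Cons n v by metis
  have len: "length w = Suc (length z)" "length w' = Suc (length z')" "length z = length z'"
    using v w z by (auto simp: ballots_def)
  define d where "d = d0 mod Suc (length z)"
  have "spread (j + d0) (False # z') = spread (j + d0) (rotate d0 (False # z))"
    using eq residue_spread z len spread_rotate by metis
  then have rot: "False # z' = rotate d0 (False # z)"
    using spread_inj[of "j + d0" "False # z'" "rotate d0 (False # z)"] len by simp
  define B C where "B = take d (False # z)" and "C = drop d (False # z)"
  have BC: "False # z = B @ C" "False # z' = C @ B"
    using rot by (simp_all add: B_def C_def d_def rotate_drop_take)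
  have dl: "d < Suc (length z)" by (simp add: d_def)
  have "(turn m ^^ d0) (True # z) = (turn m ^^ (d + d0 div Suc (length z) * Suc (length z))) (True # z)"
    by (simp only: d_def mod_div_mult_eq)
  also have "\<dots> = (turn m ^^ d) (True # z)"
    unfolding funpow_add comp_apply
    by (subst ballots_period[OF m v(1)[unfolded z(1)]]) (use v(1) z(1) in \<open>simp_all add: ballots_def\<close>)
  also have "\<dots> = True # z'"
  proof (cases B)
    case Nil
    then have "d = 0" by (cases d) (simp_all add: B_def)
    moreover have "z' = z" using BC Nil by (metis append_Nil append_Nil2 list.inject)
    ultimately show ?thesis by simp
  next
    case (Cons x Y)
    then have B: "B = False # Y" using BC by simp
    have d: "d = Suc (length Y)" using dl B arg_cong[OF B_def, of length] by simp
    then have "C \<noteq> []" using dl by (simp add: C_def)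
    then obtain b where C: "C = False # b" using BC by (cases C) auto
    have zz: "z = Y @ False # b" "z' = b @ False # Y" using BC B C by simp_all
    \<comment> \<open>\<open>y2\<close> is a suffix of the balanced word \<open>True # z'\<close>:
      what precedes it has nonnegative height, and the total is 0.\<close>
    have "sinking m Y" unfolding sinking_def
    proof (intro allI impI)
      fix y1 y2 assume Y: "Y = y1 @ y2"
      have bal: "balanced m ((True # b @ False # y1) @ y2)" using v(2) z(2) zz Y by (simp add: ballots_def)
      then show "height m y2 \<le> 0" using balanced_prefix[OF bal] balanced_height[OF bal] by simp
    qed
    then show ?thesis using turn_pow_swap[OF m, of Y b] v(1) z(1) zz unfolding d by (simp add: ballots_def)
  qed
  finally show "(turn m ^^ d0) ((turn m ^^ j) w) = (turn m ^^ (j + d0)) w'" using z by simp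
qed

text \<open>With \<open>n - 1\<close> marks the total height is \<open>- m - 1\<close>. The
  \<open>False\<close> that first reaches the minimum is the letter to replace by
  \<open>True\<close>: this repairs the total, and reading from it keeps the heights
  nonnegative.\<close>

lemma residue_cover:
  assumes m: "0 < m" and n: "0 < n" and T: "T \<subseteq> {..<(m + 1) * n}" "card T = n - 1"
  shows "\<exists>w\<in>ballots m n. \<exists>j. T = residue m w j"
proof -
  obtain u where u: "length u = (m + 1) * n" "spread 0 u = T" "count_list u True = card T"
    using word_of_set[OF T(1)] by metis
  obtain p q where pq: "u = p @ q" "\<And>p' q'. u = p' @ q' \<Longrightarrow> height m p \<le> height m p'"
    "\<And>p' q'. p = p' @ q' \<Longrightarrow> q' \<noteq> [] \<Longrightarrow> height m p < height m p'"
    using exists_lowest_prefix by metis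
  have "height m u = int (Suc m) * int (n - 1) - int ((m + 1) * n)"
    unfolding height_count by (simp only: u T(2))
  then have hu: "height m u = - int m - 1" using n by (simp add: algebra_simps of_nat_diff)
  have "height m p < 0" using pq(2)[of u "[]"] hu by simp
  then have "p \<noteq> []" by auto
  then obtain p1 x where px: "p = p1 @ [x]" by (metis append_butlast_last_id)
  then have x: "\<not> x" using pq(3)[of p1 "[x]"] by (auto split: if_splits)
  have hpq: "height m p1 + height m q = - int m" using hu pq(1) px x by simp
  define z where "z = q @ p1"
  have "0 \<le> height m a" if "True # z = a @ b" for a b
  proof (cases a)
    case (Cons y c)
    then have c: "q @ p1 = c @ b" and y: "y" using that by (auto simp: z_def)
    have "- int m \<le> height m c"
    proof -
      consider e where "q = c @ e" | e where "c = q @ e" "p1 = e @ b"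
        using c by (auto simp: append_eq_append_conv2)
      then show ?thesis
      proof cases
        case 1
        then show ?thesis using pq(1) pq(2)[of "p @ c" e] hpq px x by simp
      next
        case 2
        then show ?thesis using pq(3)[of e "b @ [x]"] hpq px x by simp
      qed
    qed
    then show ?thesis using Cons y by simp
  qed simp
  then have "balanced m (True # z)" using hpq unfolding balanced_def by (auto simp: z_def)
  then have "True # z \<in> ballots m n" using u(1) pq(1) px by (simp add: ballots_def z_def)
  then obtain w where w: "w \<in> ballots m n" "(turn m ^^ length p1) w = True # z"
    using turn_pow_surj[OF m n] by metis
  have "rotate (length p1) u = False # z" using pq(1) px x by (simp add: rotate_append z_def)
  then have "residue m w (length p1) = T"
    using residue_spread[OF w(2)] w(1) \<open>True # z \<in> ballots m n\<close> spread_rotate[of 0 "length p1" u] u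
    by (simp add: ballots_def)
  then show ?thesis using w by blast
qed

section \<open>Both families as cyclic covers, and the number of fixed words\<close>

lemma card_start: "0 < m \<Longrightarrow> w \<in> ballots m n \<Longrightarrow> card (state m w j) = n"
  unfolding state_def using card_spread ballots_count ballots_turn by metis

text \<open>The multiplicity \<open>m * n + 1\<close> is \<open>N + 1 - n\<close>, the number of
  different states by \<open>card_states\<close>.\<close>

lemma state_cyclic_cover:
  assumes m: "0 < m" and n: "0 < n"
  shows "cyclic_cover (ballots m n) (turn m) ((m + 1) * n) n (m * n + 1) (state m)"
proof
  note jug = state_juggling[OF m _ n]
  show "finite (ballots m n)" by (rule finite_ballots)
  show "0 < (m + 1) * n" using n by simp
  show "turn m w \<in> ballots m n" if "w \<in> ballots m n" for w using ballots_turn[OF m that, of 1] by simp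
  show "(turn m ^^ ((m + 1) * n)) w = w" if "w \<in> ballots m n" for w using ballots_period[OF m that] by simp
  show "state m w j \<subseteq> {..<(m + 1) * n}" if "w \<in> ballots m n" for w j
    by (rule juggling.states[OF jug[OF that]])
  show "card (state m w j) = n" if "w \<in> ballots m n" for w j using card_start m that by simp
  show "shift ((m + 1) * n) M (state m ((turn m ^^ M) w) j) = state m w (j + M)" if "w \<in> ballots m n" for w M j
    using state_turn[OF m that] that by (simp add: ballots_def)
  show "\<exists>w\<in>ballots m n. \<exists>j. T = state m w j" if "T \<subseteq> {..<(m + 1) * n}" "card T = n" for T
    by (rule state_cover[OF m n that])
  show "w = w'" if "w \<in> ballots m n" "w' \<in> ballots m n" "state m w j = state m w' j'" for w w' j j'
    by (rule state_unique[OF m that])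
  show "card (state m w ` {..<(m + 1) * n}) = m * n + 1" if "w \<in> ballots m n" for w
    using juggling.card_states[OF jug[OF that]] card_start[OF m that] by simp
  show "state m w j' = state m w j"
    if "w \<in> ballots m n" "2 * M \<le> (m + 1) * n" "j \<le> j'" "j' < M" "state m w (j + M) = state m w j"
      "state m w (j' + M) = state m w j'" for w M j j'
    by (rule juggling.periodic_state_unique[OF jug[OF that(1)] that(2-)])
qed

text \<open>Here the multiplicity is \<open>n\<close>: by \<open>card_residues\<close> there is one
  residue for each mark of the initial state.\<close>

lemma residue_cyclic_cover:
  assumes m: "0 < m" and n: "0 < n"
  shows "cyclic_cover (ballots m n) (turn m) ((m + 1) * n) (n - 1) n (residue m)"
proof
  note jug = state_juggling[OF m _ n]
  have len: "length w = (m + 1) * n" if "w \<in> ballots m n" for w using that by (simp add: ballots_def)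
  have mem: "j mod ((m + 1) * n) \<in> state m w j" if w: "w \<in> ballots m n" for w j
  proof -
    have v: "(turn m ^^ j) w \<in> ballots m n" by (rule ballots_turn[OF m w])
    then obtain z where "(turn m ^^ j) w = True # z" using ballots_Cons n by metis
    then show ?thesis using spread_hd(1)[of j z] v unfolding state_def by (simp add: ballots_def)
  qed
  show "finite (ballots m n)" by (rule finite_ballots)
  show N: "0 < (m + 1) * n" using n by simp
  show "turn m w \<in> ballots m n" if "w \<in> ballots m n" for w using ballots_turn[OF m that, of 1] by simp
  show "(turn m ^^ ((m + 1) * n)) w = w" if "w \<in> ballots m n" for w using ballots_period[OF m that] by simp
  show "residue m w j \<subseteq> {..<(m + 1) * n}" if "w \<in> ballots m n" for w j
    using juggling.states[OF jug[OF that]] unfolding residue_def by blast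
  show "card (residue m w j) = n - 1" if "w \<in> ballots m n" for w j
    using card_start[OF m that] mem[OF that, of j] len[OF that] by (simp add: residue_def)
  show "shift ((m + 1) * n) M (residue m ((turn m ^^ M) w) j) = residue m w (j + M)" if w: "w \<in> ballots m n" for w M j
  proof -
    let ?w = "(turn m ^^ M) w"
    have w': "?w \<in> ballots m n" by (rule ballots_turn[OF m w])
    have "shift ((m + 1) * n) M (state m ?w j - {j mod ((m + 1) * n)})
        = shift ((m + 1) * n) M (state m ?w j) - shift ((m + 1) * n) M {j mod ((m + 1) * n)}"
      unfolding shift_def
      by (rule inj_on_image_set_diff[OF inj_on_shift]) (use juggling.states[OF jug[OF w']] N in auto)
    also have "shift ((m + 1) * n) M {j mod ((m + 1) * n)} = {(j + M) mod ((m + 1) * n)}"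
      by (simp only: shift_def image_insert image_empty mod_add_left_eq)
    finally show ?thesis
      using state_turn[OF m w, of M j] len[OF w] len[OF w'] by (simp only: residue_def)
  qed
  show "\<exists>w\<in>ballots m n. \<exists>j. T = residue m w j" if "T \<subseteq> {..<(m + 1) * n}" "card T = n - 1" for T
    by (rule residue_cover[OF m n that])
  show "w = w'" if "w \<in> ballots m n" "w' \<in> ballots m n" "residue m w j = residue m w' j'" for w w' j j'
    by (rule residue_unique[OF m n that])
  have res: "residue m w j = state m w j - {j}" if "w \<in> ballots m n" "j < (m + 1) * n" for w j
    using len[OF that(1)] that(2) by (simp add: residue_def)
  show "card (residue m w ` {..<(m + 1) * n}) = n" if w: "w \<in> ballots m n" for w
  proof -
    have "residue m w ` {..<(m + 1) * n} = (\<lambda>j. state m w j - {j}) ` {..<(m + 1) * n}"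
      by (rule image_cong) (use res[OF w] in auto)
    then show ?thesis using juggling.card_residues[OF jug[OF w]] card_start[OF m w] by simp
  qed
  show "residue m w j' = residue m w j"
    if w: "w \<in> ballots m n" and M: "2 * M \<le> (m + 1) * n" "j \<le> j'" "j' < M" and per: "residue m w (j + M) = residue m w j"
      "residue m w (j' + M) = residue m w j'" for w M j j'
  proof -
    have "j < (m + 1) * n" "j' < (m + 1) * n" "j + M < (m + 1) * n" "j' + M < (m + 1) * n" using M by auto
    then show ?thesis
      using juggling.periodic_residue_unique[OF jug[OF w] M] per by (simp only: res[OF w])
  qed
qed

text \<open>If \<open>e\<close> divides \<open>n\<close>, its primes do not divide
  \<open>m n + 1\<close> and the states count. Otherwise a prime of \<open>e\<close> not dividing
  \<open>n\<close> lets the residues count. If all primes of \<open>e\<close> divide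
  \<open>n\<close>, then \<open>e\<close> cannot divide \<open>n - 1\<close>, and the states give
  0.\<close>

lemma card_fixed_ballots:
  assumes m: "0 < m" and n: "0 < n" and N: "(m + 1) * n = e * M" and e: "1 < e"
  shows "card {w \<in> ballots m n. (turn m ^^ M) w = w} =
    (if e dvd n then M choose (n div e) else if e dvd n - 1 then M choose ((n - 1) div e) else 0)"
proof -
  have M: "0 < M" "M dvd (m + 1) * n" "(m + 1) * n div M = e" using N n e by (cases "M = 0"; simp)+
  note S = cyclic_cover.card_fixed[OF state_cyclic_cover[OF m n] M(2), unfolded M(3)]
  note R = cyclic_cover.card_fixed[OF residue_cyclic_cover[OF m n] M(2), unfolded M(3)]
  have e0: "0 < e" using e by simp
  note P = card_periodic_subsets[OF N e0 M(1)]
  obtain p0 where p0: "prime p0" "p0 dvd e" using e prime_factor_nat[of e] by auto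
  have coprime: "\<not> p dvd m * n + 1" if "prime p" "p dvd n" for p
    using that by (metis dvd_add_right_iff dvd_mult not_prime_unit)
  show ?thesis
  proof (cases "e dvd n")
    case True
    then have "p0 dvd n" using p0 by auto
    then show ?thesis using S[OF p0 coprime[OF p0(1)]] P True by simp
  next
    case False
    show ?thesis
    proof (cases "\<exists>p. prime p \<and> p dvd e \<and> \<not> p dvd n")
      case True
      then obtain p where "prime p" "p dvd e" "\<not> p dvd n" by blast
      then show ?thesis using R[of p] P False by simp
    next
      case all: False
      then have pn: "p0 dvd n" using p0 by blast
      have "\<not> e dvd n - 1"
      proof
        assume "e dvd n - 1"
        then have "p0 dvd n - 1" using p0 by auto
        then have "p0 dvd n - (n - 1)" using pn by (rule dvd_diff_nat[rotated])
        then show False using p0 n by (simp add: not_prime_unit)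
      qed
      then show ?thesis using S[OF p0 coprime[OF p0(1) pn]] P False by simp
    qed
  qed
qed

lemma card_ballots:
  assumes "0 < m" "0 < n"
  shows "card (ballots m n) * (m * n + 1) = (m + 1) * n choose n"
  by (rule cyclic_cover.card_mult[OF state_cyclic_cover[OF assms]])

section \<open>The \<open>q\<close>-Fuss-Catalan polynomial at roots of unity\<close>

text \<open>Gaussian binomials by the q-Pascal rule. Being free of division, they can be evaluated
  at roots of unity, where q-factorials may vanish.\<close>

fun gauss_poly :: "nat \<Rightarrow> nat \<Rightarrow> complex poly" where
  "gauss_poly n 0 = 1"
| "gauss_poly 0 (Suc r) = 0"
| "gauss_poly (Suc n) (Suc r) = gauss_poly n r + monom 1 (Suc r) * gauss_poly n (Suc r)"

lemma q_int_simps [simp]: "q_int 0 = 0" "q_int (Suc 0) = 1"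
  by (simp_all add: q_int_def)

lemma q_int_add: "q_int (a + b) = q_int a + monom 1 a * q_int b"
  by (induction b) (simp_all add: q_int_def algebra_simps mult_monom)

lemma q_int_mult: "q_int (m * n) = q_int n * (\<Sum>i<m. monom 1 (n * i))"
proof (induction m)
  case (Suc m)
  have "q_int (Suc m * n) = q_int (m * n) + monom 1 (m * n) * q_int n"
    using q_int_add[of "m * n" n] by (simp add: add.commute)
  then show ?case using Suc by (simp add: algebra_simps)
qed simp

lemma q_fact_simps [simp]: "q_fact 0 = 1" "q_fact (Suc k) = q_int (Suc k) * q_fact k"
  by (simp_all add: q_fact_def)

lemma poly_q_int_1: "poly (q_int k) 1 = of_nat k"
  by (simp add: q_int_def poly_sum poly_monom)

lemma q_int_neq_0: "0 < k \<Longrightarrow> q_int k \<noteq> 0"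
  using poly_q_int_1[of k] by (metis of_nat_eq_0_iff poly_0 less_irrefl)

lemma q_fact_neq_0: "q_fact k \<noteq> 0"
  by (induction k) (simp_all add: q_int_neq_0)

lemma gauss_poly_eq_0: "n < r \<Longrightarrow> gauss_poly n r = 0"
  by (induction n r rule: gauss_poly.induct) simp_all

lemma gauss_poly_self: "gauss_poly n n = 1"
  by (induction n) (simp_all add: gauss_poly_eq_0)

text \<open>The q-Pascal rule matches \<open>[r + s] = [r] + q^r [s]\<close>, which splits the top
  factor of the q-factorial.\<close>

lemma gauss_poly_fact: "gauss_poly (r + s) r * (q_fact r * q_fact s) = q_fact (r + s)"
proof (induction "r + s" arbitrary: r s rule: less_induct)
  case less
  show ?case
  proof (cases r)
    case (Suc r')
    show ?thesis
    proof (cases s)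
      case s: (Suc s')
      have 1: "gauss_poly (r' + s) r' * (q_fact r' * q_fact s) = q_fact (r' + s)"
        using less[of r' s] Suc by simp
      have 2: "gauss_poly (r + s') r * (q_fact r * q_fact s') = q_fact (r + s')"
        using less[of r s'] s by simp
      have "gauss_poly (r + s) r = gauss_poly (r' + s) r' + monom 1 r * gauss_poly (r + s') r"
        using Suc s by simp
      then have "gauss_poly (r + s) r * (q_fact r * q_fact s)
          = gauss_poly (r' + s) r' * (q_fact r' * q_fact s) * q_int r
            + monom 1 r * (gauss_poly (r + s') r * (q_fact r * q_fact s')) * q_int s"
        using Suc s by (simp add: algebra_simps)
      also have "\<dots> = q_fact (r' + s) * (q_int r + monom 1 r * q_int s)"
        unfolding 1 2 using Suc s by (simp add: algebra_simps)
      also have "\<dots> = q_fact (r + s)" unfolding q_int_add[symmetric] using Suc by (simp add: mult.commute)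
      finally show ?thesis .
    qed (simp add: gauss_poly_self)
  qed simp
qed

text \<open>With \<open>H = [m n] / [n]\<close>, the Bezout identity
  \<open>[m n + 1] - q H [n] = 1\<close> shows that the quotient is a polynomial and yields the
  first formula, in which nothing is divided.\<close>

lemma fuss_catalan_gauss:
  assumes "0 < n"
  shows "q_fuss_catalan m n =
      gauss_poly ((m + 1) * n) n - monom 1 1 * (\<Sum>i<m. monom 1 (n * i)) * gauss_poly ((m + 1) * n) (n - 1)"
    and "q_fuss_catalan m n * q_int (m * n + 1) = gauss_poly ((m + 1) * n) n"
    and "q_fuss_catalan m n * q_int n = gauss_poly ((m + 1) * n) (n - 1)"
proof -
  define N where "N = (m + 1) * n"
  define H where "H = (\<Sum>i<m. monom (1 :: complex) (n * i))"
  define C where "C = gauss_poly N n - monom 1 1 * H * gauss_poly N (n - 1)"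
  have nn: "q_fact n = q_int n * q_fact (n - 1)" using assms by (cases n) simp_all
  have G1: "gauss_poly N n * (q_fact n * q_fact (m * n)) = q_fact N"
    using gauss_poly_fact[of n "m * n"] by (simp add: N_def add.commute)
  have "n - 1 + (m * n + 1) = N" using assms by (simp add: N_def)
  then have G2: "gauss_poly N (n - 1) * (q_fact (n - 1) * q_fact (m * n + 1)) = q_fact N"
    using gauss_poly_fact[of "n - 1" "m * n + 1"] by simp
  have "(gauss_poly N (n - 1) * q_int (m * n + 1)) * (q_fact (n - 1) * q_fact (m * n))
      = (gauss_poly N n * q_int n) * (q_fact (n - 1) * q_fact (m * n))"
    using G1 G2 nn by (simp add: mult_ac)
  then have rel: "gauss_poly N (n - 1) * q_int (m * n + 1) = gauss_poly N n * q_int n"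
    using q_fact_neq_0 by (simp only: mult_right_cancel mult_eq_0_iff simp_thms not_False_eq_True)
  have qint: "q_int (m * n + 1) = 1 + monom 1 1 * (q_int n * H)"
    using q_int_add[of 1 "m * n"] by (simp add: q_int_mult H_def)
  have "C * q_int (m * n + 1) = gauss_poly N n * q_int (m * n + 1) - monom 1 1 * H * (gauss_poly N (n - 1) * q_int (m * n + 1))"
    by (simp add: C_def algebra_simps)
  also have "\<dots> = gauss_poly N n * q_int (m * n + 1) - monom 1 1 * H * (gauss_poly N n * q_int n)"
    by (simp only: rel)
  also have "\<dots> = gauss_poly N n" unfolding qint by (simp add: algebra_simps)
  finally have C1: "C * q_int (m * n + 1) = gauss_poly N n" .
  have ne: "q_int (m * n + 1) \<noteq> 0" by (rule q_int_neq_0) simp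
  have "(C * q_int n) * q_int (m * n + 1) = gauss_poly N (n - 1) * q_int (m * n + 1)"
    unfolding rel C1[symmetric] by (simp add: mult_ac)
  then have C2: "C * q_int n = gauss_poly N (n - 1)"
    by (simp only: mult_right_cancel[OF ne])
  have "q_fact (N + 1) = q_int (N + 1) * C * (q_fact n * q_fact (m * n + 1))"
    unfolding Suc_eq_plus1[symmetric] q_fact_simps(2)[of N] G1[symmetric] C1[symmetric]
    by (simp add: mult_ac)
  moreover have "N + 1 - n = m * n + 1" by (simp add: N_def)
  ultimately have "q_binomial (N + 1) n = q_int (N + 1) * C"
    unfolding q_binomial_def using q_fact_neq_0
    by (simp only: nonzero_mult_div_cancel_right mult_eq_0_iff simp_thms not_False_eq_True)
  then have "q_fuss_catalan m n = C"
    unfolding q_fuss_catalan_def N_def[symmetric]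
    using q_int_neq_0[of "N + 1"] by (simp add: nonzero_mult_div_cancel_left)
  then show "q_fuss_catalan m n = gauss_poly ((m + 1) * n) n - monom 1 1 * (\<Sum>i<m. monom 1 (n * i)) * gauss_poly ((m + 1) * n) (n - 1)"
    "q_fuss_catalan m n * q_int (m * n + 1) = gauss_poly ((m + 1) * n) n"
    "q_fuss_catalan m n * q_int n = gauss_poly ((m + 1) * n) (n - 1)"
    using C1 C2 unfolding C_def H_def N_def by simp_all
qed

lemma poly_gauss_1: "poly (gauss_poly n r) 1 = of_nat (n choose r)"
  by (induction n r rule: gauss_poly.induct) (simp_all add: poly_monom)

lemma poly_fuss_catalan_1:
  assumes "0 < n"
  shows "poly (q_fuss_catalan m n) 1 * of_nat (m * n + 1) = of_nat ((m + 1) * n choose n)"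
  using arg_cong[OF fuss_catalan_gauss(2)[OF assms, of m], of "\<lambda>p. poly p 1"]
  by (simp only: poly_mult poly_q_int_1 poly_gauss_1)

locale primitive_root =
  fixes \<omega> :: complex and e :: nat
  assumes e: "1 < e" and power_eq_1_iff: "\<omega> ^ j = 1 \<longleftrightarrow> e dvd j"
begin

lemma poly_q_int_eq_0_iff: "poly (q_int k) \<omega> = 0 \<longleftrightarrow> e dvd k"
proof -
  have "\<omega> \<noteq> 1" using power_eq_1_iff[of 1] e by auto
  then have "poly (q_int k) \<omega> = (\<omega> ^ k - 1) / (\<omega> - 1)"
    by (simp add: q_int_def poly_sum poly_monom geometric_sum)
  then show ?thesis using power_eq_1_iff[of k] \<open>\<omega> \<noteq> 1\<close> by simp
qed

lemma poly_q_int_Suc: "e dvd k \<Longrightarrow> poly (q_int (k + 1)) \<omega> = 1"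
  using q_int_add[of k 1] poly_q_int_eq_0_iff[of k] power_eq_1_iff[of k] by (simp add: poly_monom)

lemma poly_q_fact_neq_0: "k < e \<Longrightarrow> poly (q_fact k) \<omega> \<noteq> 0"
proof (induction k)
  case (Suc k)
  then have "\<not> e dvd Suc k" by (auto dest: dvd_imp_le)
  then show ?case using Suc poly_q_int_eq_0_iff[of "Suc k"] by simp
qed simp

text \<open>An \<open>e\<close>-fold Pascal rule. For \<open>0 < r < e\<close> the value of
  \<open>gauss_poly e r\<close> at \<open>\<omega>\<close> is 0, since \<open>[e]\<close> vanishes
  there while the q-factorials of \<open>r\<close> and \<open>e - r\<close> do not; the induction
  keeps the rule because \<open>\<omega> ^ e = 1\<close>.\<close>

lemma poly_gauss_period:
  "poly (gauss_poly (n + e) r) \<omega> = poly (gauss_poly n r) \<omega> + (if e \<le> r then poly (gauss_poly n (r - e)) \<omega> else 0)"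
proof (induction n arbitrary: r)
  case 0
  consider "r = 0" | "0 < r" "r < e" | "r = e" | "e < r" by linarith
  then show ?case
  proof cases
    case 2
    have "poly (gauss_poly e r) \<omega> * (poly (q_fact r) \<omega> * poly (q_fact (e - r)) \<omega>) = poly (q_fact e) \<omega>"
      using gauss_poly_fact[of r "e - r"] 2 by (metis le_add_diff_inverse less_imp_le_nat poly_mult)
    moreover have "poly (q_fact e) \<omega> = 0"
      using poly_q_int_eq_0_iff[of e] e by (cases e) simp_all
    ultimately have "poly (gauss_poly e r) \<omega> = 0" using poly_q_fact_neq_0 2 by simp
    then show ?thesis using 2 by (cases r) simp_all
  qed (use e in \<open>auto simp: gauss_poly_self gauss_poly_eq_0\<close>)
next
  case (Suc n)
  show ?case
  proof (cases r)
    case r: (Suc r')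
    have pascal: "poly (gauss_poly (Suc k) r) \<omega> = poly (gauss_poly k r') \<omega> + \<omega> ^ r * poly (gauss_poly k r) \<omega>" for k
      by (simp add: r poly_monom)
    have L: "poly (gauss_poly (Suc n + e) r) \<omega> =
        poly (gauss_poly (n + e) r') \<omega> + \<omega> ^ r * poly (gauss_poly (n + e) r) \<omega>"
      using pascal[of "n + e"] by simp
    consider "e \<le> r'" | "r = e" | "r < e" using r by linarith
    then show ?thesis
    proof cases
      case 1
      have "\<omega> ^ r = \<omega> ^ (r - e) * \<omega> ^ e" using 1 r by (simp flip: power_add)
      then have pw: "\<omega> ^ (r - e) = \<omega> ^ r" using power_eq_1_iff[of e] by simp
      have "r - e = Suc (r' - e)" using 1 r by simp
      then have "poly (gauss_poly (Suc n) (r - e)) \<omega>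
          = poly (gauss_poly n (r' - e)) \<omega> + \<omega> ^ (r - e) * poly (gauss_poly n (r - e)) \<omega>"
        by (simp add: poly_monom)
      moreover have "e \<le> r" using 1 r by simp
      ultimately show ?thesis unfolding L pascal Suc.IH using 1 pw by (simp add: algebra_simps)
    next
      case 2
      then have "\<omega> ^ r = 1" "\<not> e \<le> r'" using power_eq_1_iff[of e] r by auto
      then show ?thesis unfolding L pascal Suc.IH using 2 by simp
    next
      case 3
      then have "\<not> e \<le> r'" using r by simp
      then show ?thesis unfolding L pascal Suc.IH using 3 by simp
    qed
  qed (use e in simp)
qed

text \<open>A case of the q-Lucas theorem: iterating the \<open>e\<close>-fold rule is the ordinary
  Pascal rule for \<open>M\<close>.\<close>

lemma poly_gauss_multiple:
  "poly (gauss_poly (e * M) r) \<omega> = (if e dvd r then of_nat (M choose (r div e)) else 0)"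
proof (induction M arbitrary: r)
  case 0
  have "0 < r div e" if "e dvd r" "r \<noteq> 0"
    using that e dvd_imp_le[of e r] by (simp add: div_greater_zero_iff)
  then show ?case by (cases r) simp_all
next
  case (Suc M)
  have *: "poly (gauss_poly (e * Suc M) r) \<omega>
      = poly (gauss_poly (e * M) r) \<omega> + (if e \<le> r then poly (gauss_poly (e * M) (r - e)) \<omega> else 0)"
    using poly_gauss_period[of "e * M" r] by (simp add: add.commute)
  show ?case
  proof (cases "e \<le> r")
    case True
    then have "e dvd r - e \<longleftrightarrow> e dvd r" by (metis dvd_add_triv_right_iff le_add_diff_inverse2)
    moreover have "r div e = Suc ((r - e) div e)" using True e by (simp add: le_div_geq)
    ultimately show ?thesis using * Suc[of r] Suc[of "r - e"] True by simp
  next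
    case False
    then have "e dvd r \<longleftrightarrow> r = 0" by (auto dest: dvd_imp_le)
    then show ?thesis using * Suc[of r] False by auto
  qed
qed

text \<open>At \<open>\<omega>\<close> the factor \<open>[m n + 1]\<close> is 1 if \<open>e\<close>
  divides \<open>n\<close>, and \<open>[n]\<close> is 1 if \<open>e\<close> divides
  \<open>n - 1\<close>. If \<open>e\<close> divides neither, both Gaussian binomials in the
  division-free formula vanish.\<close>

lemma poly_fuss_catalan:
  assumes n: "0 < n" and N: "(m + 1) * n = e * M"
  shows "poly (q_fuss_catalan m n) \<omega> =
    of_nat (if e dvd n then M choose (n div e) else if e dvd n - 1 then M choose ((n - 1) div e) else 0)"
proof -
  note C = fuss_catalan_gauss[OF n, of m, unfolded N]
  show ?thesis
  proof (cases "e dvd n")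
    case True
    then have "poly (q_int (m * n + 1)) \<omega> = 1" by (intro poly_q_int_Suc) simp
    then have "poly (q_fuss_catalan m n) \<omega> = poly (gauss_poly (e * M) n) \<omega>"
      using arg_cong[OF C(2), of "\<lambda>p. poly p \<omega>"] by simp
    then show ?thesis using True by (simp add: poly_gauss_multiple)
  next
    case ndvd: False
    show ?thesis
    proof (cases "e dvd n - 1")
      case True
      then have "poly (q_int n) \<omega> = 1" using poly_q_int_Suc[of "n - 1"] n by simp
      then have "poly (q_fuss_catalan m n) \<omega> = poly (gauss_poly (e * M) (n - 1)) \<omega>"
        using arg_cong[OF C(3), of "\<lambda>p. poly p \<omega>"] by simp
      then show ?thesis using True ndvd by (simp add: poly_gauss_multiple)
    next
      case False
      then show ?thesis unfolding C(1) using ndvd by (simp add: poly_gauss_multiple)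
    qed
  qed
qed

end

lemma primitive_root_exp:
  fixes d :: int
  assumes N: "0 < N" "N = e * gcd (nat \<bar>d\<bar>) N" and e: "1 < e"
  shows "primitive_root (exp (2 * of_real pi * \<i> * of_int d / of_nat N)) e"
proof
  fix j
  define M where "M = gcd (nat \<bar>d\<bar>) N"
  have M: "0 < M" "N = e * M" using N by (simp_all add: M_def)
  have "exp (2 * of_real pi * \<i> * of_int d / of_nat N) ^ j = exp (of_nat j * (2 * of_real pi * \<i> * of_int d / of_nat N))"
    by (rule exp_of_nat_mult[symmetric])
  also have "of_nat j * (2 * of_real pi * \<i> * of_int d / of_nat N) = \<i> * of_real (2 * pi * (of_int (d * int j) / of_nat N))"
    by (simp add: field_simps)
  finally have eq: "exp (2 * of_real pi * \<i> * of_int d / of_nat N) ^ j = cis (2 * pi * (of_int (d * int j) / of_nat N))"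
    by (simp add: cis_conv_exp)
  have "cis (2 * pi * (of_int (d * int j) / of_nat N)) = 1 \<longleftrightarrow> int N dvd d * int j"
  proof
    assume "cis (2 * pi * (of_int (d * int j) / of_nat N)) = 1"
    then have "cos (2 * pi * (of_int (d * int j) / of_nat N)) = 1" by (metis cis.sel(1) one_complex.sel(1))
    then obtain i :: int where "2 * pi * (of_int (d * int j) / of_nat N) = of_int i * 2 * pi"
      using cos_one_2pi_int by blast
    then have "(of_int (d * int j) :: real) = of_int (i * int N)" using N by (simp add: field_simps)
    then have "d * int j = i * int N" by (simp only: of_int_eq_iff)
    then show "int N dvd d * int j" by simp
  next
    assume "int N dvd d * int j"
    then obtain i where "d * int j = int N * i" by blast
    then have "of_int (d * int j) / of_nat N = (of_int i :: real)" using N by simp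
    then show "cis (2 * pi * (of_int (d * int j) / of_nat N)) = 1" by (simp only: cis_multiple_2pi Ints_of_int)
  qed
  also have "\<dots> \<longleftrightarrow> N dvd nat \<bar>d\<bar> * j"
    using dvd_nat_abs_iff[of N "d * int j"] by (simp only: nat_abs_mult_distrib nat_abs_int_diff abs_of_nat nat_int simp_thms)
  also have "\<dots> \<longleftrightarrow> e dvd j"
  proof -
    obtain a where a: "nat \<bar>d\<bar> = a * M" by (metis M_def dvd_def gcd_dvd1 mult.commute)
    have "coprime e a"
    proof -
      have "gcd (a * M) (e * M) = M" unfolding a[symmetric] M(2)[symmetric] by (rule M_def[symmetric])
      then have "gcd a e * M = M" by (metis gcd_mult_distrib_nat mult.commute)
      then have "gcd a e = 1" using M(1) by simp
      then show ?thesis by (metis coprime_iff_gcd_eq_1 gcd.commute)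
    qed
    then have 1: "e dvd a * j \<longleftrightarrow> e dvd j" by (rule coprime_dvd_mult_right_iff)
    have 2: "nat \<bar>d\<bar> * j = a * j * M" by (simp only: a mult_ac)
    show ?thesis unfolding 2 M(2) using 1 M(1) by simp
  qed
  finally show "exp (2 * of_real pi * \<i> * of_int d / of_nat N) ^ j = 1 \<longleftrightarrow> e dvd j" using eq by simp
qed (rule e)

section \<open>Edge labels of the \<open>m\<close>-Tamari lattice\<close>

locale m_tamari =
  fixes m n :: nat
  assumes m_pos: "0 < m" and n_pos: "0 < n"
begin

definition N :: nat where "N = (m + 1) * n"

text \<open>\<open>cl l\<close> is the ceiling of \<open>l / (m + 1)\<close>; its Galois property removes all nonlinear arithmetic.\<close>

definition cl :: "nat \<Rightarrow> int" where "cl l = (int l + int m) div (int m + 1)"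

abbreviation T :: "int list set" where "T \<equiv> tamari_vectors m n"
abbreviation L :: "int list gorder" where "L \<equiv> tamari_lattice m n"

lemma cl_le_iff: "cl l \<le> v \<longleftrightarrow> int l \<le> (int m + 1) * v"
proof -
  have eq: "(int m + 1) * cl l + (int l + int m) mod (int m + 1) = int l + int m"
    unfolding cl_def by (rule mult_div_mod_eq)
  have mod: "0 \<le> (int l + int m) mod (int m + 1)" "(int l + int m) mod (int m + 1) < int m + 1"
    by (rule pos_mod_sign pos_mod_bound; simp)+
  show ?thesis
  proof
    assume "cl l \<le> v"
    then have "(int m + 1) * cl l \<le> (int m + 1) * v" by (intro mult_left_mono) simp_all
    then show "int l \<le> (int m + 1) * v" using eq mod by linarith
  next
    assume "int l \<le> (int m + 1) * v"
    then have "(int m + 1) * cl l < (int m + 1) * v + (int m + 1)" using eq mod by linarith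
    then have "(int m + 1) * cl l < (int m + 1) * (v + 1)" by (simp only: distrib_left mult_1_right)
    then have "cl l < v + 1" by (simp only: mult_less_cancel_left_pos)
    then show "cl l \<le> v" by simp
  qed
qed

lemma cl_mono: "l \<le> l' \<Longrightarrow> cl l \<le> cl l'"
  unfolding cl_def by (simp add: zdiv_mono1)

lemma cl_mult: "cl ((m + 1) * a) = int a"
proof (rule antisym)
  show "cl ((m + 1) * a) \<le> int a" by (simp add: cl_le_iff algebra_simps)
  have "int ((m + 1) * a) \<le> (int m + 1) * cl ((m + 1) * a)" using cl_le_iff by blast
  then have "(int m + 1) * int a \<le> (int m + 1) * cl ((m + 1) * a)" by (simp add: algebra_simps)
  then show "int a \<le> cl ((m + 1) * a)" by (simp only: mult_le_cancel_left_pos)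
qed

lemma cl_le_mult_iff: "cl l \<le> int a \<longleftrightarrow> l \<le> (m + 1) * a"
proof -
  have "int l \<le> (int m + 1) * int a \<longleftrightarrow> int l \<le> int ((m + 1) * a)" by (simp add: algebra_simps)
  then show ?thesis unfolding cl_le_iff by (simp only: of_nat_le_iff)
qed

lemma cl_nonneg: "0 \<le> cl l"
  unfolding cl_def by (simp add: pos_imp_zdiv_nonneg_iff)

lemma cl_pos: "0 < l \<Longrightarrow> 0 < cl l"
  using cl_le_mult_iff[of l 0] by simp

lemma cl_0 [simp]: "cl 0 = 0"
  using cl_mult[of 0] by simp

lemma cl_le_n_iff: "cl l \<le> int n \<longleftrightarrow> l \<le> N"
  unfolding N_def by (rule cl_le_mult_iff)

lemma cl_Suc_mult: "cl (Suc ((m + 1) * a)) = int a + 1"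
proof -
  have "\<not> cl (Suc ((m + 1) * a)) \<le> int a" unfolding cl_le_mult_iff by simp
  moreover have "cl (Suc ((m + 1) * a)) \<le> int (a + 1)" unfolding cl_le_mult_iff using m_pos by simp
  ultimately show ?thesis by simp
qed

lemma cl_Suc_le:
  assumes "\<not> (m + 1) dvd l" "cl l \<le> v"
  shows "cl (Suc l) \<le> v"
proof -
  obtain a where a: "v = int a" using assms(2) cl_nonneg[of l] nonneg_int_cases by (metis order_trans)
  have "l \<le> (m + 1) * a" using assms(2) a cl_le_mult_iff by simp
  moreover have "l \<noteq> (m + 1) * a" using assms(1) dvd_triv_left by metis
  ultimately show ?thesis using a cl_le_mult_iff[of "Suc l" a] by simp
qed

lemma cl_dvd_le:
  assumes "(m + 1) dvd l" "cl j \<le> cl l"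
  shows "j \<le> l"
proof -
  obtain a where a: "l = (m + 1) * a" using assms(1) by blast
  then show ?thesis using assms(2) unfolding a cl_mult cl_le_mult_iff by simp
qed

lemma T_iff:
  "b \<in> T \<longleftrightarrow> length b = N + 1 \<and> (\<forall>l\<le>N. (m + 1) dvd l \<longrightarrow> b ! l = cl l) \<and>
     (\<forall>l\<le>N. cl l \<le> b ! l \<and> b ! l \<le> int n) \<and>
     (\<forall>i\<le>N. \<forall>j>i. cl j \<le> b ! i \<longrightarrow> b ! j \<le> b ! i)" (is "_ \<longleftrightarrow> ?R")
proof -
  have A: "(\<forall>k\<in>{0..n}. b ! ((m + 1) * k) = int k) \<longleftrightarrow> (\<forall>l\<le>N. (m + 1) dvd l \<longrightarrow> b ! l = cl l)"
  proof
    assume *: "\<forall>k\<in>{0..n}. b ! ((m + 1) * k) = int k"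
    show "\<forall>l\<le>N. (m + 1) dvd l \<longrightarrow> b ! l = cl l"
    proof (intro allI impI)
      fix l assume l: "l \<le> N" "(m + 1) dvd l"
      then obtain k where k: "l = (m + 1) * k" by blast
      then have "k \<le> n" using l(1) unfolding N_def k by (simp only: mult_le_cancel1)
      then show "b ! l = cl l" using * k cl_mult by auto
    qed
  next
    assume *: "\<forall>l\<le>N. (m + 1) dvd l \<longrightarrow> b ! l = cl l"
    show "\<forall>k\<in>{0..n}. b ! ((m + 1) * k) = int k"
    proof
      fix k assume "k \<in> {0..n}"
      then have "(m + 1) * k \<le> N" unfolding N_def by (intro mult_le_mono2) simp
      then show "b ! ((m + 1) * k) = int k" using * cl_mult[of k] dvd_triv_left by metis
    qed
  qed
  \<comment> \<open>Condition (II) says nothing at index 0; there the bounds come from the entry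
    being 0.\<close>
  have B: "(\<forall>s\<in>{0..<n}. \<forall>t\<in>{1..m + 1}. int s + 1 \<le> b ! ((m + 1) * s + t) \<and> b ! ((m + 1) * s + t) \<le> int n)
      \<longleftrightarrow> (\<forall>l\<le>N. cl l \<le> b ! l \<and> b ! l \<le> int n)" if b0: "b ! 0 = 0"
  proof
    assume *: "\<forall>s\<in>{0..<n}. \<forall>t\<in>{1..m + 1}. int s + 1 \<le> b ! ((m + 1) * s + t) \<and> b ! ((m + 1) * s + t) \<le> int n"
    show "\<forall>l\<le>N. cl l \<le> b ! l \<and> b ! l \<le> int n"
    proof (intro allI impI)
      fix l assume l: "l \<le> N"
      show "cl l \<le> b ! l \<and> b ! l \<le> int n"
      proof (cases "l = 0")
        case False
        \<comment> \<open>Shifted by one so that \<open>t\<close> runs through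
          \<open>1..m + 1\<close>: a multiple of \<open>m + 1\<close> belongs to the stretch that it
          ends.\<close>
        define s t where "s = (l - 1) div (m + 1)" and "t = (l - 1) mod (m + 1) + 1"
        have lst: "l = (m + 1) * s + t" using False unfolding s_def t_def
          using mult_div_mod_eq[of "m + 1" "l - 1"] by linarith
        have t: "t \<in> {1..m + 1}" using mod_less_divisor[of "m + 1" "l - 1"] unfolding t_def by auto
        have "(m + 1) * s < (m + 1) * n" using l lst t unfolding N_def by auto
        then have s: "s < n" by (simp only: mult_less_cancel1)
        have "cl l \<le> int (s + 1)" unfolding cl_le_mult_iff using lst t by simp
        then show ?thesis using * s t lst by (metis atLeastLessThan_iff le0 of_nat_1 of_nat_add order_trans)
      qed (use b0 in simp)
    qed
  next
    assume *: "\<forall>l\<le>N. cl l \<le> b ! l \<and> b ! l \<le> int n"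
    show "\<forall>s\<in>{0..<n}. \<forall>t\<in>{1..m + 1}. int s + 1 \<le> b ! ((m + 1) * s + t) \<and> b ! ((m + 1) * s + t) \<le> int n"
    proof (intro ballI)
      fix s t assume st: "s \<in> {0..<n}" "t \<in> {1..m + 1}"
      have "(m + 1) * s + t \<le> (m + 1) * (s + 1)" using st by simp
      also have "\<dots> \<le> N" unfolding N_def using st by (intro mult_le_mono2) simp
      finally have l: "(m + 1) * s + t \<le> N" .
      have "\<not> cl ((m + 1) * s + t) \<le> int s" unfolding cl_le_mult_iff using st by simp
      then show "int s + 1 \<le> b ! ((m + 1) * s + t) \<and> b ! ((m + 1) * s + t) \<le> int n" using * l by force
    qed
  qed
  have C: "(\<forall>i\<in>{0..N}. \<forall>j. i + 1 \<le> j \<and> int j \<le> (int m + 1) * b ! i \<longrightarrow> b ! j \<le> b ! i)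
      \<longleftrightarrow> (\<forall>i\<le>N. \<forall>j>i. cl j \<le> b ! i \<longrightarrow> b ! j \<le> b ! i)"
    by (auto simp: cl_le_iff N_def Suc_le_eq)
  show ?thesis
  proof (cases "b ! 0 = 0")
    case True
    show ?thesis
      unfolding tamari_vectors_def mem_Collect_eq N_def[symmetric] A B[OF True] C ..
  next
    case False
    have "\<not> (\<forall>l\<le>N. (m + 1) dvd l \<longrightarrow> b ! l = cl l)" using False by auto
    then show ?thesis unfolding tamari_vectors_def mem_Collect_eq A by blast
  qed
qed

lemma T_length: "b \<in> T \<Longrightarrow> length b = N + 1"
  and T_mult: "b \<in> T \<Longrightarrow> l \<le> N \<Longrightarrow> (m + 1) dvd l \<Longrightarrow> b ! l = cl l"
  and T_lower: "b \<in> T \<Longrightarrow> l \<le> N \<Longrightarrow> cl l \<le> b ! l"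
  and T_upper: "b \<in> T \<Longrightarrow> l \<le> N \<Longrightarrow> b ! l \<le> int n"
  and T_closed: "b \<in> T \<Longrightarrow> i < j \<Longrightarrow> i \<le> N \<Longrightarrow> cl j \<le> b ! i \<Longrightarrow> b ! j \<le> b ! i"
  by (auto simp: T_iff)

text \<open>Condition (III) need only be checked inside the vector, since
  \<open>cl j \<le> b ! i \<le> n\<close> forces \<open>j \<le> N\<close>.\<close>

lemma T_I:
  assumes "length b = N + 1" "\<And>l. l \<le> N \<Longrightarrow> (m + 1) dvd l \<Longrightarrow> b ! l = cl l"
    "\<And>l. l \<le> N \<Longrightarrow> cl l \<le> b ! l" "\<And>l. l \<le> N \<Longrightarrow> b ! l \<le> int n"
    "\<And>i j. i < j \<Longrightarrow> j \<le> N \<Longrightarrow> cl j \<le> b ! i \<Longrightarrow> b ! j \<le> b ! i"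
  shows "b \<in> T"
proof -
  have "b ! j \<le> b ! i" if "i \<le> N" "i < j" "cl j \<le> b ! i" for i j
  proof -
    have "cl j \<le> int n" using that assms(4)[of i] by simp
    then show ?thesis using assms(5) that cl_le_n_iff by simp
  qed
  then show ?thesis unfolding T_iff using assms(1-4) by blast
qed

lemma T_eqI: "x \<in> T \<Longrightarrow> y \<in> T \<Longrightarrow> (\<And>l. l \<le> N \<Longrightarrow> x ! l = y ! l) \<Longrightarrow> x = y"
  by (rule nth_equalityI) (auto simp: T_length)

section \<open>The componentwise order and its cover relations\<close>

definition below :: "int list \<Rightarrow> int list \<Rightarrow> bool" where
  "below x y \<longleftrightarrow> (\<forall>l\<le>N. x ! l \<le> y ! l)"

lemma below_antisym: "x \<in> T \<Longrightarrow> y \<in> T \<Longrightarrow> below x y \<Longrightarrow> below y x \<Longrightarrow> x = y"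
  unfolding below_def by (intro T_eqI) (auto intro: antisym)

lemma L_le: "x \<in> T \<Longrightarrow> y \<in> T \<Longrightarrow> x \<sqsubseteq>\<^bsub>L\<^esub> y \<longleftrightarrow> below x y"
  by (auto simp: tamari_lattice_def below_def list_all2_conv_all_nth T_length)

lemma L_less: "x \<in> T \<Longrightarrow> y \<in> T \<Longrightarrow> x \<sqsubset>\<^bsub>L\<^esub> y \<longleftrightarrow> below x y \<and> x \<noteq> y"
  using L_le by (auto simp: lless_def tamari_lattice_def)

lemma L_carrier [simp]: "carrier L = T"
  by (simp add: tamari_lattice_def)

text \<open>Entry \<open>i\<close> alone can be lowered to \<open>c\<close>.\<close>

definition lowers :: "int list \<Rightarrow> nat \<Rightarrow> int \<Rightarrow> bool" where
  "lowers y i c \<longleftrightarrow> i \<le> N \<and> \<not> (m + 1) dvd i \<and> cl i \<le> c \<and> c < y ! i \<and>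
     (\<forall>l>i. cl l \<le> c \<longrightarrow> y ! l \<le> c)"

definition max_lowers :: "int list \<Rightarrow> nat \<Rightarrow> int \<Rightarrow> bool" where
  "max_lowers y i c \<longleftrightarrow> lowers y i c \<and> (\<forall>c'>c. \<not> lowers y i c')"

lemma lowers_update:
  assumes y: "y \<in> T" and "lowers y i c"
  shows "y[i := c] \<in> T"
proof (rule T_I)
  have i: "i \<le> N" "\<not> (m + 1) dvd i" "cl i \<le> c" "c < y ! i" "\<And>l. i < l \<Longrightarrow> cl l \<le> c \<Longrightarrow> y ! l \<le> c"
    using assms(2) by (auto simp: lowers_def)
  have len: "length y = N + 1" by (rule T_length[OF y])
  show "length (y[i := c]) = N + 1" using len by simp
  show "y[i := c] ! l = cl l" if "l \<le> N" "(m + 1) dvd l" for l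
    using that i T_mult[OF y that] by (cases "l = i") auto
  show "cl l \<le> y[i := c] ! l" "y[i := c] ! l \<le> int n" if "l \<le> N" for l
    using that i len T_lower[OF y that] T_upper[OF y that] by (cases "l = i"; simp)+
  show "y[i := c] ! b \<le> y[i := c] ! a" if "a < b" "b \<le> N" "cl b \<le> y[i := c] ! a" for a b
    using that i len T_closed[OF y, of a b] by (cases "a = i"; cases "b = i") auto
qed

lemma lowers_max:
  assumes "lowers y i c"
  obtains c' where "max_lowers y i c'" "c \<le> c'"
proof -
  let ?S = "{c'. c \<le> c' \<and> lowers y i c'}"
  have "?S \<subseteq> {c..y ! i}" by (auto simp: lowers_def)
  then have fin: "finite ?S" by (rule finite_subset) simp
  have "c \<in> ?S" using assms by simp
  then have "Max ?S \<in> ?S" using fin by (intro Max_in) auto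
  moreover have "\<not> lowers y i c'" if "Max ?S < c'" for c'
    using that Max_ge[OF fin, of c'] \<open>Max ?S \<in> ?S\<close> by fastforce
  ultimately show ?thesis using that unfolding max_lowers_def by blast
qed

text \<open>Take the last index \<open>i\<close> where \<open>x\<close> and \<open>y\<close> differ.
  Beyond it they agree, so condition (III) for \<open>x\<close> is what permits lowering
  \<open>y\<close> at \<open>i\<close> alone to \<open>x ! i\<close>; the largest permitted value is
  then at least that.\<close>

lemma below_step:
  assumes x: "x \<in> T" and y: "y \<in> T" and le: "below x y" and ne: "x \<noteq> y"
  obtains i c where "max_lowers y i c" "below x (y[i := c])"
proof -
  have "\<exists>l. l \<le> N \<and> x ! l \<noteq> y ! l" using T_eqI x y ne by blast
  define S where "S = {l. l \<le> N \<and> x ! l \<noteq> y ! l}"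
  define i where "i = Max S"
  have "finite S" "S \<noteq> {}" using \<open>\<exists>l. _\<close> unfolding S_def by auto
  then have "i \<in> S" "\<And>l. l \<in> S \<Longrightarrow> l \<le> i" unfolding i_def by auto
  then have i: "i \<le> N" "x ! i \<noteq> y ! i" "\<And>l. l \<le> N \<Longrightarrow> i < l \<Longrightarrow> x ! l = y ! l"
    unfolding S_def using leD by blast+
  have lt: "x ! i < y ! i" using le i unfolding below_def by force
  have "lowers y i (x ! i)" unfolding lowers_def
  proof (intro conjI allI impI)
    show "\<not> (m + 1) dvd i" using T_mult[OF x i(1)] T_mult[OF y i(1)] lt by auto
    show "cl i \<le> x ! i" by (rule T_lower[OF x i(1)])
    fix l assume l: "i < l" "cl l \<le> x ! i"
    then have "l \<le> N" using T_upper[OF x i(1)] cl_le_n_iff by force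
    then show "y ! l \<le> x ! i" using T_closed[OF x l(1) i(1) l(2)] i(3)[of l] l by simp
  qed (use i lt in auto)
  then obtain c where c: "max_lowers y i c" "x ! i \<le> c" using lowers_max by metis
  have "below x (y[i := c])" using le c(2) i(1) T_length[OF y] unfolding below_def
    by (auto simp: nth_list_update)
  then show ?thesis using c that by blast
qed

text \<open>By \<open>below_step\<close>, whatever lies strictly below \<open>y\<close> lies below a
  maximal lowering of one entry. Conversely, a vector between \<open>y[i := c]\<close> and
  \<open>y\<close> can differ from \<open>y\<close> only at \<open>i\<close>, and an intermediate
  value there contradicts maximality.\<close>

lemma covers_iff: "covers L x y \<longleftrightarrow> y \<in> T \<and> (\<exists>i c. max_lowers y i c \<and> x = y[i := c])"
proof
  assume cov: "covers L x y"
  then have xy: "x \<in> T" "y \<in> T" "below x y" "x \<noteq> y" and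
    no: "\<And>z. z \<in> T \<Longrightarrow> \<not> (x \<sqsubset>\<^bsub>L\<^esub> z \<and> z \<sqsubset>\<^bsub>L\<^esub> y)"
    unfolding covers_def by (auto simp: L_less)
  obtain i c where ic: "max_lowers y i c" "below x (y[i := c])" using below_step[OF xy] by metis
  have low: "lowers y i c" using ic by (simp add: max_lowers_def)
  have z: "y[i := c] \<in> T" by (rule lowers_update[OF xy(2) low])
  have lt: "c < y ! i" "i \<le> N" using low by (auto simp: lowers_def)
  have "below (y[i := c]) y" "y[i := c] \<noteq> y"
    using lt T_length[OF xy(2)] unfolding below_def
    by (auto simp: nth_list_update) (metis less_add_one less_irrefl nth_list_update_eq order_le_less_trans less_Suc_eq_le Suc_eq_plus1)
  then have "x = y[i := c]" using no[OF z] ic(2) L_less xy z by blast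
  then show "y \<in> T \<and> (\<exists>i c. max_lowers y i c \<and> x = y[i := c])" using ic xy by blast
next
  assume "y \<in> T \<and> (\<exists>i c. max_lowers y i c \<and> x = y[i := c])"
  then obtain i c where y: "y \<in> T" and ic: "max_lowers y i c" and x: "x = y[i := c]" by blast
  have low: "lowers y i c" using ic by (simp add: max_lowers_def)
  have xT: "x \<in> T" unfolding x by (rule lowers_update[OF y low])
  have lt: "c < y ! i" "i < length y" "i \<le> N" using low T_length[OF y] by (auto simp: lowers_def)
  have xi: "x ! i = c" and xl: "\<And>l. l \<noteq> i \<Longrightarrow> x ! l = y ! l" using lt x by auto
  have "below x y" unfolding below_def
  proof (intro allI impI)
    show "x ! l \<le> y ! l" for l using xi xl lt by (cases "l = i") auto
  qed
  moreover have "x \<noteq> y" using xi lt by auto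
  moreover have False if z: "z \<in> T" "below x z" "x \<noteq> z" "below z y" "z \<noteq> y" for z
  proof -
    have zl: "z ! l = y ! l" if "l \<noteq> i" "l \<le> N" for l
      using z(2,4) that xl unfolding below_def by (metis order_antisym)
    have "z ! i \<noteq> c" using T_eqI[OF xT z(1)] z(3) zl xl xi by metis
    moreover have "z ! i \<noteq> y ! i" using T_eqI[OF z(1) y] z(5) zl by metis
    ultimately have ci: "c < z ! i" "z ! i < y ! i" using z(2,4) xi lt unfolding below_def by force+
    have "lowers y i (z ! i)" unfolding lowers_def
    proof (intro conjI allI impI)
      show "cl i \<le> z ! i" by (rule T_lower[OF z(1) lt(3)])
      fix l assume l: "i < l" "cl l \<le> z ! i"
      then have "l \<le> N" using T_upper[OF z(1) lt(3)] cl_le_n_iff by force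
      then show "y ! l \<le> z ! i" using T_closed[OF z(1) l(1) lt(3) l(2)] zl[of l] l by simp
    qed (use low ci in \<open>auto simp: lowers_def\<close>)
    then show False using ic ci unfolding max_lowers_def by blast
  qed
  ultimately show "covers L x y" unfolding covers_def using xT y by (auto simp: L_less)
qed

lemma lowers_nth:
  assumes "y \<in> T" "lowers y i c"
  shows "y[i := c] ! i = c" "l \<noteq> i \<Longrightarrow> y[i := c] ! l = y ! l"
  using assms T_length[of y] by (auto simp: lowers_def)

section \<open>Join-irreducible elements and the map kappa\<close>

definition ji_index :: "nat \<Rightarrow> int \<Rightarrow> bool" where
  "ji_index i c \<longleftrightarrow> i \<le> N \<and> \<not> (m + 1) dvd i \<and> cl i < c \<and> c \<le> int n"

text \<open>\<open>ji i c\<close> is the least vector with entry at least \<open>c\<close> at \<open>i\<close>, and \<open>mi i c\<close> the greatest one with entry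
  \<open>c - 1\<close> at \<open>i\<close>. The former are the join-irreducible elements, and \<open>\<kappa>\<close> maps the former to the latter.\<close>

definition ji :: "nat \<Rightarrow> int \<Rightarrow> int list" where
  "ji i c = map (\<lambda>l. if l \<le> i \<and> cl i \<le> cl l then c else cl l) [0..<N + 1]"

definition mi :: "nat \<Rightarrow> int \<Rightarrow> int list" where
  "mi i c = map (\<lambda>l. if (m + 1) dvd l then cl l else if i \<le> l \<and> cl l < c then c - 1 else int n) [0..<N + 1]"

lemma ji_nth: "l \<le> N \<Longrightarrow> ji i c ! l = (if l \<le> i \<and> cl i \<le> cl l then c else cl l)"
  by (simp add: ji_def nth_map_upt del: upt_Suc)

lemma mi_nth: "l \<le> N \<Longrightarrow> mi i c ! l =
    (if (m + 1) dvd l then cl l else if i \<le> l \<and> cl l < c then c - 1 else int n)"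
  by (simp add: mi_def nth_map_upt del: upt_Suc)

lemma ji_T:
  assumes "ji_index i c"
  shows "ji i c \<in> T"
proof (rule T_I)
  have i: "i \<le> N" "\<not> (m + 1) dvd i" "cl i < c" "c \<le> int n" using assms by (auto simp: ji_index_def)
  show "length (ji i c) = N + 1" by (simp add: ji_def)
  show "ji i c ! l = cl l" if "l \<le> N" "(m + 1) dvd l" for l
    using that i cl_dvd_le[of l i] by (auto simp: ji_nth)
  show "cl l \<le> ji i c ! l" if "l \<le> N" for l
    using that i cl_mono[of l i] by (auto simp: ji_nth)
  show "ji i c ! l \<le> int n" if "l \<le> N" for l
    using that i cl_le_n_iff[of l] by (auto simp: ji_nth)
  show "ji i c ! b \<le> ji i c ! a" if "a < b" "b \<le> N" "cl b \<le> ji i c ! a" for a b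
    using that i by (auto simp: ji_nth split: if_splits)
qed

text \<open>For \<open>l < i\<close> with \<open>cl i \<le> cl l\<close>, the lower bound at
  \<open>l\<close> and condition (III) give \<open>z ! i \<le> z ! l\<close>, so a large entry at
  \<open>i\<close> spreads over the plateau of \<open>ji i c\<close>.\<close>

lemma ji_below_iff:
  assumes "ji_index i c" "z \<in> T"
  shows "below (ji i c) z \<longleftrightarrow> c \<le> z ! i"
proof
  have i: "i \<le> N" using assms by (auto simp: ji_index_def)
  then show "below (ji i c) z \<Longrightarrow> c \<le> z ! i" unfolding below_def by (auto simp: ji_nth)
  assume c: "c \<le> z ! i"
  show "below (ji i c) z" unfolding below_def
  proof (intro allI impI)
    fix l assume l: "l \<le> N"
    have "z ! i \<le> z ! l" if "l \<le> i" "cl i \<le> cl l"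
    proof (cases "l = i")
      case False
      then show ?thesis using T_closed[OF assms(2), of l i] T_lower[OF assms(2) l] that l by simp
    qed simp
    then show "ji i c ! l \<le> z ! l" using T_lower[OF assms(2) l] c l by (auto simp: ji_nth)
  qed
qed

text \<open>Only the plateau exceeds the minimal entries, and lowering it before \<open>i\<close> is
  blocked by the entry at \<open>i\<close>.\<close>

lemma ji_max_lowers:
  assumes "ji_index i c"
  shows "max_lowers (ji i c) i' c' \<longleftrightarrow> i' = i \<and> c' = c - 1"
proof
  have i: "i \<le> N" "\<not> (m + 1) dvd i" "cl i < c" "c \<le> int n" using assms by (auto simp: ji_index_def)
  have up: "ji i c ! l \<le> c - 1" if "i < l" "cl l \<le> c - 1" for l
  proof -
    have "cl l \<le> int n" using that i by simp
    then have "l \<le> N" by (simp add: cl_le_n_iff)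
    then show ?thesis using that by (simp add: ji_nth)
  qed
  have low: "lowers (ji i c) i (c - 1)" unfolding lowers_def using i up by (auto simp: ji_nth)
  then have max: "max_lowers (ji i c) i (c - 1)"
    unfolding max_lowers_def using i by (auto simp: lowers_def ji_nth)
  then show "i' = i \<and> c' = c - 1 \<Longrightarrow> max_lowers (ji i c) i' c'" by simp
  assume ml: "max_lowers (ji i c) i' c'"
  then have i': "i' \<le> N" "cl i' \<le> c'" "c' < ji i c ! i'" "\<And>l. i' < l \<Longrightarrow> cl l \<le> c' \<Longrightarrow> ji i c ! l \<le> c'"
    by (auto simp: max_lowers_def lowers_def)
  then have seg: "i' \<le> i" "cl i \<le> cl i'" "ji i c ! i' = c" by (auto simp: ji_nth split: if_splits)
  have "i' = i"
  proof (rule ccontr)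
    assume "i' \<noteq> i"
    then have "ji i c ! i \<le> c'" using i'(4)[of i] seg i' by simp
    then show False using i i'(3) seg by (simp add: ji_nth)
  qed
  moreover have "c' = c - 1"
  proof -
    have "c' \<le> c - 1" using i'(3) seg by simp
    moreover have "\<not> c' < c - 1" using ml low \<open>i' = i\<close> unfolding max_lowers_def by blast
    ultimately show ?thesis by simp
  qed
  ultimately show "i' = i \<and> c' = c - 1" by simp
qed

lemma ji_covers: "ji_index i c \<Longrightarrow> covers L x (ji i c) \<longleftrightarrow> x = (ji i c)[i := c - 1]"
  unfolding covers_iff by (auto simp: ji_max_lowers ji_T)

lemma lower_cover_ji: "ji_index i c \<Longrightarrow> lower_cover L (ji i c) = (ji i c)[i := c - 1]"
  unfolding lower_cover_def by (simp add: ji_covers)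

lemma ji_inj:
  assumes "ji_index i c" "ji_index i' c'" "ji i c = ji i' c'"
  shows "i = i' \<and> c = c'"
proof -
  have "max_lowers (ji i' c') i (c - 1)" using ji_max_lowers[OF assms(1), of i "c - 1"] assms(3) by simp
  then show ?thesis using ji_max_lowers[OF assms(2)] by simp
qed

text \<open>If the only lower cover of \<open>j\<close> lowers entry \<open>i\<close>, then
  \<open>ji i (j ! i)\<close> lies below \<open>j\<close>. Were it different from \<open>j\<close>,
  it would lie below that cover, whose entry at \<open>i\<close> is too small.\<close>

lemma join_irreducible_iff: "join_irreducible L j \<longleftrightarrow> (\<exists>i c. ji_index i c \<and> j = ji i c)"
proof
  assume "join_irreducible L j"
  then have j: "j \<in> T" and ex1: "\<exists>!x. covers L x j" unfolding join_irreducible_def by auto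
  then obtain x where x: "covers L x j" by blast
  then obtain i c where ic: "max_lowers j i c" "x = j[i := c]" unfolding covers_iff by blast
  then have low: "lowers j i c" by (simp add: max_lowers_def)
  have "ji_index i (j ! i)"
    using low T_upper[OF j, of i] by (auto simp: ji_index_def lowers_def)
  note idx = this
  have "j = ji i (j ! i)"
  proof (rule ccontr)
    assume ne: "j \<noteq> ji i (j ! i)"
    have "below (ji i (j ! i)) j" using ji_below_iff[OF idx j] by simp
    then obtain i' c' where st: "max_lowers j i' c'" "below (ji i (j ! i)) (j[i' := c'])"
      using below_step[OF ji_T[OF idx] j _ ne[symmetric]] by metis
    then have "covers L (j[i' := c']) j" using j unfolding covers_iff by blast
    then have eq: "j[i' := c'] = j[i := c]" using ex1 x ic by blast
    have "j ! i \<le> j[i := c] ! i" using st(2) ji_below_iff[OF idx lowers_update[OF j low]] eq by simp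
    then show False using lowers_nth[OF j low] low by (simp add: lowers_def)
  qed
  then show "\<exists>i c. ji_index i c \<and> j = ji i c" using idx by blast
next
  assume "\<exists>i c. ji_index i c \<and> j = ji i c"
  then show "join_irreducible L j" unfolding join_irreducible_def by (auto simp: ji_covers ji_T)
qed

lemma greatest_unique:
  assumes "greatest L x A" "greatest L y A"
  shows "x = y"
proof -
  have "x \<in> T" "y \<in> T" "x \<sqsubseteq>\<^bsub>L\<^esub> y" "y \<sqsubseteq>\<^bsub>L\<^esub> x" using assms unfolding greatest_def by auto
  then show ?thesis using below_antisym L_le by blast
qed

lemma map2_min_T:
  assumes "x \<in> T" "y \<in> T"
  shows "map2 min x y \<in> T"
proof (rule T_I)
  show "length (map2 min x y) = N + 1" using assms T_length by simp
  have nth: "map2 min x y ! l = min (x ! l) (y ! l)" if "l \<le> N" for l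
    using that assms T_length by simp
  show "map2 min x y ! l = cl l" if "l \<le> N" "(m + 1) dvd l" for l
    using nth that assms T_mult by simp
  show "cl l \<le> map2 min x y ! l" if "l \<le> N" for l
    using nth that assms T_lower by simp
  show "map2 min x y ! l \<le> int n" if "l \<le> N" for l
    using nth[OF that] T_upper[OF assms(1) that] by simp
  show "map2 min x y ! b \<le> map2 min x y ! a" if ab: "a < b" "b \<le> N" "cl b \<le> map2 min x y ! a" for a b
    using nth[of a] nth[of b] ab T_closed[OF assms(1), of a b] T_closed[OF assms(2), of a b] by (simp add: min_def split: if_splits)
qed

lemma meet_eq:
  assumes "x \<in> T" "y \<in> T"
  shows "x \<sqinter>\<^bsub>L\<^esub> y = map2 min x y"
proof -
  have nth: "map2 min x y ! l = min (x ! l) (y ! l)" if "l \<le> N" for l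
    using that assms T_length by simp
  have "greatest L (map2 min x y) (Lower L {x, y})"
    unfolding greatest_def Lower_def
  proof (intro conjI ballI)
    show "map2 min x y \<in> {l. \<forall>z. z \<in> {x, y} \<inter> carrier L \<longrightarrow> l \<sqsubseteq>\<^bsub>L\<^esub> z} \<inter> carrier L"
      using assms map2_min_T by (auto simp: L_le below_def nth)
    fix z assume "z \<in> {l. \<forall>z. z \<in> {x, y} \<inter> carrier L \<longrightarrow> l \<sqsubseteq>\<^bsub>L\<^esub> z} \<inter> carrier L"
    then have "z \<in> T" "below z x" "below z y" using assms L_le by auto
    then show "z \<sqsubseteq>\<^bsub>L\<^esub> map2 min x y" using assms map2_min_T by (simp add: L_le below_def nth)
  qed auto
  then have "(SOME z. greatest L z (Lower L {x, y})) = map2 min x y"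
    by (intro some_equality greatest_unique)
  then show ?thesis by (simp add: meet_def inf_def)
qed

lemma mi_T:
  assumes "ji_index i c"
  shows "mi i c \<in> T"
proof (rule T_I)
  have i: "i \<le> N" "\<not> (m + 1) dvd i" "cl i < c" "c \<le> int n" using assms by (auto simp: ji_index_def)
  show "length (mi i c) = N + 1" by (simp add: mi_def)
  show "mi i c ! l = cl l" if "l \<le> N" "(m + 1) dvd l" for l using that by (simp add: mi_nth)
  show "cl l \<le> mi i c ! l" if "l \<le> N" for l using that cl_le_n_iff[of l] by (simp add: mi_nth)
  show "mi i c ! l \<le> int n" if "l \<le> N" for l using that i cl_le_n_iff[of l] by (simp add: mi_nth)
  show "mi i c ! b \<le> mi i c ! a" if ab: "a < b" "b \<le> N" "cl b \<le> mi i c ! a" for a b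
  proof (cases "(m + 1) dvd a")
    case True
    then show ?thesis using ab cl_dvd_le[of a b] by (simp add: mi_nth)
  next
    case False
    then show ?thesis using ab i cl_le_n_iff[of b] by (auto simp: mi_nth split: if_splits)
  qed
qed

text \<open>The meet condition forces the entry \<open>c - 1\<close> at \<open>i\<close>. Condition
  (III) then bounds by \<open>c - 1\<close> the entries at \<open>l \<ge> i\<close> with
  \<open>cl l < c\<close>, and \<open>mi i c\<close> is largest under these bounds.\<close>

lemma kappa_ji:
  assumes idx: "ji_index i c"
  shows "kappa L (ji i c) = mi i c"
proof -
  have i: "i \<le> N" "\<not> (m + 1) dvd i" "cl i < c" "c \<le> int n" using assms by (auto simp: ji_index_def)
  let ?Z = "{z \<in> carrier L. z \<sqinter>\<^bsub>L\<^esub> ji i c = lower_cover L (ji i c)}"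
  have low: "lowers (ji i c) i (c - 1)" using ji_max_lowers[OF idx, of i "c - 1"] by (simp add: max_lowers_def)
  note jT = ji_T[OF idx]
  note up = lowers_update[OF jT low] and nth = lowers_nth[OF jT low]
  have Z: "z \<in> ?Z \<longleftrightarrow> z \<in> T \<and> map2 min z (ji i c) = (ji i c)[i := c - 1]" for z
    using meet_eq[OF _ jT] lower_cover_ji[OF idx] by auto
  have "greatest L (mi i c) ?Z" unfolding greatest_def
  proof (intro conjI ballI)
    show "mi i c \<in> ?Z" unfolding Z
    proof (intro conjI)
      show "mi i c \<in> T" by (rule mi_T[OF idx])
      show "map2 min (mi i c) (ji i c) = (ji i c)[i := c - 1]"
      proof (rule T_eqI[OF map2_min_T[OF mi_T[OF idx] jT] up])
        fix l assume l: "l \<le> N"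
        have "map2 min (mi i c) (ji i c) ! l = min (mi i c ! l) (ji i c ! l)"
          using l T_length[OF mi_T[OF idx]] T_length[OF jT] by simp
        also have "\<dots> = (ji i c)[i := c - 1] ! l"
        proof (cases "l = i")
          case True
          then show ?thesis using nth(1) i by (simp add: mi_nth ji_nth)
        next
          case False
          have "ji i c ! l \<le> mi i c ! l"
          proof (cases "(m + 1) dvd l")
            case True
            then show ?thesis using l T_mult[OF jT l] by (simp add: mi_nth)
          next
            case nd: False
            then show ?thesis using l False i T_upper[OF jT l] by (auto simp: mi_nth ji_nth)
          qed
          then show ?thesis using nth(2)[OF False] by simp
        qed
        finally show "map2 min (mi i c) (ji i c) ! l = (ji i c)[i := c - 1] ! l" .
      qed
    qed
    fix z assume "z \<in> ?Z"
    then have z: "z \<in> T" "map2 min z (ji i c) = (ji i c)[i := c - 1]" using Z by auto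
    have "map2 min z (ji i c) ! i = min (z ! i) (ji i c ! i)"
      using i T_length[OF z(1)] T_length[OF jT] by simp
    then have zi: "z ! i = c - 1" using z(2) nth(1) i by (simp add: ji_nth min_def split: if_splits)
    have "below z (mi i c)" unfolding below_def
    proof (intro allI impI)
      fix l assume l: "l \<le> N"
      have "z ! l \<le> c - 1" if "i \<le> l" "cl l < c"
      proof (cases "i = l")
        case False
        then show ?thesis using T_closed[OF z(1), of i l] that zi i by simp
      qed (use zi in simp)
      then show "z ! l \<le> mi i c ! l" using T_mult[OF z(1) l] T_upper[OF z(1) l] l by (auto simp: mi_nth)
    qed
    then show "z \<sqsubseteq>\<^bsub>L\<^esub> mi i c" using L_le z mi_T[OF idx] by simp
  qed auto
  then show ?thesis unfolding kappa_def by (intro the_equality greatest_unique)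
qed

lemma below_mi_iff:
  assumes idx: "ji_index i c" and x: "x \<in> T"
  shows "below x (mi i c) \<longleftrightarrow> (\<forall>l\<ge>i. cl l < c \<longrightarrow> x ! l < c)"
proof
  have i: "i \<le> N" "\<not> (m + 1) dvd i" "cl i < c" "c \<le> int n" using assms by (auto simp: ji_index_def)
  assume le: "below x (mi i c)"
  show "\<forall>l\<ge>i. cl l < c \<longrightarrow> x ! l < c"
  proof (intro allI impI)
    fix l assume l: "i \<le> l" "cl l < c"
    then have "l \<le> N" using i cl_le_n_iff[of l] by simp
    then have "x ! l \<le> mi i c ! l" using le unfolding below_def by blast
    then show "x ! l < c" using l \<open>l \<le> N\<close> by (simp add: mi_nth split: if_splits)
  qed
next
  assume *: "\<forall>l\<ge>i. cl l < c \<longrightarrow> x ! l < c"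
  show "below x (mi i c)" unfolding below_def
  proof (intro allI impI)
    fix l assume l: "l \<le> N"
    then show "x ! l \<le> mi i c ! l" using * T_mult[OF x l] T_upper[OF x l] by (force simp: mi_nth)
  qed
qed

text \<open>A rival label \<open>ji i' c'\<close> needs entry \<open>i'\<close> at least
  \<open>c'\<close> in \<open>y\<close> but below \<open>c'\<close> in the lowered vector, so
  \<open>i' = i\<close> and \<open>c < c'\<close>. Then \<open>c' - 1\<close> is a permitted
  lowering too, and maximality of \<open>c\<close> leaves \<open>c' = c + 1\<close>.\<close>

lemma edge_label_eq:
  assumes y: "y \<in> T" and ml: "max_lowers y i c"
  shows "edge_label L (y[i := c]) y = ji i (c + 1)" "ji_index i (c + 1)"
proof -
  have low: "lowers y i c" using ml by (simp add: max_lowers_def)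
  then have i: "i \<le> N" "\<not> (m + 1) dvd i" "cl i \<le> c" "c < y ! i" "\<And>l. i < l \<Longrightarrow> cl l \<le> c \<Longrightarrow> y ! l \<le> c"
    by (auto simp: lowers_def)
  show idx: "ji_index i (c + 1)" using i T_upper[OF y i(1)] by (simp add: ji_index_def)
  note xT = lowers_update[OF y low] and nth = lowers_nth[OF y low]
  show "edge_label L (y[i := c]) y = ji i (c + 1)" unfolding edge_label_def
  proof (rule the_equality)
    have "below (y[i := c]) (mi i (c + 1))" unfolding below_mi_iff[OF idx xT]
    proof (intro allI impI)
      fix l assume "i \<le> l" "cl l < c + 1"
      then show "y[i := c] ! l < c + 1" using i(5)[of l] nth(1) nth(2)[of l] by (cases "l = i") auto
    qed
    moreover have "below (ji i (c + 1)) y" using ji_below_iff[OF idx y] i by simp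
    ultimately show "join_irreducible L (ji i (c + 1)) \<and> ji i (c + 1) \<sqsubseteq>\<^bsub>L\<^esub> y \<and> y[i := c] \<sqsubseteq>\<^bsub>L\<^esub> kappa L (ji i (c + 1))"
      using idx join_irreducible_iff kappa_ji L_le xT y ji_T mi_T by auto
  next
    fix j assume j: "join_irreducible L j \<and> j \<sqsubseteq>\<^bsub>L\<^esub> y \<and> y[i := c] \<sqsubseteq>\<^bsub>L\<^esub> kappa L j"
    then obtain i' c' where idx': "ji_index i' c'" and jeq: "j = ji i' c'" using join_irreducible_iff by blast
    have 1: "c' \<le> y ! i'" using j jeq ji_below_iff[OF idx' y] L_le[OF ji_T[OF idx'] y] by simp
    have 2: "\<And>l. i' \<le> l \<Longrightarrow> cl l < c' \<Longrightarrow> y[i := c] ! l < c'"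
      using j jeq kappa_ji[OF idx'] L_le[OF xT mi_T[OF idx']] below_mi_iff[OF idx' xT] by simp
    have c': "cl i' < c'" "c' \<le> int n" using idx' by (auto simp: ji_index_def)
    have ii: "i' = i"
    proof (rule ccontr)
      assume "i' \<noteq> i"
      then show False using 1 2[of i'] c' nth(2)[of i'] by simp
    qed
    have "c < c'" using 2[of i] ii c' nth(1) by simp
    moreover have "lowers y i (c' - 1)" unfolding lowers_def
    proof (intro conjI allI impI)
      fix l assume l: "i < l" "cl l \<le> c' - 1"
      then show "y ! l \<le> c' - 1" using 2[of l] nth(2)[of l] ii by simp
    qed (use i c' 1 ii in auto)
    then have "\<not> c < c' - 1" using ml unfolding max_lowers_def by blast
    ultimately have "c' = c + 1" by simp
    then show "j = ji i (c + 1)" using jeq ii by simp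
  qed
qed

section \<open>Labels of lower and upper covers as pairs of an index and a value\<close>

definition down_pairs :: "int list \<Rightarrow> (nat \<times> int) set" where
  "down_pairs y = {(i, c). max_lowers y i c}"

text \<open>An earlier entry with the same value would, by condition (III), keep entry
  \<open>i\<close> from being raised alone. The value before raising is recorded, so that
  \<open>(i, c)\<close> stands for the label \<open>ji i (c + 1)\<close> as in
  \<open>down_pairs\<close>.\<close>

definition up_pairs :: "int list \<Rightarrow> (nat \<times> int) set" where
  "up_pairs x = {(i, x ! i) | i. i \<le> N \<and> \<not> (m + 1) dvd i \<and> x ! i < int n \<and> x ! i \<notin> set (take i x)}"

lemma down_labels_eq:
  assumes y: "y \<in> T"
  shows "down_labels L y = (\<lambda>(i, c). ji i (c + 1)) ` down_pairs y"
  unfolding down_labels_def covers_iff down_pairs_def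
  using y edge_label_eq(1)[OF y] by (auto simp: image_iff) metis+

lemma not_in_take_iff: "x \<in> T \<Longrightarrow> i \<le> N \<Longrightarrow> v \<notin> set (take i x) \<longleftrightarrow> (\<forall>l<i. x ! l \<noteq> v)"
  using T_length[of x] by (auto simp: in_set_conv_nth)

lemma up_cover_exists:
  assumes x: "x \<in> T" and i: "i \<le> N" "\<not> (m + 1) dvd i" "x ! i < int n" "x ! i \<notin> set (take i x)"
  obtains y where "y \<in> T" "max_lowers y i (x ! i)" "x = y[i := x ! i]"
proof -
  define raises where "raises c \<longleftrightarrow> x ! i < c \<and> c \<le> int n \<and> x[i := c] \<in> T" for c
  \<comment> \<open>Earlier entries that are at least \<open>cl i\<close> bound entry
    \<open>i\<close> through condition (III); the least of these bounds, capped by \<open>n\<close>,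
    is a possible new value.\<close>
  define S where "S = {x ! l | l. l < i \<and> cl i \<le> x ! l} \<union> {int n}"
  have len: "length x = N + 1" by (rule T_length[OF x])
  have fo: "x ! l \<noteq> x ! i" if "l < i" for l using i(4) not_in_take_iff[OF x i(1)] that by auto
  have finS: "finite S" unfolding S_def by simp
  have Min: "Min S \<in> S" "\<And>s. s \<in> S \<Longrightarrow> Min S \<le> s" using finS Min_in[of S] by (auto simp: S_def)
  have gt: "x ! i < s" if s: "s \<in> S" for s
  proof -
    have "x ! i < x ! l" if "l < i" "cl i \<le> x ! l" for l
      using T_closed[OF x, of l i] that fo[OF that(1)] i(1) by simp
    then show ?thesis using s i(3) unfolding S_def by auto
  qed
  have Mn: "Min S \<le> int n" using Min(2) by (simp add: S_def)
  have "raises (Min S)" unfolding raises_def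
  proof (intro conjI)
    show "x ! i < Min S" using gt Min by blast
    show "Min S \<le> int n" by (rule Mn)
    have lt: "x ! i < Min S" using gt Min by blast
    show "x[i := Min S] \<in> T"
    proof (rule T_I)
      show "length (x[i := Min S]) = N + 1" using len by simp
      show "x[i := Min S] ! l = cl l" if "l \<le> N" "(m + 1) dvd l" for l
        using that i T_mult[OF x that] by (cases "l = i") auto
      show "cl l \<le> x[i := Min S] ! l" if "l \<le> N" for l
        using T_lower[OF x that] lt len that by (cases "l = i") auto
      show "x[i := Min S] ! l \<le> int n" if "l \<le> N" for l
        using T_upper[OF x that] Mn len that by (cases "l = i") auto
      show "x[i := Min S] ! b \<le> x[i := Min S] ! a" if ab: "a < b" "b \<le> N" "cl b \<le> x[i := Min S] ! a" for a b
      proof (cases "a = i")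
        case True
        have "x ! b \<le> Min S"
        proof -
          from Min(1) consider l where "l < i" "Min S = x ! l" | "Min S = int n" unfolding S_def by auto
          then show ?thesis
          proof cases
            case 1
            then show ?thesis using T_closed[OF x, of l b] ab True i(1) len by simp
          next
            case 2
            then show ?thesis using T_upper[OF x ab(2)] by simp
          qed
        qed
        then show ?thesis using ab True i(1) len by simp
      next
        case False
        show ?thesis
        proof (cases "b = i")
          case True
          then have "x ! a \<in> S" using ab False unfolding S_def by auto
          then show ?thesis using Min(2) True False i(1) len by simp
        next
          case nb: False
          then show ?thesis using T_closed[OF x, of a b] ab False by simp
        qed
      qed
    qed
  qed
  moreover have "{c. raises c} \<subseteq> {x ! i..int n}" unfolding raises_def by auto
  then have fin: "finite {c. raises c}" by (rule finite_subset) simp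
  ultimately have c: "raises (Min {c. raises c})" using Min_in[of "{c. raises c}"] by auto
  \<comment> \<open>The least possible raise: lowering \<open>y\<close> only to some value above
    \<open>x ! i\<close> would be a smaller raise.\<close>
  define c where "c = Min {c. raises c}"
  define y where "y = x[i := c]"
  have y: "y \<in> T" "x ! i < c" using c unfolding raises_def y_def c_def by auto
  have yi: "y ! i = c" and yl: "\<And>l. l \<noteq> i \<Longrightarrow> y ! l = x ! l" unfolding y_def using i(1) len by auto
  have "lowers y i (x ! i)" unfolding lowers_def
  proof (intro conjI allI impI)
    show "cl i \<le> x ! i" by (rule T_lower[OF x i(1)])
    fix l assume l: "i < l" "cl l \<le> x ! i"
    then show "y ! l \<le> x ! i" using T_closed[OF x l(1) i(1) l(2)] yl[of l] by simp
  qed (use i y yi in auto)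
  moreover have "\<not> lowers y i c'" if "x ! i < c'" for c'
  proof
    assume low: "lowers y i c'"
    then have "y[i := c'] \<in> T" "c' < c" using lowers_update[OF y(1)] yi by (auto simp: lowers_def)
    then have "raises c'" using that T_upper[OF y(1) i(1)] yi unfolding raises_def y_def by simp
    then have "c \<le> c'" using Min_le[OF fin] unfolding c_def by simp
    then show False using \<open>c' < c\<close> by simp
  qed
  ultimately have "max_lowers y i (x ! i)" unfolding max_lowers_def by blast
  moreover have "x = y[i := x ! i]" unfolding y_def by simp
  ultimately show ?thesis using y(1) that by blast
qed

lemma up_labels_eq:
  assumes x: "x \<in> T"
  shows "up_labels L x = (\<lambda>(i, c). ji i (c + 1)) ` up_pairs x"
proof (intro equalityI subsetI)
  fix j assume "j \<in> up_labels L x"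
  then obtain y where y: "covers L x y" "j = edge_label L x y" unfolding up_labels_def by blast
  then obtain i c where ic: "y \<in> T" "max_lowers y i c" "x = y[i := c]" unfolding covers_iff by blast
  have low: "lowers y i c" using ic by (simp add: max_lowers_def)
  then have i: "i \<le> N" "\<not> (m + 1) dvd i" "cl i \<le> c" "c < y ! i" by (auto simp: lowers_def)
  have xi: "x ! i = c" "\<And>l. l \<noteq> i \<Longrightarrow> x ! l = y ! l" using lowers_nth[OF ic(1) low] ic by auto
  have "x ! l \<noteq> x ! i" if l: "l < i" for l
  proof
    assume "x ! l = x ! i"
    then have "y ! l = c" using xi l by simp
    then show False using T_closed[OF ic(1), of l i] l i by simp
  qed
  then have "x ! i \<notin> set (take i x)" using not_in_take_iff[OF x i(1)] by auto
  moreover have "x ! i < int n" using xi i T_upper[OF ic(1) i(1)] by simp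
  ultimately have "(i, c) \<in> up_pairs x" unfolding up_pairs_def using i xi by blast
  moreover have "j = ji i (c + 1)" using y ic edge_label_eq(1)[OF ic(1,2)] by simp
  ultimately show "j \<in> (\<lambda>(i, c). ji i (c + 1)) ` up_pairs x" by force
next
  fix j assume "j \<in> (\<lambda>(i, c). ji i (c + 1)) ` up_pairs x"
  then obtain i where i: "i \<le> N" "\<not> (m + 1) dvd i" "x ! i < int n" "x ! i \<notin> set (take i x)"
    and j: "j = ji i (x ! i + 1)" unfolding up_pairs_def by auto
  obtain y where y: "y \<in> T" "max_lowers y i (x ! i)" "x = y[i := x ! i]"
    using up_cover_exists[OF x i] by metis
  then have "covers L x y" unfolding covers_iff by blast
  moreover have "edge_label L x y = j" using edge_label_eq(1)[OF y(1,2)] y(3) j by simp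
  ultimately show "j \<in> up_labels L x" unfolding up_labels_def by blast
qed

lemma labels_eq_iff:
  assumes x: "x \<in> T" and y: "y \<in> T"
  shows "up_labels L x = down_labels L y \<longleftrightarrow> up_pairs x = down_pairs y"
    "up_labels L x = up_labels L y \<longleftrightarrow> up_pairs x = up_pairs y"
proof -
  have u: "up_pairs z \<subseteq> {(i, c). ji_index i (c + 1)}" if "z \<in> T" for z
    using T_lower[OF that] unfolding up_pairs_def ji_index_def by auto
  have d: "down_pairs y \<subseteq> {(i, c). ji_index i (c + 1)}"
    using edge_label_eq(2)[OF y] unfolding down_pairs_def by auto
  have inj: "inj_on (\<lambda>(i, c). ji i (c + 1)) {(i, c). ji_index i (c + 1)}"
    using ji_inj by (fastforce simp: inj_on_def)
  show "up_labels L x = down_labels L y \<longleftrightarrow> up_pairs x = down_pairs y"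
    unfolding up_labels_eq[OF x] down_labels_eq[OF y] by (rule inj_on_image_eq_iff[OF inj u[OF x] d])
  show "up_labels L x = up_labels L y \<longleftrightarrow> up_pairs x = up_pairs y"
    unfolding up_labels_eq[OF x] up_labels_eq[OF y] by (rule inj_on_image_eq_iff[OF inj u[OF x] u[OF y]])
qed

end

section \<open>Rowmotion as the turn operator\<close>

lemma count_take_Suc:
  assumes "t < length w"
  shows "count_list (take (Suc t) w) True = count_list (take t w) True + of_bool (w ! t)"
  using assms by (simp add: take_Suc_conv_app_nth)

lemma count_take_mono: "t \<le> t' \<Longrightarrow> count_list (take t w) True \<le> count_list (take t' w) True"
proof -
  assume "t \<le> t'"
  then have "take t' w = take t w @ take (t' - t) (drop t w)" by (metis le_add_diff_inverse take_add)
  then show ?thesis by simp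
qed

lemma count_le_if_imp:
  assumes "length w = length w'" "\<And>i. i < length w \<Longrightarrow> w ! i \<Longrightarrow> w' ! i"
  shows "count_list w True \<le> count_list w' True"
  using assms
proof (induction w w' rule: list_induct2)
  case (Cons x xs y ys)
  have "x \<longrightarrow> y" using Cons.prems[of 0] by simp
  moreover have "count_list xs True \<le> count_list ys True"
    by (rule Cons.IH) (use Cons.prems[of "Suc _"] in simp)
  ultimately show ?case by auto
qed simp

lemma eq_if_imp_count:
  assumes "length w = length w'" "\<And>i. i < length w \<Longrightarrow> w ! i \<Longrightarrow> w' ! i"
    and "count_list w' True \<le> count_list w True"
  shows "w = w'"
  using assms
proof (induction w w' rule: list_induct2)
  case (Cons x xs y ys)
  have xy: "x \<longrightarrow> y" using Cons.prems(1)[of 0] by simp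
  have imp: "\<And>i. i < length xs \<Longrightarrow> xs ! i \<Longrightarrow> ys ! i" using Cons.prems(1)[of "Suc _"] by simp
  have "count_list xs True \<le> count_list ys True" by (rule count_le_if_imp[OF Cons.hyps imp])
  then have "x = y" "count_list ys True \<le> count_list xs True"
    using xy Cons.prems(2) by (auto split: if_splits)
  then show ?case using Cons.IH imp by blast
qed simp

section \<open>The rowmotion image in closed form\<close>

context m_tamari
begin

text \<open>The componentwise minimum of the vectors \<open>mi i (c + 1)\<close> over the pairs
  \<open>(i, c)\<close> of \<open>down_pairs y\<close>, that is, the meet of the
  \<open>kappa\<close> images of the down labels; \<open>n\<close> is the default where no pair
  applies.\<close>

definition row_vec :: "int list \<Rightarrow> int list" where
  "row_vec y = map (\<lambda>l. if (m + 1) dvd l then cl l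
     else Min ({c. \<exists>i. max_lowers y i c \<and> i \<le> l \<and> cl l \<le> c} \<union> {int n})) [0..<N + 1]"

lemma row_vec_mult: "l \<le> N \<Longrightarrow> (m + 1) dvd l \<Longrightarrow> row_vec y ! l = cl l"
  by (simp add: row_vec_def nth_map_upt del: upt_Suc)

lemma
  assumes y: "y \<in> T" and l: "l \<le> N" "\<not> (m + 1) dvd l"
  shows row_vec_le: "max_lowers y i c \<Longrightarrow> i \<le> l \<Longrightarrow> cl l \<le> c \<Longrightarrow> row_vec y ! l \<le> c"
    and row_vec_cases: "row_vec y ! l = int n \<or> (\<exists>i. max_lowers y i (row_vec y ! l) \<and> i \<le> l \<and> cl l \<le> row_vec y ! l)"
    and row_vec_le_n: "row_vec y ! l \<le> int n"
proof -
  let ?S = "{c. \<exists>i. max_lowers y i c \<and> i \<le> l \<and> cl l \<le> c} \<union> {int n}"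
  have eq: "row_vec y ! l = Min ?S" using l by (simp add: row_vec_def nth_map_upt del: upt_Suc)
  have "c \<in> {0..int n}" if "max_lowers y i c" for i c
    using that T_upper[OF y, of i] cl_nonneg[of i] by (auto simp: max_lowers_def lowers_def)
  then have "?S \<subseteq> {0..int n}" by auto
  then have fin: "finite ?S" by (rule finite_subset) simp
  show "row_vec y ! l \<le> c" if "max_lowers y i c" "i \<le> l" "cl l \<le> c"
    unfolding eq by (rule Min_le[OF fin]) (use that in blast)
  show "row_vec y ! l \<le> int n"
    unfolding eq by (rule Min_le[OF fin]) simp
  have "row_vec y ! l \<in> ?S" unfolding eq by (rule Min_in[OF fin]) simp
  then show "row_vec y ! l = int n \<or> (\<exists>i. max_lowers y i (row_vec y ! l) \<and> i \<le> l \<and> cl l \<le> row_vec y ! l)"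
    by blast
qed

lemma row_vec_T:
  assumes y: "y \<in> T"
  shows "row_vec y \<in> T"
proof (rule T_I)
  show "length (row_vec y) = N + 1" by (simp add: row_vec_def)
  show "row_vec y ! l = cl l" if "l \<le> N" "(m + 1) dvd l" for l using row_vec_mult that by simp
  show upper: "row_vec y ! l \<le> int n" if "l \<le> N" for l
    using that row_vec_mult[OF that] row_vec_le_n[OF y that] cl_le_n_iff[of l] by (cases "(m + 1) dvd l") auto
  show "cl l \<le> row_vec y ! l" if "l \<le> N" for l
    using that row_vec_mult[OF that] row_vec_cases[OF y that] cl_le_n_iff[of l] by (cases "(m + 1) dvd l") auto
  show "row_vec y ! b \<le> row_vec y ! a" if ab: "a < b" "b \<le> N" "cl b \<le> row_vec y ! a" for a b
  proof (cases "(m + 1) dvd a")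
    case True
    then show ?thesis using ab row_vec_mult[of a y] cl_dvd_le[OF True, of b] by simp
  next
    case False
    from ab have a: "a \<le> N" by simp
    show ?thesis
    proof (cases "row_vec y ! a = int n")
      case True
      then show ?thesis using upper[OF ab(2)] by simp
    next
      case ne: False
      then obtain i where i: "max_lowers y i (row_vec y ! a)" "i \<le> a" using row_vec_cases[OF y a False] by blast
      show ?thesis
      proof (cases "(m + 1) dvd b")
        case True
        then show ?thesis using row_vec_mult[OF ab(2) True] ab(3) by simp
      next
        case nb: False
        show ?thesis by (rule row_vec_le[OF y ab(2) nb i(1)]) (use i ab in auto)
      qed
    qed
  qed
qed

text \<open>No pair with index before \<open>i\<close> has a value between \<open>cl i\<close> and
  \<open>c\<close>: lowering there would require \<open>y ! i\<close> to be at most that value,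
  contrary to \<open>c < y ! i\<close>.\<close>

lemma max_lowers_nth_row_vec:
  assumes y: "y \<in> T" and ml: "max_lowers y i c"
  shows "row_vec y ! i = c" "row_vec y ! i \<notin> set (take i (row_vec y))"
proof -
  have i: "i \<le> N" "\<not> (m + 1) dvd i" "cl i \<le> c" "c < y ! i" using ml by (auto simp: max_lowers_def lowers_def)
  have cn: "c < int n" using i T_upper[OF y i(1)] by simp
  have le: "row_vec y ! i \<le> c" by (rule row_vec_le[OF y i(1,2) ml _ i(3)]) simp
  have "row_vec y ! i \<noteq> int n" using le cn by simp
  then obtain i' where i': "max_lowers y i' (row_vec y ! i)" "i' \<le> i" "cl i \<le> row_vec y ! i"
    using row_vec_cases[OF y i(1,2)] by blast
  show eq: "row_vec y ! i = c"
  proof (rule ccontr)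
    assume "row_vec y ! i \<noteq> c"
    then have lt: "row_vec y ! i < c" using le by simp
    show False
    proof (cases "i' = i")
      case True
      then show False using i'(1) ml lt unfolding max_lowers_def by blast
    next
      case False
      then have "y ! i \<le> row_vec y ! i" using i' by (auto simp: max_lowers_def lowers_def)
      then show False using lt i by simp
    qed
  qed
  have "row_vec y ! l \<noteq> c" if l: "l < i" for l
  proof
    assume lc: "row_vec y ! l = c"
    have lN: "l \<le> N" using l i by simp
    show False
    proof (cases "(m + 1) dvd l")
      case True
      then show False using cl_dvd_le[OF True, of i] row_vec_mult[OF lN True] lc i l by simp
    next
      case False
      then obtain i'' where "max_lowers y i'' c" "i'' \<le> l" using row_vec_cases[OF y lN False] lc cn by auto
      then have "y ! i \<le> c" using l i by (auto simp: max_lowers_def lowers_def)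
      then show False using i by simp
    qed
  qed
  then show "row_vec y ! i \<notin> set (take i (row_vec y))"
    using not_in_take_iff[OF row_vec_T[OF y] i(1)] eq by simp
qed

lemma up_pairs_row_vec:
  assumes y: "y \<in> T"
  shows "up_pairs (row_vec y) = down_pairs y"
proof (intro equalityI subrelI)
  fix i c assume "(i, c) \<in> down_pairs y"
  then have ml: "max_lowers y i c" by (simp add: down_pairs_def)
  then have "i \<le> N" "\<not> (m + 1) dvd i" "c < int n"
    using T_upper[OF y, of i] by (auto simp: max_lowers_def lowers_def)
  then show "(i, c) \<in> up_pairs (row_vec y)"
    using max_lowers_nth_row_vec[OF y ml] unfolding up_pairs_def by auto
next
  fix i c assume "(i, c) \<in> up_pairs (row_vec y)"
  then have i: "i \<le> N" "\<not> (m + 1) dvd i" "c < int n" "row_vec y ! i = c"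
    "row_vec y ! i \<notin> set (take i (row_vec y))" unfolding up_pairs_def by auto
  then obtain i' where i': "max_lowers y i' c" "i' \<le> i" using row_vec_cases[OF y i(1,2)] by auto
  have "row_vec y ! i' = c" by (rule max_lowers_nth_row_vec(1)[OF y i'(1)])
  then have "\<not> i' < i" using i not_in_take_iff[OF row_vec_T[OF y] i(1)] by auto
  then show "(i, c) \<in> down_pairs y" using i' by (simp add: down_pairs_def)
qed

text \<open>If \<open>x' ! l\<close> is neither prescribed nor \<open>n\<close>, the first index
  \<open>i\<close> with that value belongs to \<open>up_pairs x'\<close>. So \<open>x ! i\<close>
  equals it, and condition (III) for \<open>x\<close> bounds \<open>x ! l\<close> by it. Exchanging
  the roles gives equality.\<close>

lemma up_pairs_inj:
  assumes x: "x \<in> T" and x': "x' \<in> T" and eq: "up_pairs x = up_pairs x'"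
  shows "x = x'"
proof -
  have le: "x ! l \<le> x' ! l" if x: "x \<in> T" and x': "x' \<in> T" and eq: "up_pairs x = up_pairs x'" and l: "l \<le> N"
    for x x' l
  proof (cases "(m + 1) dvd l \<or> x' ! l = int n")
    case True
    then show ?thesis using T_mult[OF x l] T_mult[OF x' l] T_upper[OF x l] by auto
  next
    case False
    define i where "i = (LEAST i. x' ! i = x' ! l)"
    have i: "x' ! i = x' ! l" unfolding i_def by (rule LeastI) simp
    have il: "i \<le> l" unfolding i_def by (rule Least_le) simp
    have first: "x' ! j \<noteq> x' ! i" if "j < i" for j
      using not_less_Least[of j "\<lambda>i. x' ! i = x' ! l"] that i unfolding i_def by simp
    have iN: "i \<le> N" using il l by simp
    have "\<not> (m + 1) dvd i"
    proof
      assume d: "(m + 1) dvd i"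
      then have "cl l \<le> cl i" using T_mult[OF x' iN d] T_lower[OF x' l] i by simp
      then have "l = i" using cl_dvd_le[OF d, of l] il by simp
      then show False using d False by simp
    qed
    then have "(i, x' ! i) \<in> up_pairs x'"
      using iN i False T_upper[OF x' l] first not_in_take_iff[OF x' iN] unfolding up_pairs_def by auto
    then have "(i, x' ! i) \<in> up_pairs x" using eq by simp
    then have xi: "x ! i = x' ! l" using i unfolding up_pairs_def by auto
    show ?thesis
    proof (cases "i = l")
      case ne: False
      then show ?thesis using T_closed[OF x, of i l] T_lower[OF x' l] xi il iN by simp
    qed (use xi in simp)
  qed
  show ?thesis using le[OF x x' eq] le[OF x' x eq[symmetric]] by (intro T_eqI[OF x x'] antisym)
qed

lemma rowmotion_eq:
  assumes y: "y \<in> T"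
  shows "rowmotion L y = row_vec y"
  unfolding rowmotion_def
proof (rule the_equality)
  show "row_vec y \<in> carrier L \<and> up_labels L (row_vec y) = down_labels L y"
    using labels_eq_iff(1)[OF row_vec_T[OF y] y] up_pairs_row_vec[OF y] row_vec_T[OF y] by simp
  fix x assume "x \<in> carrier L \<and> up_labels L x = down_labels L y"
  then have x: "x \<in> T" "up_pairs x = down_pairs y" using labels_eq_iff(1)[OF _ y] by auto
  then show "x = row_vec y" using up_pairs_inj[OF x(1) row_vec_T[OF y]] up_pairs_row_vec[OF y] by simp
qed

section \<open>The bijection between Tamari vectors and ballot words\<close>

text \<open>Letter \<open>i\<close> marks whether position \<open>i + 1\<close> is the minimum of its block (entry \<open>0\<close> has no block).\<close>

definition word :: "int list \<Rightarrow> bool list" where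
  "word b = map (\<lambda>i. b ! Suc i \<notin> set (take (Suc i) b)) [0..<N]"

definition cnt :: "bool list \<Rightarrow> nat \<Rightarrow> int" where
  "cnt w t = int (count_list (take t w) True)"

lemma length_word [simp]: "length (word b) = N"
  by (simp add: word_def)

lemma word_nth:
  assumes "b \<in> T" "i < N"
  shows "word b ! i \<longleftrightarrow> (\<forall>l<Suc i. b ! l \<noteq> b ! Suc i)"
  using assms not_in_take_iff[of b "Suc i"] by (simp add: word_def)

lemma cnt_Suc: "t < length w \<Longrightarrow> cnt w (Suc t) = cnt w t + of_bool (w ! t)"
  unfolding cnt_def by (simp add: count_take_Suc)

lemma cnt_mono: "t \<le> t' \<Longrightarrow> cnt w t \<le> cnt w t'"
  unfolding cnt_def by (simp add: count_take_mono)

lemma height_take: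
  assumes "t \<le> length w"
  shows "0 \<le> height m (take t w) \<longleftrightarrow> cl t \<le> cnt w t"
  unfolding height_count cl_le_iff cnt_def using assms by (simp add: algebra_simps)

lemma ballots_iff:
  "w \<in> ballots m n \<longleftrightarrow> length w = N \<and> cnt w N = int n \<and> (\<forall>t\<le>N. cl t \<le> cnt w t)"
proof -
  have "height m w = 0 \<longleftrightarrow> cnt w N = int n" if "length w = N"
  proof -
    have "height m w = (int m + 1) * cnt w N - (int m + 1) * int n"
      using that unfolding height_count cnt_def by (simp add: N_def algebra_simps)
    then show ?thesis by (simp only: right_diff_distrib[symmetric] mult_eq_0_iff) auto
  qed
  then show ?thesis unfolding ballots_def balanced_iff N_def[symmetric]
    using height_take[of _ w] by auto
qed

lemma cnt_word:
  assumes b: "b \<in> T" and t: "t \<le> N"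
  shows "cnt (word b) t = int (card ((!) b ` {1..t}))"
  using t
proof (induction t)
  case (Suc t)
  have img: "(!) b ` {1..Suc t} = insert (b ! Suc t) ((!) b ` {1..t})"
    by (auto simp: atLeastAtMostSuc_conv)
  have b0: "b ! 0 = 0" using T_mult[OF b, of 0] by simp
  have "b ! Suc t \<noteq> 0" using T_lower[OF b Suc.prems] cl_pos[of "Suc t"] by simp
  moreover have "{..<Suc t} = insert 0 {1..t}" by auto
  moreover have "word b ! t \<longleftrightarrow> b ! Suc t \<notin> (!) b ` {..<Suc t}"
    using word_nth[OF b, of t] Suc.prems by (metis Suc_le_eq image_iff lessThan_iff)
  ultimately have "word b ! t \<longleftrightarrow> b ! Suc t \<notin> (!) b ` {1..t}" using b0 by simp
  then show ?case using Suc cnt_Suc[of t "word b"] unfolding img by (simp add: card_insert_if)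
qed (simp add: cnt_def)

lemma values_subset:
  assumes b: "b \<in> T" and t: "t \<le> N"
  shows "(!) b ` {1..t} \<subseteq> {1..int n}"
proof (rule image_subsetI)
  fix l assume l: "l \<in> {1..t}"
  then have "l \<le> N" using t by simp
  then show "b ! l \<in> {1..int n}" using T_lower[OF b] T_upper[OF b] cl_pos[of l] l by force
qed

text \<open>The entry at \<open>(m + 1) * v\<close> is \<open>v\<close> itself, so all values below
  the current stretch have already occurred.\<close>

lemma values_small:
  assumes b: "b \<in> T" and t: "t \<le> N"
  shows "{1..cl t - 1} \<subseteq> (!) b ` {1..t}" "(m + 1) dvd t \<Longrightarrow> {1..cl t} \<subseteq> (!) b ` {1..t}"
proof -
  have key: "v \<in> (!) b ` {1..t}" if v: "1 \<le> v" "(m + 1) * nat v \<le> t" for v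
  proof -
    have "b ! ((m + 1) * nat v) = cl ((m + 1) * nat v)"
      by (rule T_mult[OF b le_trans[OF v(2) t] dvd_triv_left])
    then have "b ! ((m + 1) * nat v) = v" unfolding cl_mult using v by simp
    moreover have "(m + 1) * nat v \<in> {1..t}" using v by simp
    ultimately show ?thesis by (metis image_eqI)
  qed
  show "{1..cl t - 1} \<subseteq> (!) b ` {1..t}"
  proof
    fix v assume v: "v \<in> {1..cl t - 1}"
    then have "\<not> cl t \<le> int (nat v)" by simp
    then show "v \<in> (!) b ` {1..t}" using key[of v] v unfolding cl_le_mult_iff by simp
  qed
  assume d: "(m + 1) dvd t"
  show "{1..cl t} \<subseteq> (!) b ` {1..t}"
  proof
    fix v assume v: "v \<in> {1..cl t}"
    then have "cl ((m + 1) * nat v) \<le> cl t" unfolding cl_mult by simp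
    then have "(m + 1) * nat v \<le> t" by (rule cl_dvd_le[OF d])
    then show "v \<in> (!) b ` {1..t}" using key[of v] v by simp
  qed
qed

text \<open>A value \<open>v\<close> stands for the block that ends at \<open>(m + 1) * v\<close>;
  the count is that of blocks begun by \<open>t\<close> and ending after the multiple of index
  \<open>c\<close>.\<close>

lemma card_large_values:
  assumes b: "b \<in> T" and t: "t \<le> N" and c: "0 \<le> c" "{1..c} \<subseteq> (!) b ` {1..t}"
  shows "int (card {v \<in> (!) b ` {1..t}. c < v}) = cnt (word b) t - c"
proof -
  have "(!) b ` {1..t} = {1..c} \<union> {v \<in> (!) b ` {1..t}. c < v}"
    using c values_subset[OF b t] by force
  moreover have "card ({1..c} \<union> {v \<in> (!) b ` {1..t}. c < v}) = nat c + card {v \<in> (!) b ` {1..t}. c < v}"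
    by (subst card_Un_disjoint) auto
  ultimately show ?thesis using cnt_word[OF b t] c by simp
qed

lemma word_ballots:
  assumes b: "b \<in> T"
  shows "word b \<in> ballots m n"
  unfolding ballots_iff
proof (intro conjI allI impI)
  fix t assume t: "t \<le> N"
  show "cl t \<le> cnt (word b) t"
  proof (cases "t = 0")
    case False
    \<comment> \<open>Besides the values \<open>1..cl t - 1\<close>, the entry at \<open>t\<close>
      supplies one more, as it is at least \<open>cl t\<close>.\<close>
    have "insert (b ! t) {1..cl t - 1} \<subseteq> (!) b ` {1..t}" using values_small(1)[OF b t] False by auto
    then have "card (insert (b ! t) {1..cl t - 1}) \<le> card ((!) b ` {1..t})" by (intro card_mono) simp_all
    moreover have "b ! t \<notin> {1..cl t - 1}" using T_lower[OF b t] by simp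
    ultimately show ?thesis using cnt_word[OF b t] cl_pos[of t] False by simp
  qed (simp add: cnt_def)
next
  have "(m + 1) dvd N" "cl N = int n" unfolding N_def by (rule dvd_triv_left, rule cl_mult)
  then have "(!) b ` {1..N} = {1..int n}"
    using values_small(2)[OF b order_refl] values_subset[OF b order_refl] by auto
  then show "cnt (word b) N = int n" using cnt_word[OF b order_refl] by simp
qed simp

text \<open>Together these recover \<open>b ! l\<close> from the word, as the least
  \<open>a \<ge> cl l\<close> at which the number of open blocks falls below the number open at
  \<open>l\<close>. The block of \<open>l\<close> is innermost among the latter, so it is the first
  of them to close.\<close>

lemma block_char:
  assumes b: "b \<in> T" and l: "1 \<le> l" "l \<le> N"
  shows "cnt (word b) ((m + 1) * nat (b ! l)) - b ! l \<le> cnt (word b) l - cl l"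
    and "cl l \<le> a \<Longrightarrow> a < b ! l \<Longrightarrow> cnt (word b) l - cl l < cnt (word b) ((m + 1) * nat a) - a"
proof -
  have cl1: "1 \<le> cl l" using cl_pos[of l] l by simp
  have open_l: "int (card {v \<in> (!) b ` {1..l}. cl l - 1 < v}) = cnt (word b) l - (cl l - 1)"
    using card_large_values[OF b l(2) _ values_small(1)[OF b l(2)]] cl1 by simp
  have open_mult: "int (card {v \<in> (!) b ` {1..(m + 1) * nat a}. a < v}) = cnt (word b) ((m + 1) * nat a) - a"
    if "0 \<le> a" "a \<le> int n" for a
  proof -
    have t: "(m + 1) * nat a \<le> N" unfolding N_def using that by (intro mult_le_mono2) simp
    have "cl ((m + 1) * nat a) = a" using cl_mult[of "nat a"] that by simp
    then have "{1..a} \<subseteq> (!) b ` {1..(m + 1) * nat a}"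
      using values_small(2)[OF b t dvd_triv_left] by (simp only:)
    then show ?thesis using card_large_values[OF b t that(1)] by simp
  qed
  have bl: "cl l \<le> b ! l" "b ! l \<le> int n" using T_lower[OF b l(2)] T_upper[OF b l(2)] .
  let ?A = "{v \<in> (!) b ` {1..(m + 1) * nat (b ! l)}. b ! l < v}"
  let ?B = "{v \<in> (!) b ` {1..l}. cl l - 1 < v}"
  have "?A \<subseteq> ?B - {b ! l}"
  proof
    fix v assume "v \<in> ?A"
    then obtain j where j: "1 \<le> j" "j \<le> (m + 1) * nat (b ! l)" "v = b ! j" "b ! l < b ! j" by auto
    have "cl j \<le> int (nat (b ! l))" unfolding cl_le_mult_iff by (rule j(2))
    then have "cl j \<le> b ! l" using bl cl1 by simp
    then have "\<not> l < j" using T_closed[OF b _ l(2), of j] j(4) by auto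
    then show "v \<in> ?B - {b ! l}" using j bl by auto
  qed
  then have "card ?A \<le> card (?B - {b ! l})" by (intro card_mono) simp_all
  also have "\<dots> < card ?B" using l bl by (intro psubset_card_mono) auto
  finally have "int (card ?A) \<le> int (card ?B) - 1" by simp
  then show "cnt (word b) ((m + 1) * nat (b ! l)) - b ! l \<le> cnt (word b) l - cl l"
    using open_l open_mult[of "b ! l"] bl cl1 by simp
  assume a: "cl l \<le> a" "a < b ! l"
  have la: "l \<le> (m + 1) * nat a" using a cl1 cl_le_mult_iff[of l "nat a"] by simp
  have "?B \<subseteq> {v \<in> (!) b ` {1..(m + 1) * nat a}. a < v}"
  proof
    fix v assume "v \<in> ?B"
    then obtain j where j: "1 \<le> j" "j \<le> l" "v = b ! j" "cl l \<le> b ! j" by auto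
    have "b ! l \<le> b ! j"
    proof (cases "j = l")
      case False
      then show ?thesis using T_closed[OF b, of j l] j l by simp
    qed simp
    then show "v \<in> {v \<in> (!) b ` {1..(m + 1) * nat a}. a < v}" using j a la by auto
  qed
  then have "card ?B \<le> card {v \<in> (!) b ` {1..(m + 1) * nat a}. a < v}" by (intro card_mono) simp_all
  then show "cnt (word b) l - cl l < cnt (word b) ((m + 1) * nat a) - a"
    using open_l open_mult[of a] a bl cl1 by simp
qed

lemma word_inj:
  assumes b: "b \<in> T" "b' \<in> T" and eq: "word b = word b'"
  shows "b = b'"
proof -
  have le: "b ! l \<le> b' ! l" if b: "b \<in> T" "b' \<in> T" "word b = word b'" and l: "1 \<le> l" "l \<le> N" for b b' l
  proof (rule ccontr)
    assume "\<not> b ! l \<le> b' ! l"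
    then show False
      using block_char(2)[OF b(1) l, of "b' ! l"] block_char(1)[OF b(2) l] T_lower[OF b(2) l(2)] b(3) by simp
  qed
  show ?thesis
  proof (rule T_eqI[OF b])
    fix l assume l: "l \<le> N"
    show "b ! l = b' ! l"
    proof (cases "l = 0")
      case True
      then show ?thesis using T_mult[OF b(1), of 0] T_mult[OF b(2), of 0] by simp
    next
      case False
      then show ?thesis using le[OF b eq, of l] le[OF b(2,1) eq[symmetric], of l] l by simp
    qed
  qed
qed

text \<open>Reverses \<open>block_char\<close>: \<open>F a\<close> plays the number of blocks open
  after the multiple of index \<open>a\<close>, \<open>E l\<close> the number open at
  \<open>l\<close> besides its own, and entry \<open>l\<close> is the first \<open>a\<close> with
  \<open>F a \<le> E l\<close>.\<close>

lemma word_surj: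
  assumes w: "w \<in> ballots m n"
  obtains b where "b \<in> T" "word b = w"
proof -
  have len: "length w = N" and total: "cnt w N = int n" and ballot: "\<And>t. t \<le> N \<Longrightarrow> cl t \<le> cnt w t"
    using w unfolding ballots_iff by auto
  define F where "F a = cnt w ((m + 1) * a) - int a" for a
  define E where "E l = cnt w l - cl l" for l
  define P where "P l a \<longleftrightarrow> cl l \<le> int a \<and> F a \<le> E l" for l a
  define c where "c l = (LEAST a. P l a)" for l
  define b where "b = map (\<lambda>l. int (c l)) [0..<N + 1]"
  have nth: "b ! l = int (c l)" if "l \<le> N" for l using that by (simp add: b_def nth_map_upt del: upt_Suc)
  have "P l n" if "l \<le> N" for l
    using that ballot[OF that] total cl_le_n_iff[of l] unfolding P_def F_def E_def N_def[symmetric] by simp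
  then have c: "P l (c l)" "c l \<le> n" if "l \<le> N" for l
    unfolding c_def using that by (auto intro: LeastI Least_le)
  have c_min: "\<not> P l a" if "a < c l" for l a
    using not_less_Least[of a "P l"] that unfolding c_def by blast
  have c_le: "c l \<le> a" if "P l a" for l a using Least_le[of "P l" a] that unfolding c_def by simp
  have above: "E l < F a" if "cl l \<le> int a" "a < c l" for l a
    using c_min[OF that(2)] that(1) unfolding P_def by simp
  have before: "\<exists>a. cl l = int a + 1 \<and> (m + 1) * a < l" if "0 < l" for l
  proof -
    have "cl l = int (nat (cl l - 1)) + 1" using cl_pos[OF that] by simp
    moreover have "\<not> cl l \<le> int (nat (cl l - 1))" using cl_pos[OF that] by simp
    ultimately show ?thesis unfolding cl_le_mult_iff by (metis not_le)
  qed
  have bT: "b \<in> T"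
  proof (rule T_I)
    show "length b = N + 1" by (simp add: b_def)
    show "b ! l = cl l" if l: "l \<le> N" "(m + 1) dvd l" for l
    proof -
      obtain a where a: "l = (m + 1) * a" using l(2) by blast
      have "P l a" unfolding P_def F_def E_def a cl_mult by simp
      then have "c l \<le> a" by (rule c_le)
      moreover have "int a \<le> int (c l)" using c(1)[OF l(1)] unfolding P_def a cl_mult by simp
      ultimately show ?thesis using nth[OF l(1)] unfolding a cl_mult by simp
    qed
    show "cl l \<le> b ! l" if "l \<le> N" for l using c(1)[OF that] nth[OF that] unfolding P_def by simp
    show "b ! l \<le> int n" if "l \<le> N" for l using c(2)[OF that] nth[OF that] by simp
    show "b ! j \<le> b ! l" if lj: "l < j" "j \<le> N" "cl j \<le> b ! l" for l j
    proof -
      have l: "l \<le> N" using lj by simp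
      have cj: "cl j \<le> int (c l)" using lj(3) nth[OF l] by simp
      have "E l \<le> E j"
      proof (cases "cl j = cl l")
        case True
        then show ?thesis using cnt_mono[of l j w] lj unfolding E_def by simp
      next
        case False
        then have lt: "cl l < cl j" using cl_mono[of l j] lj by simp
        obtain a where a: "cl j = int a + 1" "(m + 1) * a < j" using before[of j] lj by auto
        have "E l < F a" by (rule above) (use a lt cj in auto)
        also have "F a \<le> E j + 1" using cnt_mono[of "(m + 1) * a" j w] a unfolding F_def E_def by simp
        finally show ?thesis by simp
      qed
      then have "P j (c l)" using c(1)[OF l] cj unfolding P_def by simp
      then show ?thesis using c_le nth[OF l] nth[OF lj(2)] by simp
    qed
  qed
  \<comment> \<open>\<open>F\<close> drops by at most one per step, so at the first crossing it
    meets \<open>E l\<close> exactly.\<close>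
  have level: "F (c l) = E l" if l: "0 < l" "l \<le> N" for l
  proof (rule antisym)
    show "F (c l) \<le> E l" using c(1)[OF l(2)] unfolding P_def by simp
    have cl: "cl l \<le> int (c l)" using c(1)[OF l(2)] unfolding P_def by simp
    show "E l \<le> F (c l)"
    proof (cases "cl l = int (c l)")
      case True
      then have "l \<le> (m + 1) * c l" using cl_le_mult_iff[of l "c l"] by simp
      then show ?thesis using cnt_mono[of l "(m + 1) * c l" w] True unfolding E_def F_def by simp
    next
      case False
      then have lt: "cl l \<le> int (c l - 1)" "c l - 1 < c l" using cl cl_pos[OF l(1)] by auto
      have "E l < F (c l - 1)" by (rule above[OF lt])
      also have "F (c l - 1) \<le> F (c l) + 1"
      proof -
        have "cnt w ((m + 1) * (c l - 1)) \<le> cnt w ((m + 1) * c l)"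
          by (rule cnt_mono, rule mult_le_mono2) simp
        then show ?thesis using lt(2) unfolding F_def by linarith
      qed
      finally show ?thesis by simp
    qed
  qed
  \<comment> \<open>A \<open>True\<close> letter must begin a new block: an equal earlier entry
    would have the same level, although the count has just gone up.\<close>
  have first: "b ! j \<noteq> b ! Suc i" if i: "i < N" "w ! i" and j: "j < Suc i" for i j
  proof
    assume eq: "b ! j = b ! Suc i"
    have iN: "Suc i \<le> N" "j \<le> N" using i j by auto
    have step: "cnt w (Suc i) = cnt w i + 1" using cnt_Suc[of i w] i len by simp
    have j0: "0 < j"
      using eq T_mult[OF bT, of 0] T_lower[OF bT iN(1)] cl_pos[of "Suc i"] by (cases j) auto
    have cc: "c j = c (Suc i)" using eq nth iN by simp
    then have EE: "E j = E (Suc i)" using level[of j] level[of "Suc i"] iN j0 by simp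
    show False
    proof (cases "cl j = cl (Suc i)")
      case True
      then show False using EE step cnt_mono[of j i w] j unfolding E_def by simp
    next
      case False
      then have lt: "cl j < cl (Suc i)" using cl_mono[of j "Suc i"] j by simp
      obtain a where a: "cl (Suc i) = int a + 1" "(m + 1) * a < Suc i" using before[of "Suc i"] by auto
      have "cl (Suc i) \<le> int (c j)" using c(1)[OF iN(1)] cc unfolding P_def by simp
      then have "E j < F a" by (intro above) (use a lt in auto)
      then have "cnt w (Suc i) < cnt w ((m + 1) * a) + 1" using EE a unfolding E_def F_def by simp
      then show False using step cnt_mono[of "(m + 1) * a" i w] a by simp
    qed
  qed
  have "w = word b"
  proof (rule eq_if_imp_count)
    show "length w = length (word b)" using len by simp
    show "word b ! i" if "i < length w" "w ! i" for i
      using word_nth[OF bT, of i] first[of i] that len by simp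
    show "count_list (word b) True \<le> count_list w True"
      using ballots_count word_ballots[OF bT] w by simp
  qed
  then show ?thesis using bT that by blast
qed

lemma word_bij: "bij_betw word T (ballots m n)"
  by (rule bij_betwI') (use word_inj word_ballots word_surj in metis)+

text \<open>If \<open>l\<close> is not a multiple of \<open>m + 1\<close>, entry \<open>l\<close>
  exceeds entry \<open>Suc l\<close> and can be lowered, so \<open>l\<close> is the index of a pair.
  If \<open>l = (m + 1) * a\<close>, an earlier value \<open>a\<close> would come from a pair
  \<open>(i, a)\<close>; but entry \<open>i\<close> could also be lowered to the larger
  \<open>y ! Suc l\<close>, contrary to maximality.\<close>

lemma first_row_vec:
  assumes y: "y \<in> T" and l: "1 \<le> l" "l < N" and first: "word y ! l"
  shows "word (row_vec y) ! (l - 1)"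
proof -
  note x = row_vec_T[OF y]
  have f: "\<And>j. j < Suc l \<Longrightarrow> y ! j \<noteq> y ! Suc l" using first word_nth[OF y l(2)] by auto
  have lN: "l \<le> N" "Suc l \<le> N" using l by auto
  have "row_vec y ! l \<notin> set (take l (row_vec y))"
  proof (cases "(m + 1) dvd l")
    case False
    have "cl (Suc l) \<le> y ! l" by (rule cl_Suc_le[OF False T_lower[OF y lN(1)]])
    then have lt: "y ! Suc l < y ! l" using T_closed[OF y, of l "Suc l"] f[of l] lN by simp
    have cl_eq: "cl l \<le> y ! Suc l" using cl_mono[of l "Suc l"] T_lower[OF y lN(2)] by simp
    have "lowers y l (y ! Suc l)" unfolding lowers_def
    proof (intro conjI allI impI)
      fix j assume j: "l < j" "cl j \<le> y ! Suc l"
      show "y ! j \<le> y ! Suc l"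
      proof (cases "j = Suc l")
        case False
        then show ?thesis using T_closed[OF y _ lN(2) j(2)] j(1) by simp
      qed simp
    qed (use lN False cl_eq lt in auto)
    then obtain c where "max_lowers y l c" using lowers_max by metis
    then show ?thesis using max_lowers_nth_row_vec[OF y] by blast
  next
    case True
    then obtain a where a: "l = (m + 1) * a" by blast
    have xl: "row_vec y ! l = int a" using row_vec_mult[OF lN(1) True] unfolding a cl_mult .
    have an: "int a < int n" using l(2) unfolding a N_def by (simp only: mult_less_cancel1 of_nat_less_iff)
    have "row_vec y ! j \<noteq> int a" if j: "j < l" for j
    proof
      assume xj: "row_vec y ! j = int a"
      have jN: "j \<le> N" using j lN by simp
      have nd: "\<not> (m + 1) dvd j"
      proof
        assume "(m + 1) dvd j"
        then have "cl l \<le> cl j" using row_vec_mult[OF jN, of y] xj a cl_mult[of a] by simp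
        then show False using cl_dvd_le[OF \<open>(m + 1) dvd j\<close>, of l] j by simp
      qed
      obtain i where ml: "max_lowers y i (int a)" "i \<le> j" using row_vec_cases[OF y jN nd] xj an by auto
      then have i: "i \<le> N" "\<not> (m + 1) dvd i" "int a < y ! i" "\<And>l. i < l \<Longrightarrow> cl l \<le> int a \<Longrightarrow> y ! l \<le> int a"
        by (auto simp: max_lowers_def lowers_def)
      have clS: "cl (Suc l) = int a + 1" unfolding a by (rule cl_Suc_mult)
      have "y ! Suc l \<le> y ! i" using T_closed[OF y, of i "Suc l"] i clS ml j by simp
      moreover have "y ! Suc l \<noteq> y ! i" using f[of i] ml j by simp
      ultimately have lt: "y ! Suc l < y ! i" by simp
      have gt: "int a < y ! Suc l" using T_lower[OF y lN(2)] clS by simp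
      have "lowers y i (y ! Suc l)" unfolding lowers_def
      proof (intro conjI allI impI)
        show "cl i \<le> y ! Suc l"
          using cl_mono[of i "Suc l"] T_lower[OF y lN(2)] ml j by simp
        fix t assume t: "i < t" "cl t \<le> y ! Suc l"
        consider "t \<le> l" | "t = Suc l" | "Suc l < t" by linarith
        then show "y ! t \<le> y ! Suc l"
        proof cases
          case 1
          then have "cl t \<le> int a" unfolding cl_le_mult_iff a .
          then show ?thesis using i(4)[OF t(1)] gt by simp
        next
          case 3
          then show ?thesis using T_closed[OF y _ lN(2) t(2)] by simp
        qed simp
      qed (use i lt in auto)
      then show False using ml(1) gt unfolding max_lowers_def by blast
    qed
    then show ?thesis using not_in_take_iff[OF x lN(1)] xl by simp
  qed
  then show ?thesis using word_nth[OF x, of "l - 1"] not_in_take_iff[OF x lN(1)] l by simp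
qed

end

lemma count_take_card:
  assumes "t \<le> length w"
  shows "count_list (take t w) True = card {i. i < t \<and> w ! i}"
proof -
  have "count_list (take t w) True = card {i. i < length (take t w) \<and> take t w ! i}"
    by (simp add: count_list_eq_length_filter length_filter_conv_card eq_commute[of True])
  also have "{i. i < length (take t w) \<and> take t w ! i} = {i. i < t \<and> w ! i}" using assms by auto
  finally show ?thesis .
qed

context m_tamari
begin

text \<open>A partial converse of \<open>first_row_vec\<close>; value \<open>n\<close> is set aside
  because it may be the default instead of the value of a pair. If \<open>q = (m + 1) * a\<close>
  and \<open>y ! Suc q\<close> occurred earlier, its last occurrence \<open>i\<close> would have the
  pair \<open>(i, a)\<close>, so the image would take the value \<open>a\<close> already before
  \<open>q\<close>.\<close>

lemma row_vec_first:
  assumes y: "y \<in> T" and q: "1 \<le> q" "q < N" and first: "word (row_vec y) ! (q - 1)"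
    and less: "row_vec y ! q < int n"
  shows "word y ! q"
proof -
  note x = row_vec_T[OF y]
  have qN: "q \<le> N" "Suc q \<le> N" using q by auto
  have fx: "\<And>l. l < q \<Longrightarrow> row_vec y ! l \<noteq> row_vec y ! q"
    using first word_nth[OF x, of "q - 1"] q by auto
  have "y ! l \<noteq> y ! Suc q" if l: "l < Suc q" for l
  proof (cases "(m + 1) dvd q")
    case False
    then have "(q, row_vec y ! q) \<in> up_pairs (row_vec y)"
      using qN less fx not_in_take_iff[OF x qN(1)] unfolding up_pairs_def by auto
    then have "max_lowers y q (row_vec y ! q)" using up_pairs_row_vec[OF y] by (simp add: down_pairs_def)
    then have low: "cl q \<le> row_vec y ! q" "row_vec y ! q < y ! q"
      "\<And>j. q < j \<Longrightarrow> cl j \<le> row_vec y ! q \<Longrightarrow> y ! j \<le> row_vec y ! q"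
      by (auto simp: max_lowers_def lowers_def)
    have "cl (Suc q) \<le> row_vec y ! q" by (rule cl_Suc_le[OF False low(1)])
    then have lt: "y ! Suc q < y ! q" using low(2) low(3)[of "Suc q"] by simp
    show ?thesis
    proof
      assume eq: "y ! l = y ! Suc q"
      then have "l < q" using l lt by (cases "l = q") auto
      moreover have "cl q \<le> y ! l" using cl_mono[of q "Suc q"] T_lower[OF y qN(2)] eq by simp
      ultimately show False using T_closed[OF y, of l q] eq lt qN by simp
    qed
  next
    case True
    then obtain a where a: "q = (m + 1) * a" by blast
    have xq: "row_vec y ! q = int a" using row_vec_mult[OF qN(1) True] unfolding a cl_mult .
    have clS: "cl (Suc q) = int a + 1" unfolding a by (rule cl_Suc_mult)
    have gt: "int a < y ! Suc q" using T_lower[OF y qN(2)] clS by simp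
    show ?thesis
    proof
      assume eq: "y ! l = y ! Suc q"
      define I where "I = {l. l < Suc q \<and> y ! l = y ! Suc q}"
      define i where "i = Max I"
      have "finite I" "I \<noteq> {}" using eq l unfolding I_def by auto
      then have "i \<in> I" "\<And>j. j \<in> I \<Longrightarrow> j \<le> i" unfolding i_def by auto
      then have i: "i < Suc q" "y ! i = y ! Suc q" "\<And>j. i < j \<Longrightarrow> j < Suc q \<Longrightarrow> y ! j \<noteq> y ! Suc q"
        unfolding I_def using leD by blast+
      have yq: "y ! q = int a" using T_mult[OF y qN(1) True] unfolding a cl_mult .
      then have iq: "i < q" using i gt by (cases "i = q") auto
      have iN: "i \<le> N" using iq qN by simp
      have nd: "\<not> (m + 1) dvd i"
      proof
        assume "(m + 1) dvd i"
        then have "y ! i = cl i" using T_mult[OF y iN] by simp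
        also have "\<dots> \<le> cl q" using cl_mono iq by simp
        also have "\<dots> = int a" unfolding a by (rule cl_mult)
        finally show False using i gt by simp
      qed
      have "lowers y i (int a)" unfolding lowers_def
      proof (intro conjI allI impI)
        show "cl i \<le> int a" unfolding cl_le_mult_iff using iq a by simp
        fix t assume t: "i < t" "cl t \<le> int a"
        have tq: "t \<le> q" using t(2) unfolding cl_le_mult_iff a .
        then have "y ! t \<le> y ! i" using T_closed[OF y t(1) iN] t(2) gt i(2) by simp
        moreover have "y ! t \<noteq> y ! Suc q" using i(3)[OF t(1)] tq by simp
        ultimately have lt: "y ! t < y ! Suc q" using i(2) by simp
        show "y ! t \<le> int a"
        proof (rule ccontr)
          assume "\<not> y ! t \<le> int a"
          then have "y ! Suc q \<le> y ! t" using T_closed[OF y, of t "Suc q"] clS tq qN by simp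
          then show False using lt by simp
        qed
      qed (use iN nd gt i in auto)
      moreover have "\<not> lowers y i c'" if c': "int a < c'" for c'
      proof
        assume "lowers y i c'"
        then have "y ! Suc q \<le> c'" "c' < y ! i" using clS c' iq by (auto simp: lowers_def)
        then show False using i by simp
      qed
      ultimately have "max_lowers y i (int a)" unfolding max_lowers_def by blast
      then have "row_vec y ! i = int a" by (rule max_lowers_nth_row_vec(1)[OF y])
      then show False using fx[OF iq] xq by simp
    qed
  qed
  then show ?thesis using word_nth[OF y q(2)] by blast
qed

text \<open>By \<open>first_row_vec\<close> the image keeps all marks of the shifted word and has
  one more, which should sit right after \<open>A\<close>. If not, the ballot condition forces an
  extra mark at some earlier \<open>p\<close>, and by \<open>row_vec_first\<close> its entry, at
  \<open>q = Suc p\<close>, is \<open>n\<close>. Balance of \<open>A\<close> supplies at least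
  \<open>cl q\<close> marks before \<open>q\<close>. Their entries are distinct and below
  \<open>cl q\<close>, since a larger one would bound the entry \<open>n\<close> at
  \<open>q\<close>; but only \<open>cl q - 1\<close> such values exist.\<close>

lemma word_row_vec:
  assumes y: "y \<in> T"
  shows "word (row_vec y) = turn m (word y)"
proof -
  note x = row_vec_T[OF y]
  let ?W = "word (row_vec y)"
  have wb: "word y \<in> ballots m n" "?W \<in> ballots m n" using word_ballots y x by auto
  have "0 < length (word y)" using n_pos by (simp add: N_def)
  then have "word y \<noteq> []" by (rule length_greater_0_conv[THEN iffD1])
  then obtain A B where AB: "word y = True # A @ False # B" "balanced m A"
    using balanced_decomp[OF m_pos] wb unfolding ballots_def by blast
  \<comment> \<open>The word without its leading letter and with \<open>False\<close> appended,
    before any letter is flipped.\<close>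
  define v where "v = A @ False # B @ [False]"
  have lens: "length v = N" "Suc (length A) < N" using length_word[of y] AB(1) by (simp_all add: v_def)
  have v_nth: "v ! i \<longleftrightarrow> Suc i < N \<and> word y ! Suc i" if "i < N" for i
  proof -
    define t where "t = A @ False # B"
    have t: "v = t @ [False]" "length t = N - 1" "word y = True # t"
      using lens AB(1) by (simp_all add: v_def t_def)
    show ?thesis
    proof (cases "Suc i < N")
      case True
      then have "i < length t" using t by simp
      then show ?thesis using True t by (simp add: nth_append)
    next
      case False
      then have "i = length t" using t(2) that by linarith
      then have "\<not> v ! i" unfolding t(1) by simp
      then show ?thesis using False by simp
    qed
  qed
  have imp: "?W ! i" if "i < N" "v ! i" for i
    using first_row_vec[OF y, of "Suc i"] v_nth[OF that(1)] that by simp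
  have WA: "?W ! length A"
  proof (rule ccontr)
    assume nW: "\<not> ?W ! length A"
    have "\<exists>p<length A. ?W ! p \<and> \<not> v ! p"
    proof (rule ccontr)
      assume none: "\<not> (\<exists>p<length A. ?W ! p \<and> \<not> v ! p)"
      have "?W ! i = v ! i" if "i < Suc (length A)" for i
        using none nW imp[of i] that lens by (cases "i = length A") (auto simp: v_def)
      then have "take (Suc (length A)) ?W = take (Suc (length A)) v"
        using lens by (intro nth_take_lemma) simp_all
      then have "take (Suc (length A)) ?W = A @ [False]" by (simp add: v_def)
      moreover have "0 \<le> height m (take (Suc (length A)) ?W)"
        using wb(2) lens unfolding ballots_def balanced_iff by simp
      ultimately show False using balanced_height[OF AB(2)] by simp
    qed
    then obtain p where p: "p < length A" "?W ! p" "\<not> v ! p" by blast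
    define q where "q = Suc p"
    have q: "1 \<le> q" "q < N" "q \<le> N" using p(1) lens by (auto simp: q_def)
    have nq: "\<not> word y ! q" using v_nth[of p] p q by (simp add: q_def)
    have xq: "row_vec y ! q = int n"
      using row_vec_first[OF y q(1,2)] p(2) nq T_upper[OF x q(3)] unfolding q_def by force
    define I where "I = {i. i < q \<and> v ! i}"
    have "take q v = take q A" using p(1) by (simp add: v_def q_def)
    moreover have "0 \<le> height m (take q A)" using AB(2) p(1) unfolding balanced_iff q_def by simp
    ultimately have "cl q \<le> cnt v q" using height_take[of q v] lens q by simp
    also have "cnt v q = int (card I)" unfolding cnt_def I_def using count_take_card[of q v] lens q by simp
    finally have "cl q \<le> int (card I)" .
    have I: "Suc i < q" "Suc i \<le> N" "\<And>l. l < Suc i \<Longrightarrow> row_vec y ! l \<noteq> row_vec y ! Suc i" if "i \<in> I" for i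
    proof -
      have i: "i < q" "v ! i" using that by (auto simp: I_def)
      then have "i \<noteq> p" using p(3) by auto
      then show "Suc i < q" "Suc i \<le> N" using i q by (auto simp: q_def)
      have "?W ! i" using imp[of i] i q by simp
      then show "\<And>l. l < Suc i \<Longrightarrow> row_vec y ! l \<noteq> row_vec y ! Suc i" using word_nth[OF x, of i] i q by simp
    qed
    have fq: "row_vec y ! l \<noteq> int n" if "l < q" for l
      using word_nth[OF x, of p] p(2) q that xq by (simp add: q_def)
    have "inj_on (\<lambda>i. row_vec y ! Suc i) I"
    proof (rule linorder_inj_onI)
      fix i j assume "i < j" "i \<in> I" "j \<in> I"
      then show "row_vec y ! Suc i \<noteq> row_vec y ! Suc j" using I(3)[of j "Suc i"] by simp
    qed auto
    moreover have "(\<lambda>i. row_vec y ! Suc i) ` I \<subseteq> {1..cl q - 1}"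
    proof (rule image_subsetI)
      fix i assume i: "i \<in> I"
      have "1 \<le> row_vec y ! Suc i" using T_lower[OF x I(2)[OF i]] cl_pos[of "Suc i"] by simp
      moreover have "\<not> cl q \<le> row_vec y ! Suc i"
      proof
        assume "cl q \<le> row_vec y ! Suc i"
        then have "int n \<le> row_vec y ! Suc i" using T_closed[OF x I(1)[OF i] I(2)[OF i]] xq by simp
        then show False using T_upper[OF x I(2)[OF i]] fq[OF I(1)[OF i]] by simp
      qed
      ultimately show "row_vec y ! Suc i \<in> {1..cl q - 1}" by simp
    qed
    ultimately have "card I \<le> card {1..cl q - 1}" using card_inj_on_le by blast
    then show False using \<open>cl q \<le> int (card I)\<close> cl_pos[of q] q by simp
  qed
  have "turn m (word y) = A @ True # B @ [False]" unfolding AB(1) by (rule turn_eq[OF AB(2)])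
  also have "\<dots> = ?W"
  proof (rule eq_if_imp_count)
    show "length (A @ True # B @ [False]) = length ?W" using lens by (simp add: v_def)
    show "?W ! i" if "i < length (A @ True # B @ [False])" "(A @ True # B @ [False]) ! i" for i
    proof (cases "i = length A")
      case False
      then consider "i < length A" | k where "i = length A + Suc k"
        by (metis less_imp_Suc_add linorder_neqE_nat add_Suc_right)
      then have "v ! i" using that by cases (simp_all add: v_def nth_append)
      then show ?thesis using imp[of i] that lens by (simp add: v_def)
    qed (use WA in simp)
    have "count_list (word y) True = n" "count_list ?W True = n" using ballots_count wb by auto
    then show "count_list ?W True \<le> count_list (A @ True # B @ [False]) True" using AB(1) by simp
  qed
  finally show ?thesis by simp
qed

section \<open>Transfer of iterates and fixed points from words to vectors\<close>

abbreviation row :: "int list \<Rightarrow> int list" where "row \<equiv> rowmotion L"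

lemma row_closed: "y \<in> T \<Longrightarrow> row y \<in> T"
  using rowmotion_eq row_vec_T by simp

lemma row_pow:
  assumes "y \<in> T"
  shows "(row ^^ j) y \<in> T" "word ((row ^^ j) y) = (turn m ^^ j) (word y)"
proof (induction j)
  case (Suc j)
  { case 1 show ?case using Suc row_closed by simp }
  { case 2 show ?case using Suc word_row_vec rowmotion_eq by simp }
qed (use assms in simp_all)

lemma row_pow_fixed_iff: "y \<in> T \<Longrightarrow> (row ^^ j) y = y \<longleftrightarrow> (turn m ^^ j) (word y) = word y"
  using row_pow[of y j] word_inj[of "(row ^^ j) y" y] by metis

lemma card_row_fixed: "card {y \<in> T. (row ^^ j) y = y} = card {w \<in> ballots m n. (turn m ^^ j) w = w}"
proof (rule bij_betw_same_card[where f = word], rule bij_betwI')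
  show "word x = word y \<longleftrightarrow> x = y" if "x \<in> {y \<in> T. (row ^^ j) y = y}" "y \<in> {y \<in> T. (row ^^ j) y = y}" for x y
    using word_inj that by blast
  show "word x \<in> {w \<in> ballots m n. (turn m ^^ j) w = w}" if "x \<in> {y \<in> T. (row ^^ j) y = y}" for x
    using that word_ballots[of x] row_pow_fixed_iff[of x j] by blast
  show "\<exists>x\<in>{y \<in> T. (row ^^ j) y = y}. w = word x" if w: "w \<in> {w \<in> ballots m n. (turn m ^^ j) w = w}" for w
  proof -
    obtain b where "b \<in> T" "word b = w" using word_surj w by blast
    then show ?thesis using row_pow_fixed_iff w by auto
  qed
qed

lemma finite_T: "finite T"
  using bij_betw_finite[OF word_bij] finite_ballots by simp

lemma row_bij: "bij_betw row T T"
proof -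
  have "inj_on row T"
  proof (rule inj_onI)
    fix y y' assume y: "y \<in> T" "y' \<in> T" and "row y = row y'"
    then have "turn m (word y) = turn m (word y')" using word_row_vec rowmotion_eq by metis
    then have "(turn m ^^ 1) (word y) = (turn m ^^ 1) (word y')" by simp
    then have "word y = word y'" using turn_pow_inj[OF m_pos] word_ballots y by blast
    then show "y = y'" using word_inj y by blast
  qed
  moreover have "row ` T \<subseteq> T" using row_closed by blast
  ultimately show ?thesis unfolding bij_betw_def using endo_inj_surj finite_T by blast
qed

lemma row_period: "y \<in> T \<Longrightarrow> (row ^^ N) y = y"
  using row_pow_fixed_iff ballots_period[OF m_pos word_ballots, of y N] by (simp add: N_def)

end

section \<open>No smaller period when n is at least 3\<close>

lemma wrap_balanced:
  assumes A: "balanced m A"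
  shows "balanced m (True # A @ replicate m False)"
proof -
  have rep: "height m (replicate k False) = - int k" for k by (induction k) simp_all
  have "0 \<le> height m u" if "True # A @ replicate m False = u @ v" for u v
  proof (cases u)
    case (Cons x p)
    then have x: "x" and p: "A @ replicate m False = p @ v" using that by auto
    consider r where "A = p @ r" | r where "p = A @ r" "replicate m False = r @ v"
      using p by (auto simp: append_eq_append_conv2)
    then have "- int m \<le> height m p"
    proof cases
      case 1
      then show ?thesis using balanced_prefix A by force
    next
      case 2
      have "length r \<le> m" "r = replicate (length r) False"
        using arg_cong[OF 2(2), of length] arg_cong[OF 2(2), of "take (length r)"] by simp_all
      then show ?thesis using 2(1) balanced_height[OF A] rep[of "length r"] by simp
    qed
    then show ?thesis using Cons x by simp
  qed simp
  then show ?thesis unfolding balanced_def using balanced_height[OF A] rep by simp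
qed

text \<open>With \<open>A\<close> empty, a turn just moves one \<open>False\<close> of the leading
  run to the end.\<close>

lemma turn_pow_peak:
  assumes "r \<le> s"
  shows "(turn m ^^ r) (True # replicate s False @ V) = True # replicate (s - r) False @ V @ replicate r False"
  using assms
proof (induction r)
  case (Suc r)
  then have "s - r = Suc (s - Suc r)" by simp
  then have "(turn m ^^ Suc r) (True # replicate s False @ V)
      = turn m (True # [] @ False # (replicate (s - Suc r) False @ V @ replicate r False))"
    using Suc by simp
  also have "\<dots> = True # replicate (s - Suc r) False @ V @ replicate r False @ [False]"
    by (subst turn_eq) simp_all
  finally show ?case by (simp add: replicate_append_same)
qed simp

text \<open>Two test words suffice. On \<open>U n\<close>, a remainder \<open>r\<close> of
  \<open>k\<close> modulo \<open>m + 1\<close> would shorten the leading run, so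
  \<open>k = (m + 1) * c\<close>. On \<open>D @ U (n - 2)\<close>, the rotation brings a copy of
  \<open>u\<close> to the front, whose second letter is \<open>False\<close> and not
  \<open>True\<close> as in \<open>D\<close>.\<close>

lemma turn_pow_moves:
  assumes m: "0 < m" and n: "3 \<le> n" and k: "0 < k" "k < (m + 1) * n"
  shows "\<exists>w\<in>ballots m n. (turn m ^^ k) w \<noteq> w"
proof (rule ccontr)
  assume "\<not> (\<exists>w\<in>ballots m n. (turn m ^^ k) w \<noteq> w)"
  then have fixed: "\<And>w. w \<in> ballots m n \<Longrightarrow> (turn m ^^ k) w = w" by blast
  define u where "u = True # replicate m False"
  define U where "U j = concat (replicate j u)" for j
  have u: "balanced m u" "length u = m + 1" using wrap_balanced[of m "[]"] by (simp_all add: u_def)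
  have U_bal: "balanced m (U j)" "length (U j) = (m + 1) * j" for j
    by (induction j) (use u balanced_append in \<open>simp_all add: U_def\<close>)
  have U_Suc: "U (Suc j) = u @ U j" for j by (simp add: U_def)
  have U_add: "U (i + j) = U i @ U j" for i j by (simp add: U_def replicate_add)
  define c r where "c = k div (m + 1)" and "r = k mod (m + 1)"
  have kcr: "k = r + (m + 1) * c" unfolding c_def r_def by (simp only: mod_mult_div_eq)
  have "(m + 1) * c < (m + 1) * n" using k kcr by linarith
  then have cn: "c < n" by (simp only: mult_less_cancel1)
  have "r = 0"
  proof (rule ccontr)
    assume "r \<noteq> 0"
    have rm: "r \<le> m" unfolding r_def using mod_less_divisor[of "m + 1" k] by simp
    have "U n \<in> ballots m n" using U_bal by (simp add: ballots_def)
    then have "U n = (turn m ^^ k) (U n)" using fixed by simp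
    also have "\<dots> = (turn m ^^ r) ((turn m ^^ ((m + 1) * c)) (U n))"
      unfolding kcr funpow_add by simp
    also have "(turn m ^^ ((m + 1) * c)) (U n) = U n"
      using turn_pow_append[OF m U_bal(1) U_bal(1), of c "n - c"] U_add[of c "n - c"] U_add[of "n - c" c] U_bal(2)[of c] cn
      by simp
    also have "U n = True # replicate m False @ U (n - 1)"
      using n by (cases n) (simp_all add: U_def u_def)
    finally have eq: "True # replicate m False @ U (n - 1) = True # replicate (m - r) False @ U (n - 1) @ replicate r False"
      unfolding turn_pow_peak[OF rm] .
    have "n - 1 = Suc (n - 2)" using n by simp
    then have "U (n - 1) = u @ U (n - 2)" using U_Suc by metis
    moreover have "(replicate m False @ U (n - 1)) ! (m - r) = (replicate (m - r) False @ U (n - 1) @ replicate r False) ! (m - r)"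
      using eq by simp
    ultimately show False using \<open>r \<noteq> 0\<close> rm by (simp add: nth_append u_def)
  qed
  then have kc: "k = (m + 1) * c" and c: "0 < c" using kcr k by auto
  define D where "D = True # u @ replicate m False"
  have D: "balanced m D" "length D = (m + 1) * 2" unfolding D_def using wrap_balanced u by simp_all
  define w where "w = D @ U (n - 2)"
  have "2 + (n - 2) = n" using n by simp
  then have "(m + 1) * 2 + (m + 1) * (n - 2) = (m + 1) * n" by (metis add_mult_distrib2)
  then have w: "w \<in> ballots m n" unfolding w_def ballots_def using D U_bal balanced_append by simp
  have move: "(turn m ^^ ((m + 1) * (2 + j))) w = U (n - 2 - j) @ D @ U j" if "j \<le> n - 2" for j
  proof -
    have "(turn m ^^ ((m + 1) * (2 + j))) w = (turn m ^^ ((m + 1) * j)) ((turn m ^^ length D) w)"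
      unfolding D(2) by (simp only: add_mult_distrib2 add.commute[of "(m + 1) * 2"] funpow_add comp_apply)
    also have "(turn m ^^ length D) w = U (n - 2) @ D"
      unfolding w_def by (rule turn_pow_append[OF m D(1) U_bal(1)])
    also have "U (n - 2) = U j @ U (n - 2 - j)"
      using U_add[of j "n - 2 - j"] le_add_diff_inverse[OF that] by (simp only:)
    also have "(U j @ U (n - 2 - j)) @ D = U j @ (U (n - 2 - j) @ D)" by simp
    also have "(turn m ^^ ((m + 1) * j)) \<dots> = (U (n - 2 - j) @ D) @ U j"
      unfolding U_bal(2)[symmetric] by (rule turn_pow_append[OF m U_bal(1) balanced_append[OF U_bal(1) D(1)]])
    finally show ?thesis by simp
  qed
  have impossible: "(turn m ^^ ((m + 1) * (2 + j))) w \<noteq> w" if j: "j + 2 < n" for j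
  proof
    assume eq: "(turn m ^^ ((m + 1) * (2 + j))) w = w"
    have "n - 2 - j = Suc (n - 2 - j - 1)" using j by simp
    then have "U (n - 2 - j) = u @ U (n - 2 - j - 1)" using U_Suc by metis
    moreover have "w = U (n - 2 - j) @ D @ U j" using move[of j] j unfolding eq by simp
    ultimately have "w = u @ (U (n - 2 - j - 1) @ D @ U j)" by simp
    then have "w ! 1 = (u @ (U (n - 2 - j - 1) @ D @ U j)) ! 1" by (rule arg_cong)
    also have "\<dots> = u ! 1" using u(2) m by (simp add: nth_append)
    finally have "w ! 1 = u ! 1" .
    moreover have "w ! 1" by (simp add: w_def D_def u_def)
    moreover have "\<not> u ! 1" using m by (simp add: u_def)
    ultimately show False by simp
  qed
  show False
  proof (cases "c = 1")
    case True
    \<comment> \<open>For \<open>c = 1\<close> the cut would fall inside \<open>D\<close>, so the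
      power is applied twice; \<open>n \<ge> 3\<close> ensures that a factor \<open>u\<close> is
      left to come to the front.\<close>
    have "(turn m ^^ (k + k)) w = w" unfolding funpow_add comp_apply using fixed[OF w] by simp
    moreover have "k + k = (m + 1) * (2 + 0)" using True kc by simp
    ultimately show False using impossible[of 0] n by simp
  next
    case False
    then have "c = 2 + (c - 2)" "c - 2 + 2 < n" using c cn by auto
    then show False using impossible[of "c - 2"] fixed[OF w] kc by metis
  qed
qed

lemma inv_into_pow_fixed_iff:
  assumes f: "bij_betw f X X" and x: "x \<in> X"
  shows "(inv_into X f ^^ k) x = x \<longleftrightarrow> (f ^^ k) x = x"
proof -
  let ?g = "inv_into X f"
  have g: "?g y \<in> X" "f (?g y) = y" if "y \<in> X" for y
    using f that by (auto simp: bij_betw_def inv_into_into f_inv_into_f)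
  have in_X: "(?g ^^ k) x \<in> X" for k by (induction k) (use x g in auto)
  have inverse: "(f ^^ k) ((?g ^^ k) x) = x" for k
  proof (induction k)
    case (Suc k)
    have "(f ^^ Suc k) ((?g ^^ Suc k) x) = (f ^^ k) (f (?g ((?g ^^ k) x)))"
      by (simp only: funpow_Suc_right[of k f] funpow.simps(2)[of k ?g] comp_apply)
    then show ?case using g(2)[OF in_X] Suc by simp
  qed simp
  have "inj_on (f ^^ k) X" using bij_betw_funpow[OF f] by (simp add: bij_betw_def)
  then show ?thesis using inverse[of k] in_X[of k] x unfolding inj_on_def by metis
qed

lemma int_iterate_fixed_iff:
  assumes f: "bij_betw f X X" and x: "x \<in> X"
  shows "int_iterate X f d x = x \<longleftrightarrow> (f ^^ nat \<bar>d\<bar>) x = x"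
  using inv_into_pow_fixed_iff[OF assms] by (simp add: int_iterate_def)

text \<open>For \<open>n = 1\<close> there is a single vector, and for \<open>n = 2\<close> a chain
  of \<open>m + 1\<close> vectors on which rowmotion has order \<open>m + 1\<close>. Hence the
  general part takes \<open>(m + 1) * n\<close> as a period, and as the order only from
  \<open>n = 3\<close> on.\<close>

theorem theorem5p13:
  fixes m n :: nat
  assumes "m > 0" and "n > 0"
  shows "csp_with_period (tamari_vectors m n) (rowmotion (tamari_lattice m n))
           ((m + 1) * n) (q_fuss_catalan m n) \<and>
         (n \<ge> 3 \<longrightarrow>
           map_order (tamari_vectors m n) (rowmotion (tamari_lattice m n)) = (m + 1) * n \<and>
           exhibits_csp (tamari_vectors m n) (rowmotion (tamari_lattice m n)) (q_fuss_catalan m n))"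
proof -
  interpret m_tamari m n by standard (use assms in auto)
  have N: "0 < (m + 1) * n" using assms by simp
  have period: "(row ^^ ((m + 1) * n)) y = y" if "y \<in> T" for y using row_period[OF that] by (simp add: N_def)
  have fixed: "of_nat (card {x \<in> T. int_iterate T row d x = x}) =
      poly (q_fuss_catalan m n) (exp (2 * of_real pi * \<i> * of_int d / of_nat ((m + 1) * n)))" for d
  proof -
    \<comment> \<open>The powers with exponents \<open>\<bar>d\<bar>\<close> and \<open>M\<close>
      have the same fixed points, because the \<open>(m + 1) * n\<close>-th power is the
      identity.\<close>
    define M where "M = gcd (nat \<bar>d\<bar>) ((m + 1) * n)"
    have "{x \<in> T. int_iterate T row d x = x} = {x \<in> T. (row ^^ M) x = x}"
    proof -
      have "(row ^^ nat \<bar>d\<bar>) x = x \<longleftrightarrow> (row ^^ M) x = x" if x: "x \<in> T" for x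
      proof
        assume "(row ^^ nat \<bar>d\<bar>) x = x"
        then show "(row ^^ M) x = x" unfolding M_def by (rule funpow_fixed_gcd[OF _ period[OF x]])
      next
        assume fx: "(row ^^ M) x = x"
        obtain a where a: "nat \<bar>d\<bar> = M * a" unfolding M_def by (meson dvd_def gcd_dvd1)
        have "(row ^^ (i * M)) x = x" for i by (induction i) (use fx in \<open>simp_all add: funpow_add\<close>)
        from this[of a] show "(row ^^ nat \<bar>d\<bar>) x = x" unfolding a by (simp only: mult.commute)
      qed
      then show ?thesis using int_iterate_fixed_iff[OF row_bij] by auto
    qed
    then have card: "card {x \<in> T. int_iterate T row d x = x} = card {w \<in> ballots m n. (turn m ^^ M) w = w}"
      using card_row_fixed by simp
    obtain e where eM: "(m + 1) * n = e * M" unfolding M_def by (metis dvd_def gcd_dvd2 mult.commute)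
    show ?thesis
    proof (cases "1 < e")
      case True
      interpret primitive_root "exp (2 * of_real pi * \<i> * of_int d / of_nat ((m + 1) * n))" e
        by (rule primitive_root_exp[OF N eM[unfolded M_def] True])
      show ?thesis
        unfolding card card_fixed_ballots[OF assms eM True] poly_fuss_catalan[OF assms(2) eM] ..
    next
      case False
      \<comment> \<open>The case \<open>e = 1\<close>: the root of unity is 1 and every vector is
        fixed, so the claim is the total count from \<open>card_ballots\<close>.\<close>
      then have MN: "M = (m + 1) * n" using eM N by (cases e) auto
      then have "(m + 1) * n dvd nat \<bar>d\<bar>" unfolding M_def by (metis gcd_dvd1)
      then obtain i where i: "d = int ((m + 1) * n) * i" by (metis dvd_nat_abs_iff dvd_def)
      have "exp (2 * of_real pi * \<i> * of_int (int K * i) / of_nat K) = exp (\<i> * of_real (2 * pi * of_int i))"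
        if "0 < K" for K :: nat
        using that by (simp add: mult_ac)
      from this[OF N] have "exp (2 * of_real pi * \<i> * of_int d / of_nat ((m + 1) * n)) = exp (\<i> * of_real (2 * pi * of_int i))"
        unfolding i .
      also have "\<dots> = 1" by (simp only: cis_conv_exp[symmetric] cis_multiple_2pi Ints_of_int)
      finally have one: "exp (2 * of_real pi * \<i> * of_int d / of_nat ((m + 1) * n)) = 1" .
      have "{w \<in> ballots m n. (turn m ^^ M) w = w} = ballots m n"
        using ballots_period[OF assms(1), of _ n M] MN by auto
      moreover have "poly (q_fuss_catalan m n) 1 * of_nat (m * n + 1) = of_nat (card (ballots m n)) * of_nat (m * n + 1)"
        unfolding poly_fuss_catalan_1[OF assms(2)] card_ballots[OF assms, symmetric] by (rule of_nat_mult)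
      then have "poly (q_fuss_catalan m n) 1 = of_nat (card (ballots m n))"
        using of_nat_neq_0[of "m * n", where 'a = complex] by (simp del: of_nat_Suc)
      ultimately show ?thesis unfolding card one by simp
    qed
  qed
  have csp: "csp_with_period T row ((m + 1) * n) (q_fuss_catalan m n)"
    unfolding csp_with_period_def using finite_T row_bij N period fixed by blast
  moreover have "map_order T row = (m + 1) * n" if n3: "3 \<le> n"
    unfolding map_order_def
  proof (rule Least_equality)
    show "0 < (m + 1) * n \<and> (\<forall>x\<in>T. (row ^^ ((m + 1) * n)) x = x)" using N period by blast
    fix k assume k: "0 < k \<and> (\<forall>x\<in>T. (row ^^ k) x = x)"
    show "(m + 1) * n \<le> k"
    proof (rule ccontr)
      assume "\<not> (m + 1) * n \<le> k"
      then obtain w where w: "w \<in> ballots m n" "(turn m ^^ k) w \<noteq> w"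
        using turn_pow_moves[OF assms(1) n3, of k] k by auto
      then obtain b where "b \<in> T" "word b = w" using word_surj by metis
      then show False using row_pow_fixed_iff[of b k] k w by blast
    qed
  qed
  ultimately show ?thesis unfolding exhibits_csp_def by simp
qed

end
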